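(* Under the standing assumptions below, suppose in addition that $f$ is Hölder continuous, i.e. there are $C,b>0$ with $|f(x)-f(y)|\le C\|x-y\|^b$ for all $x,y\in\mathbb{R}^d$. Let $\eta_t$, $t>0$, be a Poisson process on $\mathbb{R}^d$ with intensity measure $t\mu$ and $$\widehat\xi_t=\sum_{x\in\eta_t\cap W}\delta_{2^d t\mu(\mathbf{B}(x,c(x,\eta_t)))-\log t}.$$ Then $\widehat\xi_t$ converges in distribution, as $t\to\infty$, to a Poisson process on $\mathbb{R}$ with intensity measure $M$ determined by $M([u,\infty))=e^{-u}$, $u\in\mathbb{R}$.
   Context: Standing assumptions: $\mu$ is a locally finite measure on $\mathbb{R}^d$ with density $f:\mathbb{R}^d\to[0,\infty)$; $W\subset\mathbb{R}^d$ is compact with $\mu(W)=1$; there is a bounded open set $A\supset W$ with $\inf_{x\in A}f(x)>0$ and $\sup_{x\in A}f(x)<\infty$. $\mathbf{B}(x,r)$ is the open Euclidean ball with center $x$ and radius $r$. For a locally finite counting measure $\nu$ on $\mathbb{R}^d$ and $x\in\mathbb{R}^d$, the Voronoi cell is $N(x,\nu)=\{y\in\mathbb{R}^d:\|x-y\|\le\|y-x'\|\text{ for all }x'\in\nu,\ x'\neq x\}$, and the inradius is $c(x,\nu)=\sup\{R\ge0:\mathbf{B}(x,R)\subset N(x,\nu)\}$. *)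

theory Defs
  imports "HOL-Probability.Probability"
begin

text \<open>Counting measures on a Euclidean space are represented by their multiplicity
  functions \<open>\<nu> :: 'b \<Rightarrow> nat\<close>; the atoms of \<open>\<nu>\<close> are the points with nonzero multiplicity.\<close>

definition cm_support :: "('b \<Rightarrow> nat) \<Rightarrow> 'b set" where
  "cm_support \<nu> = {x. \<nu> x \<noteq> 0}"

definition locally_finite_cm :: "('b::euclidean_space \<Rightarrow> nat) \<Rightarrow> bool" where
  "locally_finite_cm \<nu> \<longleftrightarrow> (\<forall>B. bounded B \<longrightarrow> finite (B \<inter> cm_support \<nu>))"

definition cm_count :: "('b \<Rightarrow> nat) \<Rightarrow> 'b set \<Rightarrow> nat" where
  "cm_count \<nu> B = (\<Sum>x\<in>B \<inter> cm_support \<nu>. \<nu> x)"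

text \<open>Integral of a function w.r.t. a counting measure (finite sum for compactly supported g).\<close>
definition cm_integral :: "('b \<Rightarrow> nat) \<Rightarrow> ('b \<Rightarrow> real) \<Rightarrow> real" where
  "cm_integral \<nu> g = (\<Sum>x\<in>{x\<in>cm_support \<nu>. g x \<noteq> 0}. real (\<nu> x) * g x)"

definition Cc :: "('b::euclidean_space \<Rightarrow> real) set" where
  "Cc = {g. continuous_on UNIV g \<and> (\<exists>K. compact K \<and> (\<forall>x. x \<notin> K \<longrightarrow> g x = 0))}"

text \<open>The vague topology on the space of locally finite counting measures: the coarsest
  topology making all maps \<open>\<nu> \<mapsto> \<integral> g d\<nu>\<close>, \<open>g\<close> continuous with compact support, continuous.\<close>
definition vague_topology :: "('b::euclidean_space \<Rightarrow> nat) topology" where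
  "vague_topology = pullback_topology {\<nu>. locally_finite_cm \<nu>}
      (\<lambda>\<nu>. restrict (\<lambda>g. cm_integral \<nu> g) Cc)
      (product_topology (\<lambda>_. euclideanreal) Cc)"

definition poisson_process ::
  "'m measure \<Rightarrow> ('m \<Rightarrow> 'b::euclidean_space \<Rightarrow> nat) \<Rightarrow> 'b measure \<Rightarrow> bool" where
  "poisson_process P \<eta> \<Lambda> \<longleftrightarrow>
     prob_space P \<and>
     (\<forall>\<omega>\<in>space P. locally_finite_cm (\<eta> \<omega>)) \<and>
     (\<forall>B. B \<in> sets borel \<and> bounded B \<longrightarrow>
        (\<lambda>\<omega>. cm_count (\<eta> \<omega>) B) \<in> measurable P (count_space UNIV) \<and>
        (\<forall>k. measure P {\<omega>\<in>space P. cm_count (\<eta> \<omega>) B = k} =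
               measure \<Lambda> B ^ k / fact k * exp (- measure \<Lambda> B))) \<and>
     (\<forall>(I::nat set) B. finite I \<and> (\<forall>i\<in>I. B i \<in> sets borel \<and> bounded (B i)) \<and>
        disjoint_family_on B I \<longrightarrow>
        prob_space.indep_vars P (\<lambda>_. count_space UNIV) (\<lambda>i \<omega>. cm_count (\<eta> \<omega>) (B i)) I)"

definition conv_distr_cm ::
  "(real \<Rightarrow> 'm measure) \<Rightarrow> (real \<Rightarrow> 'm \<Rightarrow> 'b::euclidean_space \<Rightarrow> nat) \<Rightarrow>
   'n measure \<Rightarrow> ('n \<Rightarrow> 'b \<Rightarrow> nat) \<Rightarrow> bool" where
  "conv_distr_cm P X Q Y \<longleftrightarrow>
     (\<forall>F. continuous_map vague_topology euclideanreal F \<and>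
          (\<exists>c. \<forall>\<nu>\<in>topspace vague_topology. \<bar>F \<nu>\<bar> \<le> c) \<longrightarrow>
        ((\<lambda>t. \<integral>\<omega>. F (X t \<omega>) \<partial>P t) \<longlongrightarrow> (\<integral>\<omega>. F (Y \<omega>) \<partial>Q)) at_top)"

definition voronoi_cell :: "'b::euclidean_space \<Rightarrow> ('b \<Rightarrow> nat) \<Rightarrow> 'b set" where
  "voronoi_cell x \<nu> = {y. \<forall>x'\<in>cm_support \<nu>. x' \<noteq> x \<longrightarrow> norm (x - y) \<le> norm (y - x')}"

definition inradius :: "'b::euclidean_space \<Rightarrow> ('b \<Rightarrow> nat) \<Rightarrow> ereal" where
  "inradius x \<nu> = Sup {ereal R | R. 0 \<le> R \<and> ball x R \<subseteq> voronoi_cell x \<nu>}"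

definition eball :: "'b::euclidean_space \<Rightarrow> ereal \<Rightarrow> 'b set" where
  "eball x r = {y. ereal (dist x y) < r}"

definition xi_hat :: "'b::euclidean_space measure \<Rightarrow> 'b set \<Rightarrow> real \<Rightarrow> ('b \<Rightarrow> nat) \<Rightarrow> real \<Rightarrow> nat" where
  "xi_hat \<mu> W t \<nu> = (\<lambda>u. \<Sum>x\<in>{x\<in>W \<inter> cm_support \<nu>.
       2 ^ DIM('b) * t * measure \<mu> (eball x (inradius x \<nu>)) - ln t = u}. \<nu> x)"

end

theory Submission
  imports Defs "HOL-Real_Asymp.Real_Asymp"
begin

text \<open>
  The proof is a local form of the Chen--Stein method. The value attached to an atom \<open>x\<close> is at
  least \<open>u\<close> iff no other atom lies within a distance \<open>s\<close> of \<open>x\<close> with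
  \<open>2\<^sup>d t \<mu>(B(x, s/2)) = u + ln t\<close>, and by Hoelder continuity the void probability of
  \<open>B(x, s)\<close> is then \<open>e\<^sup>-\<^sup>u / t\<close> up to a factor tending to one.
  Cut a neighbourhood of \<open>W\<close> into pieces of diameter \<open>O(t\<^sup>-\<^sup>3)\<close>. Up to an event of small
  probability the counts \<open>X\<^sub>l\<close> of values in disjoint intervals are sums of indicators of
  events which only depend on finitely many independent Poisson counts in a small neighbourhood. The
  dependence between neighbouring pieces is negligible, which yields
  \<open>k\<^sub>l P(X = k) = \<lambda>\<^sub>l P(X = k - e\<^sub>l) + o(1)\<close> for every multi-index \<open>k\<close>. Together with
  tightness this recursion identifies the limit of \<open>P(X = k)\<close>. Convergence of these laws on ever
  finer grids gives convergence in distribution in the vague topology, because the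
  oscillation of a continuous functional over all measures with the same grid counts as \<open>\<nu>\<close> tends
  to zero, for every \<open>\<nu>\<close>.
\<close>

section \<open>Counting measures and the vague topology on the line\<close>

text \<open>A Poisson process is given here by its independent counts on bounded Borel sets, without
  a Palm formula; cutting into pieces replaces integrals over atoms by finite sums. A value involves
  \<open>\<mu>\<close> of the ball whose radius is half the distance to the nearest other atom,
  while the void probability involves the ball of the full distance. The factor 2^d matches the two
  only where \<open>f\<close> is nearly constant. As \<open>t * \<mu>\<close> of these balls is of
  order ln t, the relative error must be o(1 / ln t), and Hoelder continuity provides this. The mesh
  t^-3 makes two atoms in one piece negligible even for d = 1. The delicate term is a pair of nearby
  atoms with large values: neither lies in the exclusion ball of the other, so the second ball adds
  a fixed fraction \<kappa> to the void mass. The resulting factor t^-\<kappa> beats the number of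
  neighbours, which is of order ln t. Values within \<epsilon> of a grid level may be misjudged by
  the discretisation; this has probability O(\<epsilon>), and \<epsilon> is sent to 0 only after
  \<open>t\<close> has tended to infinity.\<close>

lemma finite_cm_support_Int: "locally_finite_cm \<nu> \<Longrightarrow> bounded B \<Longrightarrow> finite (B \<inter> cm_support \<nu>)"
  by (simp add: locally_finite_cm_def)

lemma cm_count_UN_disjoint:
  assumes "locally_finite_cm \<nu>" "finite L" "\<And>l. l \<in> L \<Longrightarrow> bounded (B l)" "disjoint_family_on B L"
  shows "cm_count \<nu> (\<Union>l\<in>L. B l) = (\<Sum>l\<in>L. cm_count \<nu> (B l))"
proof -
  have "(\<Union>l\<in>L. B l) \<inter> cm_support \<nu> = (\<Union>l\<in>L. B l \<inter> cm_support \<nu>)" by auto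
  moreover have "(\<Sum>x\<in>(\<Union>l\<in>L. B l \<inter> cm_support \<nu>). \<nu> x) = (\<Sum>l\<in>L. \<Sum>x\<in>B l \<inter> cm_support \<nu>. \<nu> x)"
    using assms(2,4) finite_cm_support_Int[OF assms(1)] assms(3)
    by (intro sum.UNION_disjoint) (auto simp: disjoint_family_on_def disjoint_iff)
  ultimately show ?thesis unfolding cm_count_def by simp
qed

lemma cm_count_mono:
  assumes "locally_finite_cm \<nu>" "bounded C" "B \<subseteq> C"
  shows "cm_count \<nu> B \<le> cm_count \<nu> C"
  unfolding cm_count_def using assms by (intro sum_mono2 finite_cm_support_Int) auto

lemma cm_count_eq_0_iff:
  assumes "locally_finite_cm \<nu>" "bounded B"
  shows "cm_count \<nu> B = 0 \<longleftrightarrow> B \<inter> cm_support \<nu> = {}"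
  using finite_cm_support_Int[OF assms] by (auto simp: cm_count_def cm_support_def)

text \<open>Window and mesh are refined by one index: for \<open>l < 2 * n * n\<close> the cells of
  width 1/n tile [-n, n). Since division by 0 gives 0, all cells are empty for n = 0.\<close>

definition grid_cell :: "nat \<Rightarrow> nat \<Rightarrow> real set" where
  "grid_cell n l = {- real n + real l / real n ..< - real n + real (Suc l) / real n}"

text \<open>A list keeps the value type countable, so that measurability and convergence of laws can
  be checked on single values.\<close>

definition grid_counts :: "nat \<Rightarrow> (real \<Rightarrow> nat) \<Rightarrow> nat list" where
  "grid_counts n \<nu> = map (\<lambda>l. cm_count \<nu> (grid_cell n l)) [0..<2 * n * n]"

lemma grid_counts_eq_iff:
  "grid_counts n \<nu> = grid_counts n \<nu>' \<longleftrightarrow>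
    (\<forall>l<2 * n * n. cm_count \<nu> (grid_cell n l) = cm_count \<nu>' (grid_cell n l))"
  by (auto simp: grid_counts_def)

lemma bounded_grid_cell: "bounded (grid_cell n l)"
  unfolding grid_cell_def by (rule bounded_subset[OF bounded_cbox[of "- real n + real l / real n" "- real n + real (Suc l) / real n"]]) auto

lemma grid_cell_iff:
  assumes "n > 0"
  shows "x \<in> grid_cell n l \<longleftrightarrow> \<lfloor>real n * (x + real n)\<rfloor> = int l"
proof -
  have "x \<in> grid_cell n l \<longleftrightarrow> real l \<le> real n * (x + real n) \<and> real n * (x + real n) < real l + 1"
    using assms by (auto simp: grid_cell_def field_simps)
  then show ?thesis by (simp add: floor_eq_iff)
qed

lemma disjoint_grid_cell: "disjoint_family_on (grid_cell n) L"
  by (cases "n = 0") (auto simp: disjoint_family_on_def grid_cell_iff, simp add: grid_cell_def)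

lemma UN_grid_cell:
  assumes "n > 0"
  shows "{- real n..<real n} \<subseteq> (\<Union>l<2*n*n. grid_cell n l)"
proof
  fix x assume x: "x \<in> {- real n..<real n}"
  let ?l = "\<lfloor>real n * (x + real n)\<rfloor>"
  have "0 \<le> real n * (x + real n)" using x by auto
  then have l0: "0 \<le> ?l" by (simp only: zero_le_floor)
  have "real n * (x + real n) < real n * (2 * real n)"
    using x assms by (intro mult_strict_left_mono) auto
  also have "\<dots> = of_int (int (2 * n * n))" by simp
  finally have "?l < int (2 * n * n)" by (simp only: floor_less_iff)
  with l0 have "nat ?l < 2 * n * n" by linarith
  moreover have "x \<in> grid_cell n (nat ?l)" using assms l0 by (simp only: grid_cell_iff int_nat_eq if_True)
  ultimately show "x \<in> (\<Union>l<2*n*n. grid_cell n l)" by blast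
qed

lemma grid_cell_width: "n > 0 \<Longrightarrow> x \<in> grid_cell n l \<Longrightarrow> y \<in> grid_cell n l \<Longrightarrow> \<bar>x - y\<bar> < 1 / real n"
  by (auto simp: grid_cell_def add_divide_distrib)

text \<open>The error is charged only to cells that meet the support interval: their total mass can
  be bounded uniformly in \<open>n\<close>, that of the whole window [-n, n) cannot.\<close>

lemma integral_grid_approx:
  assumes \<nu>: "locally_finite_cm \<nu>" and n: "n > 0" "R < real n" "0 \<le> e"
    and supp: "\<And>x. \<bar>x\<bar> > R \<Longrightarrow> g x = 0"
    and unif: "\<And>x y. \<bar>x - y\<bar> < 1 / real n \<Longrightarrow> \<bar>g x - g y\<bar> \<le> e"
  defines "p \<equiv> \<lambda>l. - real n + real l / real n"
  shows "\<bar>cm_integral \<nu> g - (\<Sum>l<2*n*n. real (cm_count \<nu> (grid_cell n l)) * g (p l))\<bar>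
     \<le> e * (\<Sum>l\<in>{l. l < 2*n*n \<and> grid_cell n l \<inter> {- R..R} \<noteq> {}}. real (cm_count \<nu> (grid_cell n l)))"
proof -
  let ?I = "\<lambda>l. grid_cell n l \<inter> cm_support \<nu>"
  let ?L = "{l. l < 2*n*n \<and> grid_cell n l \<inter> {- R..R} \<noteq> {}}"
  have fin: "finite (?I l)" for l using \<nu> bounded_grid_cell by (rule finite_cm_support_Int)
  have p: "p l \<in> grid_cell n l" for l using n by (auto simp: p_def grid_cell_def field_simps)
  have int: "cm_integral \<nu> g = (\<Sum>l<2*n*n. \<Sum>x\<in>?I l. real (\<nu> x) * g x)"
  proof -
    have "(\<Sum>l<2*n*n. \<Sum>x\<in>?I l. real (\<nu> x) * g x) = (\<Sum>x\<in>(\<Union>l<2*n*n. ?I l). real (\<nu> x) * g x)"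
      using disjoint_grid_cell[of n UNIV] fin
      by (intro sum.UNION_disjoint[symmetric]) (auto simp: disjoint_family_on_def)
    also have "\<dots> = cm_integral \<nu> g" unfolding cm_integral_def
    proof (rule sum.mono_neutral_right)
      show "{x \<in> cm_support \<nu>. g x \<noteq> 0} \<subseteq> (\<Union>l<2*n*n. ?I l)"
      proof
        fix x assume x: "x \<in> {x \<in> cm_support \<nu>. g x \<noteq> 0}"
        then have "\<bar>x\<bar> \<le> R" using supp[of x] by force
        then have "x \<in> {- real n..<real n}" using n by auto
        then show "x \<in> (\<Union>l<2*n*n. ?I l)" using UN_grid_cell[OF n(1)] x by blast
      qed
    qed (use fin in \<open>auto simp del: UN_simps\<close>)
    finally show ?thesis ..
  qed
  have cell: "\<bar>(\<Sum>x\<in>?I l. real (\<nu> x) * g x) - real (cm_count \<nu> (grid_cell n l)) * g (p l)\<bar>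
     \<le> (if l \<in> ?L then e * real (cm_count \<nu> (grid_cell n l)) else 0)" if "l < 2*n*n" for l
  proof (cases "l \<in> ?L")
    case True
    have "\<bar>(\<Sum>x\<in>?I l. real (\<nu> x) * g x) - real (cm_count \<nu> (grid_cell n l)) * g (p l)\<bar>
      = \<bar>\<Sum>x\<in>?I l. real (\<nu> x) * (g x - g (p l))\<bar>"
      by (simp add: cm_count_def sum_distrib_right sum_subtractf right_diff_distrib)
    also have "\<dots> \<le> (\<Sum>x\<in>?I l. real (\<nu> x) * e)"
    proof (rule order_trans[OF sum_abs], rule sum_mono)
      fix x assume "x \<in> ?I l"
      then have "\<bar>g x - g (p l)\<bar> \<le> e" using grid_cell_width[OF n(1) _ p] unif by blast
      then show "\<bar>real (\<nu> x) * (g x - g (p l))\<bar> \<le> real (\<nu> x) * e"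
        by (auto simp: abs_mult intro: mult_left_mono)
    qed
    also have "\<dots> = e * real (cm_count \<nu> (grid_cell n l))"
      by (simp add: cm_count_def sum_distrib_left mult.commute)
    finally show ?thesis using True by simp
  next
    case False
    then have "g x = 0" if "x \<in> grid_cell n l" for x
      using that \<open>l < 2*n*n\<close> supp[of x] by fastforce
    then have "(\<Sum>x\<in>?I l. real (\<nu> x) * g x) = 0" "g (p l) = 0" using p by auto
    then show ?thesis using n(3) by simp
  qed
  have "\<bar>cm_integral \<nu> g - (\<Sum>l<2*n*n. real (cm_count \<nu> (grid_cell n l)) * g (p l))\<bar>
     \<le> (\<Sum>l<2*n*n. if l \<in> ?L then e * real (cm_count \<nu> (grid_cell n l)) else 0)"
    unfolding int sum_subtractf[symmetric] using cell
    by (intro order_trans[OF sum_abs] sum_mono) auto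
  also have "\<dots> = (\<Sum>l\<in>?L. e * real (cm_count \<nu> (grid_cell n l)))"
    by (rule sum.mono_neutral_cong_right) auto
  finally show ?thesis by (simp only: sum_distrib_left)
qed

text \<open>Cells have width at most 1, so those meeting [-R, R] stay in one interval for all
  \<open>n\<close>.\<close>

lemma sum_grid_counts_le:
  assumes \<nu>: "locally_finite_cm \<nu>" and n: "n > 0"
  shows "(\<Sum>l\<in>{l. l < 2*n*n \<and> grid_cell n l \<inter> {- R..R} \<noteq> {}}. real (cm_count \<nu> (grid_cell n l)))
     \<le> real (cm_count \<nu> {- R - 1..R + 1})"
proof -
  let ?L = "{l. l < 2*n*n \<and> grid_cell n l \<inter> {- R..R} \<noteq> {}}"
  have "x \<in> {- R - 1..R + 1}" if "x \<in> grid_cell n l" "y \<in> grid_cell n l" "y \<in> {-R..R}" for x y l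
  proof -
    have "\<bar>x - y\<bar> < 1 / real n" using grid_cell_width[OF n] that by blast
    also have "\<dots> \<le> 1" using n by simp
    finally show ?thesis using that by auto
  qed
  then have "(\<Union>l\<in>?L. grid_cell n l) \<subseteq> {- R - 1..R + 1}" by blast
  then have "cm_count \<nu> (\<Union>l\<in>?L. grid_cell n l) \<le> cm_count \<nu> {- R - 1..R + 1}"
    by (intro cm_count_mono[OF \<nu>]) auto
  moreover have "cm_count \<nu> (\<Union>l\<in>?L. grid_cell n l) = (\<Sum>l\<in>?L. cm_count \<nu> (grid_cell n l))"
    by (intro cm_count_UN_disjoint[OF \<nu>]) (auto simp: bounded_grid_cell disjoint_grid_cell)
  ultimately show ?thesis by (simp flip: of_nat_sum)
qed

lemma Cc_real_bounds:
  fixes g :: "real \<Rightarrow> real"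
  assumes "g \<in> Cc"
  obtains R where "0 \<le> R" "\<And>x. \<bar>x\<bar> > R \<Longrightarrow> g x = 0" "uniformly_continuous_on UNIV g"
proof -
  obtain K where K: "compact K" "\<And>x. x \<notin> K \<Longrightarrow> g x = 0" and cont: "continuous_on UNIV g"
    using assms by (auto simp: Cc_def)
  obtain R where R: "R > 0" "\<And>x. x \<in> K \<Longrightarrow> norm x \<le> R"
    using compact_imp_bounded[OF K(1)] by (auto simp: bounded_pos)
  have zero: "g x = 0" if "\<bar>x\<bar> > R" for x using K(2) R(2)[of x] that by auto
  \<comment> \<open>With a margin of 2, two points at distance less than 1 either both lie in this
    interval or both have modulus above \<open>R\<close>, where \<open>g\<close> vanishes.\<close>
  have uc: "uniformly_continuous_on {-R-2..R+2} g"
    by (intro compact_uniformly_continuous continuous_on_subset[OF cont]) auto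
  have "uniformly_continuous_on UNIV g"
    unfolding uniformly_continuous_on_def
  proof (intro allI impI)
    fix e :: real assume "e > 0"
    then obtain d where d: "d > 0" "\<And>x x'. x \<in> {-R-2..R+2} \<Longrightarrow> x' \<in> {-R-2..R+2} \<Longrightarrow> dist x' x < d \<Longrightarrow> dist (g x') (g x) < e"
      using uc unfolding uniformly_continuous_on_def by metis
    show "\<exists>d>0. \<forall>x\<in>UNIV. \<forall>x'\<in>UNIV. dist x' x < d \<longrightarrow> dist (g x') (g x) < e"
    proof (intro exI[of _ "min d 1"] conjI ballI impI)
      fix x x' :: real assume *: "dist x' x < min d 1"
      show "dist (g x') (g x) < e"
      proof (cases "x \<in> {-R-2..R+2} \<and> x' \<in> {-R-2..R+2}")
        case True then show ?thesis using d * by auto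
      next
        case False
        then have "\<bar>x\<bar> > R" "\<bar>x'\<bar> > R" using * by (auto simp: dist_real_def)
        then show ?thesis using zero \<open>e > 0\<close> by simp
      qed
    qed (use d in auto)
  qed
  then show ?thesis using that[of R] R zero by auto
qed

text \<open>Each \<open>\<nu>' n\<close> agrees with \<open>\<nu>\<close> on the n-th grid only. No
  mass bound for the \<open>\<nu>' n\<close> is given, but the approximation error is expressed by
  grid counts, which can be read off \<open>\<nu>\<close>.\<close>

lemma cm_integral_tendsto_of_grid_counts:
  fixes \<nu> :: "real \<Rightarrow> nat"
  assumes \<nu>: "locally_finite_cm \<nu>" and \<nu>': "\<And>n. locally_finite_cm (\<nu>' n)"
    and eq: "\<And>n. grid_counts n (\<nu>' n) = grid_counts n \<nu>" and g: "g \<in> Cc"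
  shows "(\<lambda>n. cm_integral (\<nu>' n) g) \<longlonglongrightarrow> cm_integral \<nu> g"
proof (rule LIMSEQ_I)
  obtain R where R: "0 \<le> R" "\<And>x. \<bar>x\<bar> > R \<Longrightarrow> g x = 0" and uc: "uniformly_continuous_on UNIV g"
    using Cc_real_bounds[OF g] by blast
  fix r :: real assume "r > 0"
  let ?N = "cm_count \<nu> {- R - 1..R + 1}"
  \<comment> \<open>Two approximation errors of at most \<open>e * ?N\<close> have to stay below
    \<open>r\<close>; adding 1 covers \<open>?N = 0\<close>.\<close>
  define e where "e = r / (2 * (real ?N + 1))"
  have "e > 0" using \<open>r > 0\<close> by (simp add: e_def)
  then obtain d where d: "d > 0" "\<And>x y. \<bar>x - y\<bar> < d \<Longrightarrow> \<bar>g x - g y\<bar> < e"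
    using uc unfolding uniformly_continuous_on_def dist_real_def by (metis UNIV_I)
  obtain n0 where n0: "n0 > 0" "1 / real n0 < d" using d(1)
    by (metis nat_approx_posE of_nat_0_less_iff zero_less_Suc)
  obtain n1 where n1: "R < real n1" using reals_Archimedean2 by blast
  show "\<exists>no. \<forall>n\<ge>no. norm (cm_integral (\<nu>' n) g - cm_integral \<nu> g) < r"
  proof (intro exI allI impI)
    fix n assume n: "n \<ge> max n0 n1"
    then have "n > 0" using n0 by auto
    have Rn: "R < real n" using n n1 by linarith
    have "1 / real n \<le> 1 / real n0" using n n0 by (intro divide_left_mono) auto
    then have unif: "\<bar>g x - g y\<bar> \<le> e" if "\<bar>x - y\<bar> < 1 / real n" for x y
      using that n0(2) d(2)[of x y] by linarith
    let ?S = "\<lambda>\<nu>. \<Sum>l<2*n*n. real (cm_count \<nu> (grid_cell n l)) * g (- real n + real l / real n)"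
    have S: "?S (\<nu>' n) = ?S \<nu>"
      using eq[of n] unfolding grid_counts_eq_iff by (intro sum.cong) auto
    let ?T = "\<Sum>l\<in>{l. l < 2*n*n \<and> grid_cell n l \<inter> {- R..R} \<noteq> {}}. real (cm_count \<nu> (grid_cell n l))"
    have "\<bar>cm_integral (\<nu>' n) g - ?S (\<nu>' n)\<bar> \<le> e * (\<Sum>l\<in>{l. l < 2*n*n \<and> grid_cell n l \<inter> {- R..R} \<noteq> {}}. real (cm_count (\<nu>' n) (grid_cell n l)))"
      using \<open>e > 0\<close> \<open>n > 0\<close> Rn R unif by (intro integral_grid_approx \<nu>') auto
    also have "\<dots> = e * ?T" using eq[of n] unfolding grid_counts_eq_iff by simp
    finally have a: "\<bar>cm_integral (\<nu>' n) g - ?S (\<nu>' n)\<bar> \<le> e * ?T" .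
    have b: "\<bar>cm_integral \<nu> g - ?S \<nu>\<bar> \<le> e * ?T"
      using \<open>e > 0\<close> \<open>n > 0\<close> Rn R unif by (intro integral_grid_approx \<nu>) auto
    have "e * ?T \<le> e * real ?N"
      using sum_grid_counts_le[OF \<nu> \<open>n > 0\<close>] \<open>e > 0\<close> by (intro mult_left_mono) auto
    moreover have "e * real ?N < r / 2"
      using \<open>r > 0\<close> by (simp add: e_def field_simps)
    ultimately show "norm (cm_integral (\<nu>' n) g - cm_integral \<nu> g) < r"
      using a b S unfolding real_norm_def by linarith
  qed
qed

text \<open>In a pullback of a product topology a sequence converges once all the integrals do.
  Sequential continuity is all that is used of \<open>F\<close> later on, so metrizability of the
  vague topology never enters.\<close>

lemma vague_continuous_sequentially:
  fixes F :: "(real \<Rightarrow> nat) \<Rightarrow> real"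
  assumes F: "continuous_map vague_topology euclideanreal F"
    and \<nu>: "locally_finite_cm \<nu>" "\<And>n::nat. locally_finite_cm (\<nu>' n)"
    and conv: "\<And>g. g \<in> Cc \<Longrightarrow> (\<lambda>n. cm_integral (\<nu>' n) g) \<longlonglongrightarrow> cm_integral \<nu> g"
  shows "(\<lambda>n. F (\<nu>' n)) \<longlonglongrightarrow> F \<nu>"
proof -
  let ?j = "\<lambda>\<nu>. restrict (\<lambda>g. cm_integral \<nu> g) (Cc :: (real \<Rightarrow> real) set)"
  let ?T = "product_topology (\<lambda>_. euclideanreal) (Cc :: (real \<Rightarrow> real) set)"
  have "limitin ?T (\<lambda>n. ?j (\<nu>' n)) (?j \<nu>) sequentially"
    unfolding limitin_componentwise using conv by auto
  then have "limitin vague_topology \<nu>' \<nu> sequentially"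
    using \<nu> unfolding limitin_def vague_topology_def topspace_pullback_topology openin_pullback_topology
    by (auto elim!: eventually_mono)
  from continuous_map_limit[OF F this] show ?thesis by (simp add: o_def)
qed

lemma grid_oscillation:
  fixes F :: "(real \<Rightarrow> nat) \<Rightarrow> real"
  assumes F: "continuous_map vague_topology euclideanreal F"
    and \<nu>: "locally_finite_cm \<nu>" and "e > 0"
  shows "\<exists>n0. \<forall>n\<ge>n0. \<forall>\<nu>'. locally_finite_cm \<nu>' \<longrightarrow> grid_counts n \<nu>' = grid_counts n \<nu> \<longrightarrow> \<bar>F \<nu>' - F \<nu>\<bar> < e"
proof -
  define bad where "bad = (\<lambda>n \<nu>'. locally_finite_cm \<nu>' \<and> grid_counts n \<nu>' = grid_counts n \<nu> \<and> \<not> \<bar>F \<nu>' - F \<nu>\<bar> < e)"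
  \<comment> \<open>Where no counterexample exists, \<open>\<nu>\<close> itself is taken. The
    sequence thus converges vaguely to \<open>\<nu>\<close> in any case, and convergence of
    \<open>F\<close> along it rules out counterexamples for large \<open>n\<close>.\<close>
  define w where "w n = (if \<exists>\<nu>'. bad n \<nu>' then SOME \<nu>'. bad n \<nu>' else \<nu>)" for n
  have w: "bad n (w n)" if "\<exists>\<nu>'. bad n \<nu>'" for n
    using someI_ex[OF that] that by (simp add: w_def)
  have w': "locally_finite_cm (w n) \<and> grid_counts n (w n) = grid_counts n \<nu>" for n
    using w[of n] \<nu> by (cases "\<exists>\<nu>'. bad n \<nu>'") (auto simp: bad_def w_def)
  have "(\<lambda>n. F (w n)) \<longlonglongrightarrow> F \<nu>"
    using w' \<nu> by (intro vague_continuous_sequentially[OF F] cm_integral_tendsto_of_grid_counts) auto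
  then obtain n0 where "\<And>n. n \<ge> n0 \<Longrightarrow> \<bar>F (w n) - F \<nu>\<bar> < e"
    using \<open>e > 0\<close> by (metis LIMSEQ_D real_norm_def)
  then show ?thesis using w by (meson bad_def)
qed


section \<open>From laws of grid counts to convergence in distribution\<close>

text \<open>On a countable space pointwise convergence of the masses to a probability law suffices:
  a finite set carrying almost all of the limit mass carries almost all mass for large
  \<open>t\<close> too, so nothing escapes.\<close>

lemma bounded_functional_tendsto:
  fixes K :: "real \<Rightarrow> 'm \<Rightarrow> 'k::countable" and K' :: "'n \<Rightarrow> 'k" and H :: "'k \<Rightarrow> real"
  assumes P: "eventually (\<lambda>t. prob_space (P t)) at_top" and Q: "prob_space Q"
    and K: "eventually (\<lambda>t. K t \<in> measurable (P t) (count_space UNIV)) at_top"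
    and K': "K' \<in> measurable Q (count_space UNIV)"
    and conv: "\<And>k. ((\<lambda>t. measure (P t) {\<omega>\<in>space (P t). K t \<omega> = k}) \<longlongrightarrow> measure Q {\<omega>\<in>space Q. K' \<omega> = k}) at_top"
    and H: "\<And>k. \<bar>H k\<bar> \<le> c"
  shows "((\<lambda>t. \<integral>\<omega>. H (K t \<omega>) \<partial>P t) \<longlongrightarrow> (\<integral>\<omega>. H (K' \<omega>) \<partial>Q)) at_top"
proof (rule tendstoI)
  interpret Q: prob_space Q by (rule Q)
  fix e :: real assume "e > 0"
  have "c \<ge> 0" using H[of undefined] by linarith
  \<comment> \<open>The two tails cost at most \<open>c * d\<close> each, together less than
    \<open>e / 2\<close>; the other half is left for the finite sum. Adding 1 covers
    \<open>c = 0\<close>.\<close>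
  define d where "d = e / (4 * (c + 1))"
  have "d > 0" "2 * c * d < e / 2" using \<open>e > 0\<close> \<open>c \<ge> 0\<close> by (auto simp: d_def field_simps)
  have est: "\<bar>(\<integral>\<omega>. H (L \<omega>) \<partial>R) - (\<Sum>k\<in>S. H k * measure R {\<omega>\<in>space R. L \<omega> = k})\<bar>
      \<le> c * (1 - (\<Sum>k\<in>S. measure R {\<omega>\<in>space R. L \<omega> = k}))"
    if R: "prob_space R" and L: "L \<in> measurable R (count_space UNIV)" and S: "finite S" for R :: "'r measure" and L and S :: "'k set"
  proof -
    interpret R: prob_space R by (rule R)
    have HL: "(\<lambda>\<omega>. f (L \<omega>)) \<in> borel_measurable R" for f :: "'k \<Rightarrow> real"
      by (rule measurable_compose[OF L]) simp
    have int: "integrable R (\<lambda>\<omega>. f (L \<omega>))" if "\<And>k. \<bar>f k\<bar> \<le> B" for f :: "'k \<Rightarrow> real" and B :: real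
      using HL that by (intro R.integrable_const_bound[of _ B]) auto
    have lev: "{\<omega>\<in>space R. L \<omega> = k} \<in> sets R" for k
      using measurable_sets[OF L, of "{k}"] by (simp add: vimage_def Int_def conj_commute)
    have eqm: "(\<integral>\<omega>. (\<Sum>k\<in>S. f k * indicator {\<omega>\<in>space R. L \<omega> = k} \<omega>) \<partial>R) = (\<Sum>k\<in>S. f k * measure R {\<omega>\<in>space R. L \<omega> = k})"
      for f :: "'k \<Rightarrow> real"
      using lev by (subst Bochner_Integration.integral_sum) (auto intro!: integrable_real_indicator simp: less_top[symmetric])
    have ptw: "(\<Sum>k\<in>S. f k * indicator {\<omega>\<in>space R. L \<omega> = k} \<omega>) = f (L \<omega>) * indicator S (L \<omega>)"
      if "\<omega> \<in> space R" for f :: "'k \<Rightarrow> real" and \<omega>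
    proof -
      have "(\<Sum>k\<in>S. f k * indicator {\<omega>\<in>space R. L \<omega> = k} \<omega>) = (\<Sum>k\<in>S. if k = L \<omega> then f k else 0)"
        using that by (intro sum.cong) (auto simp: indicator_def)
      then show ?thesis using S by (simp add: indicator_def)
    qed
    have eqm': "(\<integral>\<omega>. f (L \<omega>) * indicator S (L \<omega>) \<partial>R) = (\<Sum>k\<in>S. f k * measure R {\<omega>\<in>space R. L \<omega> = k})"
      for f :: "'k \<Rightarrow> real"
      unfolding eqm[symmetric] using ptw by (intro Bochner_Integration.integral_cong) auto
    have intS: "integrable R (\<lambda>\<omega>. indicator S (L \<omega>) :: real)"
      by (rule int[of _ 1]) (auto simp: indicator_def)
    have "\<bar>(\<integral>\<omega>. H (L \<omega>) \<partial>R) - (\<Sum>k\<in>S. H k * measure R {\<omega>\<in>space R. L \<omega> = k})\<bar>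
      = \<bar>\<integral>\<omega>. H (L \<omega>) - H (L \<omega>) * indicator S (L \<omega>) \<partial>R\<bar>"
      unfolding eqm'[symmetric] using H \<open>c \<ge> 0\<close>
      by (subst Bochner_Integration.integral_diff) (auto intro!: int[of _ c] simp: indicator_def)
    also have "\<dots> \<le> (\<integral>\<omega>. \<bar>H (L \<omega>) - H (L \<omega>) * indicator S (L \<omega>)\<bar> \<partial>R)"
      by (rule integral_abs_bound)
    also have "\<dots> \<le> (\<integral>\<omega>. c * (1 - indicator S (L \<omega>)) \<partial>R)"
      using H \<open>c \<ge> 0\<close> by (intro integral_mono int[of "\<lambda>k. \<bar>H k - H k * indicator S k\<bar>" c] int[of "\<lambda>k. c * (1 - indicator S k)" c]) (auto simp: indicator_def)
    also have "\<dots> = c * (1 - (\<integral>\<omega>. indicator S (L \<omega>) \<partial>R))"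
      using intS by (simp add: R.prob_space)
    also have "(\<integral>\<omega>. indicator S (L \<omega>) \<partial>R) = (\<Sum>k\<in>S. measure R {\<omega>\<in>space R. L \<omega> = k})"
      using eqm'[of "\<lambda>_. 1"] by simp
    finally show ?thesis .
  qed
  obtain S where S: "finite S" "1 - (\<Sum>k\<in>S. measure Q {\<omega>\<in>space Q. K' \<omega> = k}) < d"
  proof -
    let ?A = "\<lambda>k. {\<omega>\<in>space Q. K' \<omega> = k}"
    let ?T = "\<lambda>N. {k::'k. to_nat k < N}"
    have lev: "?A k \<in> sets Q" for k
      using measurable_sets[OF K', of "{k}"] by (simp add: vimage_def Int_def conj_commute)
    have fin: "finite (?T N)" for N
      by (rule inj_on_finite[of to_nat _ "{..<N}"]) (auto intro: inj_on_subset[OF inj_to_nat])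
    have "(\<lambda>N. measure Q (\<Union>k\<in>?T N. ?A k)) \<longlonglongrightarrow> measure Q (\<Union>N. \<Union>k\<in>?T N. ?A k)"
      using lev fin by (intro Q.finite_Lim_measure_incseq) (auto simp: incseq_def intro!: sets.finite_UN)
    also have "(\<Union>N. \<Union>k\<in>?T N. ?A k) = space Q" by auto
    finally have "eventually (\<lambda>N. dist (measure Q (\<Union>k\<in>?T N. ?A k)) 1 < d) sequentially"
      using \<open>d > 0\<close> by (intro tendstoD) (simp_all add: Q.prob_space)
    then obtain N where N: "\<bar>measure Q (\<Union>k\<in>?T N. ?A k) - 1\<bar> < d"
      unfolding eventually_sequentially dist_real_def by blast
    have "measure Q (\<Union>k\<in>?T N. ?A k) = (\<Sum>k\<in>?T N. measure Q (?A k))"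
      using lev fin by (intro Q.finite_measure_finite_Union) (auto simp: disjoint_family_on_def)
    then show ?thesis using N that[OF fin[of N]] by simp
  qed
  have "((\<lambda>t. \<Sum>k\<in>S. measure (P t) {\<omega>\<in>space (P t). K t \<omega> = k}) \<longlongrightarrow> (\<Sum>k\<in>S. measure Q {\<omega>\<in>space Q. K' \<omega> = k})) at_top"
    by (intro tendsto_sum conv)
  then have "eventually (\<lambda>t. (\<Sum>k\<in>S. measure (P t) {\<omega>\<in>space (P t). K t \<omega> = k}) > 1 - d) at_top"
    by (rule order_tendstoD) (use S in linarith)
  moreover have "((\<lambda>t. \<Sum>k\<in>S. H k * measure (P t) {\<omega>\<in>space (P t). K t \<omega> = k}) \<longlongrightarrow> (\<Sum>k\<in>S. H k * measure Q {\<omega>\<in>space Q. K' \<omega> = k})) at_top"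
    by (intro tendsto_sum tendsto_mult_left conv)
  then have "eventually (\<lambda>t. dist (\<Sum>k\<in>S. H k * measure (P t) {\<omega>\<in>space (P t). K t \<omega> = k}) (\<Sum>k\<in>S. H k * measure Q {\<omega>\<in>space Q. K' \<omega> = k}) < e / 2) at_top"
    using \<open>e > 0\<close> by (intro tendstoD) auto
  ultimately show "eventually (\<lambda>t. dist (\<integral>\<omega>. H (K t \<omega>) \<partial>P t) (\<integral>\<omega>. H (K' \<omega>) \<partial>Q) < e) at_top"
    using P K
  proof eventually_elim
    case (elim t)
    have "c * (1 - (\<Sum>k\<in>S. measure (P t) {\<omega>\<in>space (P t). K t \<omega> = k})) \<le> c * d"
      "c * (1 - (\<Sum>k\<in>S. measure Q {\<omega>\<in>space Q. K' \<omega> = k})) \<le> c * d"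
      using elim S \<open>c \<ge> 0\<close> by (auto intro!: mult_left_mono)
    then show ?case
      using est[OF elim(3,4) S(1)] est[OF Q K' S(1)] elim(2) \<open>2 * c * d < e / 2\<close> unfolding dist_real_def by linarith
  qed
qed

lemma grid_counts_measurable:
  assumes "\<And>n l. (\<lambda>\<omega>. cm_count (X \<omega>) (grid_cell n l)) \<in> measurable M (count_space UNIV)"
  shows "(\<lambda>\<omega>. grid_counts n (X \<omega>)) \<in> measurable M (count_space UNIV)"
  unfolding measurable_count_space_eq2_countable
proof (intro conjI ballI)
  fix ks :: "nat list"
  show "(\<lambda>\<omega>. grid_counts n (X \<omega>)) -` {ks} \<inter> space M \<in> sets M"
  proof (cases "length ks = 2 * n * n")
    case True
    have *: "{\<omega>\<in>space M. cm_count (X \<omega>) (grid_cell n l) = ks ! l} \<in> sets M" for l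
      using measurable_sets[OF assms[of n l], of "{ks ! l}"] by (simp add: vimage_def Int_def conj_commute)
    have "{\<omega>\<in>space M. \<forall>l\<in>{..<2*n*n}. cm_count (X \<omega>) (grid_cell n l) = ks ! l} \<in> sets M"
      by (intro sets.sets_Collect_finite_All) (use * in auto)
    also have "{\<omega>\<in>space M. \<forall>l\<in>{..<2*n*n}. cm_count (X \<omega>) (grid_cell n l) = ks ! l}
      = (\<lambda>\<omega>. grid_counts n (X \<omega>)) -` {ks} \<inter> space M"
      using True by (auto simp: grid_counts_def list_eq_iff_nth_eq)
    finally show ?thesis .
  next
    case False
    then have "(\<lambda>\<omega>. grid_counts n (X \<omega>)) -` {ks} \<inter> space M = {}" by (auto simp: grid_counts_def)
    then show ?thesis by simp
  qed
qed auto

text \<open>\<open>F\<close> is replaced by a function of the n-th grid counts, namely its value at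
  a representative of the class with these counts; \<open>osc n\<close> bounds the error. The
  oscillation tends to 0 for each single measure, without uniformity, so it is controlled in
  expectation only.\<close>

lemma conv_distr_cmI:
  fixes X :: "real \<Rightarrow> 'm \<Rightarrow> real \<Rightarrow> nat" and Y :: "'n \<Rightarrow> real \<Rightarrow> nat"
  assumes P: "eventually (\<lambda>t. prob_space (P t)) at_top" and Q: "prob_space Q"
    and X: "eventually (\<lambda>t. \<forall>\<omega>\<in>space (P t). locally_finite_cm (X t \<omega>)) at_top"
      "eventually (\<lambda>t. \<forall>n l. (\<lambda>\<omega>. cm_count (X t \<omega>) (grid_cell n l)) \<in> measurable (P t) (count_space UNIV)) at_top"
    and Y: "\<And>\<omega>. \<omega> \<in> space Q \<Longrightarrow> locally_finite_cm (Y \<omega>)"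
      "\<And>n l. (\<lambda>\<omega>. cm_count (Y \<omega>) (grid_cell n l)) \<in> measurable Q (count_space UNIV)"
    and conv: "\<And>n k. n > 0 \<Longrightarrow>
      ((\<lambda>t. measure (P t) {\<omega>\<in>space (P t). \<forall>l<2*n*n. cm_count (X t \<omega>) (grid_cell n l) = k l})
         \<longlongrightarrow> measure Q {\<omega>\<in>space Q. \<forall>l<2*n*n. cm_count (Y \<omega>) (grid_cell n l) = k l}) at_top"
  shows "conv_distr_cm P X Q Y"
  unfolding conv_distr_cm_def
proof (intro allI impI, elim conjE exE)
  interpret Q: prob_space Q by (rule Q)
  fix F :: "(real \<Rightarrow> nat) \<Rightarrow> real" and c
  assume F: "continuous_map vague_topology euclideanreal F"
    and c: "\<forall>\<nu>\<in>topspace vague_topology. \<bar>F \<nu>\<bar> \<le> c"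
  have bnd: "\<bar>F \<nu>\<bar> \<le> c" if "locally_finite_cm \<nu>" for \<nu>
    using c that by (auto simp: vague_topology_def topspace_pullback_topology)
  have "locally_finite_cm (\<lambda>_::real. 0)" by (simp add: locally_finite_cm_def cm_support_def)
  from bnd[OF this] have "c \<ge> 0" by linarith
  define C where "C n ks = {\<nu>. locally_finite_cm \<nu> \<and> grid_counts n \<nu> = ks}" for n ks
  \<comment> \<open>Lists that no measure realises, such as those of the wrong length, get the
    default 0 here and in \<open>osc\<close>.\<close>
  define G where "G n ks = (if C n ks = {} then 0 else F (SOME \<nu>. \<nu> \<in> C n ks))" for n ks
  define osc where "osc n ks = (if C n ks = {} then 0 else (SUP \<nu>\<in>C n ks. \<bar>F \<nu> - G n ks\<bar>))" for n ks
  have GC: "\<exists>\<nu>\<in>C n ks. G n ks = F \<nu>" if "C n ks \<noteq> {}" for n ks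
    using that some_in_eq[of "C n ks"] by (auto simp: G_def)
  have G_bnd: "\<bar>G n ks\<bar> \<le> c" for n ks
  proof (cases "C n ks = {}")
    case True
    then show ?thesis using \<open>c \<ge> 0\<close> by (simp add: G_def)
  next
    case False
    from GC[OF this] obtain \<nu> where "\<nu> \<in> C n ks" "G n ks = F \<nu>" by blast
    then show ?thesis using bnd[of \<nu>] by (simp add: C_def)
  qed
  have bdd: "\<bar>F \<nu> - G n ks\<bar> \<le> 2 * c" if "\<nu> \<in> C n ks" for \<nu> n ks
    using bnd[of \<nu>] G_bnd[of n ks] that by (auto simp: C_def)
  have osc_upper: "\<bar>F \<nu> - G n (grid_counts n \<nu>)\<bar> \<le> osc n (grid_counts n \<nu>)" if "locally_finite_cm \<nu>" for n \<nu>
  proof -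
    let ?ks = "grid_counts n \<nu>"
    have \<nu>: "\<nu> \<in> C n ?ks" using that by (simp add: C_def)
    have "bdd_above ((\<lambda>\<nu>'. \<bar>F \<nu>' - G n ?ks\<bar>) ` C n ?ks)"
      using bdd by (intro bdd_aboveI2[of _ _ "2*c"])
    from cSUP_upper[OF \<nu> this] \<nu> show ?thesis by (auto simp: osc_def)
  qed
  have osc_bnd: "\<bar>osc n ks\<bar> \<le> 2 * c" for n ks
  proof (cases "C n ks = {}")
    case False
    then obtain \<nu> where \<nu>: "\<nu> \<in> C n ks" by auto
    have "osc n ks \<le> 2 * c" using False bdd by (auto simp: osc_def intro!: cSUP_least)
    moreover have "0 \<le> osc n ks" using osc_upper[of \<nu> n] \<nu> by (auto simp: C_def)
    ultimately show ?thesis by auto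
  qed (use \<open>c \<ge> 0\<close> in \<open>auto simp: osc_def\<close>)
  have osc_lim: "(\<lambda>n. osc n (grid_counts n \<nu>)) \<longlonglongrightarrow> 0" if \<nu>: "locally_finite_cm \<nu>" for \<nu>
  proof (rule LIMSEQ_I)
    fix r :: real assume "r > 0"
    obtain n0 where n0: "\<And>n \<nu>'. n \<ge> n0 \<Longrightarrow> locally_finite_cm \<nu>' \<Longrightarrow> grid_counts n \<nu>' = grid_counts n \<nu> \<Longrightarrow> \<bar>F \<nu>' - F \<nu>\<bar> < r/4"
      using grid_oscillation[OF F \<nu>, of "r/4"] \<open>r > 0\<close> by auto
    show "\<exists>n0. \<forall>n\<ge>n0. norm (osc n (grid_counts n \<nu>) - 0) < r"
    proof (intro exI allI impI)
      fix n assume n: "n \<ge> n0"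
      let ?C = "C n (grid_counts n \<nu>)"
      have ne: "\<nu> \<in> ?C" using \<nu> by (auto simp: C_def)
      then have "?C \<noteq> {}" by auto
      from GC[OF this] obtain \<nu>0 where \<nu>0: "\<nu>0 \<in> ?C" "G n (grid_counts n \<nu>) = F \<nu>0" by blast
      have "\<bar>F \<nu>' - G n (grid_counts n \<nu>)\<bar> \<le> r/2" if "\<nu>' \<in> ?C" for \<nu>'
      proof -
        have "\<bar>F \<nu>' - F \<nu>\<bar> < r/4" "\<bar>F \<nu>0 - F \<nu>\<bar> < r/4"
          using n0[OF n, of \<nu>'] n0[OF n, of \<nu>0] that \<nu>0 by (auto simp: C_def)
        then show ?thesis unfolding \<nu>0(2) by linarith
      qed
      with \<open>?C \<noteq> {}\<close> have "(SUP \<nu>'\<in>?C. \<bar>F \<nu>' - G n (grid_counts n \<nu>)\<bar>) \<le> r/2"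
        by (rule cSUP_least)
      then have "osc n (grid_counts n \<nu>) \<le> r/2" using \<open>?C \<noteq> {}\<close> by (simp add: osc_def)
      then show "norm (osc n (grid_counts n \<nu>) - 0) < r"
        using osc_upper[OF \<nu>, of n] \<open>r > 0\<close> by auto
    qed
  qed
  \<comment> \<open>Measurability of \<open>F (Z \<omega>)\<close> is not assumed; it follows
    because \<open>F\<close> is a pointwise limit of functions of countably valued grid
    counts.\<close>
  have F_meas: "(\<lambda>\<omega>. F (Z \<omega>)) \<in> borel_measurable R"
    if Z: "\<And>\<omega>. \<omega> \<in> space R \<Longrightarrow> locally_finite_cm (Z \<omega>)"
      "\<And>n l. (\<lambda>\<omega>. cm_count (Z \<omega>) (grid_cell n l)) \<in> measurable R (count_space UNIV)" for Z and R :: "'r measure"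
  proof (rule borel_measurable_LIMSEQ_real)
    fix \<omega> assume \<omega>: "\<omega> \<in> space R"
    have "(\<lambda>n. F (Z \<omega>) - G n (grid_counts n (Z \<omega>))) \<longlonglongrightarrow> 0"
    proof (rule tendsto_0_le[OF osc_lim[OF Z(1)[OF \<omega>]], of _ 1], intro always_eventually allI)
      fix n
      show "norm (F (Z \<omega>) - G n (grid_counts n (Z \<omega>))) \<le> norm (osc n (grid_counts n (Z \<omega>))) * 1"
        using osc_upper[OF Z(1)[OF \<omega>], of n] by simp
    qed
    from tendsto_diff[OF tendsto_const[of "F (Z \<omega>)"] this]
    show "(\<lambda>n. G n (grid_counts n (Z \<omega>))) \<longlonglongrightarrow> F (Z \<omega>)" by simp
  next
    show "(\<lambda>\<omega>. G n (grid_counts n (Z \<omega>))) \<in> borel_measurable R" for n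
      by (rule measurable_compose[OF grid_counts_measurable[OF Z(2)]]) simp
  qed
  have approx: "\<bar>(\<integral>\<omega>. F (Z \<omega>) \<partial>R) - (\<integral>\<omega>. G n (grid_counts n (Z \<omega>)) \<partial>R)\<bar> \<le> (\<integral>\<omega>. osc n (grid_counts n (Z \<omega>)) \<partial>R)"
    if R: "prob_space R" and Z: "\<And>\<omega>. \<omega> \<in> space R \<Longrightarrow> locally_finite_cm (Z \<omega>)"
      "\<And>n l. (\<lambda>\<omega>. cm_count (Z \<omega>) (grid_cell n l)) \<in> measurable R (count_space UNIV)" for Z n and R :: "'r measure"
  proof -
    interpret R: prob_space R by (rule R)
    have meas: "(\<lambda>\<omega>. h (grid_counts n (Z \<omega>))) \<in> borel_measurable R" for h :: "nat list \<Rightarrow> real"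
      by (rule measurable_compose[OF grid_counts_measurable[OF Z(2)]]) simp
    have i1: "integrable R (\<lambda>\<omega>. F (Z \<omega>))"
      using Z bnd by (intro R.integrable_const_bound[of _ c] F_meas AE_I2) auto
    have i2: "integrable R (\<lambda>\<omega>. G n (grid_counts n (Z \<omega>)))"
      using G_bnd by (intro R.integrable_const_bound[of _ c] meas AE_I2) auto
    have i3: "integrable R (\<lambda>\<omega>. osc n (grid_counts n (Z \<omega>)))"
      using osc_bnd by (intro R.integrable_const_bound[of _ "2*c"] meas AE_I2) auto
    have "\<bar>(\<integral>\<omega>. F (Z \<omega>) - G n (grid_counts n (Z \<omega>)) \<partial>R)\<bar> \<le> (\<integral>\<omega>. \<bar>F (Z \<omega>) - G n (grid_counts n (Z \<omega>))\<bar> \<partial>R)"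
      by (rule integral_abs_bound)
    also have "\<dots> \<le> (\<integral>\<omega>. osc n (grid_counts n (Z \<omega>)) \<partial>R)"
      using osc_upper Z by (intro integral_mono integrable_abs Bochner_Integration.integrable_diff i1 i2 i3) auto
    finally show ?thesis using i1 i2 by simp
  qed
  have gc: "((\<lambda>t. \<integral>\<omega>. h (grid_counts n (X t \<omega>)) \<partial>P t) \<longlongrightarrow> (\<integral>\<omega>. h (grid_counts n (Y \<omega>)) \<partial>Q)) at_top"
    if n: "n > 0" and h: "\<And>ks. \<bar>h ks\<bar> \<le> B" for h :: "nat list \<Rightarrow> real" and n B
  proof (rule bounded_functional_tendsto[where P = P and Q = Q, OF P Q _ grid_counts_measurable[OF Y(2)] _ h])
    show "\<forall>\<^sub>F t in at_top. (\<lambda>\<omega>. grid_counts n (X t \<omega>)) \<in> measurable (P t) (count_space UNIV)"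
      using X(2) by eventually_elim (rule grid_counts_measurable, blast)
    fix ks
    show "((\<lambda>t. measure (P t) {\<omega> \<in> space (P t). grid_counts n (X t \<omega>) = ks}) \<longlongrightarrow> measure Q {\<omega> \<in> space Q. grid_counts n (Y \<omega>) = ks}) at_top"
    proof (cases "length ks = 2 * n * n")
      case True
      then have "grid_counts n \<nu> = ks \<longleftrightarrow> (\<forall>l<2*n*n. cm_count \<nu> (grid_cell n l) = ks ! l)" for \<nu>
        by (auto simp: grid_counts_def list_eq_iff_nth_eq)
      then show ?thesis using conv[OF n, of "\<lambda>l. ks ! l"] by simp
    next
      case False
      then have "grid_counts n \<nu> \<noteq> ks" for \<nu> by (auto simp: grid_counts_def)
      then show ?thesis by simp
    qed
  qed
  show "((\<lambda>t. \<integral>\<omega>. F (X t \<omega>) \<partial>P t) \<longlongrightarrow> (\<integral>\<omega>. F (Y \<omega>) \<partial>Q)) at_top"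
  proof (rule tendstoI)
    fix e :: real assume "e > 0"
    have "(\<lambda>n. \<integral>\<omega>. osc n (grid_counts n (Y \<omega>)) \<partial>Q) \<longlonglongrightarrow> (\<integral>\<omega>. 0 \<partial>Q)"
    proof (rule integral_dominated_convergence[where w = "\<lambda>_. 2 * c"])
      show "(\<lambda>\<omega>. osc n (grid_counts n (Y \<omega>))) \<in> borel_measurable Q" for n
        by (rule measurable_compose[OF grid_counts_measurable[OF Y(2)]]) simp
    qed (use osc_lim osc_bnd Y in auto)
    then have "eventually (\<lambda>n. dist (\<integral>\<omega>. osc n (grid_counts n (Y \<omega>)) \<partial>Q) 0 < e/4) sequentially"
      using \<open>e > 0\<close> by (intro tendstoD) auto
    then obtain n where n: "n > 0" "(\<integral>\<omega>. osc n (grid_counts n (Y \<omega>)) \<partial>Q) < e/4"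
      unfolding eventually_sequentially by (metis abs_le_D1 abs_less_iff diff_zero dist_real_def le_add2 le_cases not_gr_zero not_less_eq_eq zero_le)
    \<comment> \<open>The error bound is itself a bounded function of grid counts, so its small
      expectation under \<open>Q\<close> passes to \<open>P t\<close> for large
      \<open>t\<close>.\<close>
    have "eventually (\<lambda>t. (\<integral>\<omega>. osc n (grid_counts n (X t \<omega>)) \<partial>P t) < e/4) at_top"
      using gc[OF n(1), of "osc n"] osc_bnd n(2) by (intro order_tendstoD) auto
    moreover have "eventually (\<lambda>t. dist (\<integral>\<omega>. G n (grid_counts n (X t \<omega>)) \<partial>P t) (\<integral>\<omega>. G n (grid_counts n (Y \<omega>)) \<partial>Q) < e/4) at_top"
      using \<open>e > 0\<close> G_bnd by (intro tendstoD gc[OF n(1)]) auto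
    ultimately show "eventually (\<lambda>t. dist (\<integral>\<omega>. F (X t \<omega>) \<partial>P t) (\<integral>\<omega>. F (Y \<omega>) \<partial>Q) < e) at_top"
      using P X
    proof eventually_elim
      case (elim t)
      have "\<bar>(\<integral>\<omega>. F (X t \<omega>) \<partial>P t) - (\<integral>\<omega>. G n (grid_counts n (X t \<omega>)) \<partial>P t)\<bar> \<le> (\<integral>\<omega>. osc n (grid_counts n (X t \<omega>)) \<partial>P t)"
        using elim by (intro approx) auto
      moreover have "\<bar>(\<integral>\<omega>. F (Y \<omega>) \<partial>Q) - (\<integral>\<omega>. G n (grid_counts n (Y \<omega>)) \<partial>Q)\<bar> \<le> (\<integral>\<omega>. osc n (grid_counts n (Y \<omega>)) \<partial>Q)"
        using Q Y by (intro approx) auto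
      ultimately show ?case using elim n \<open>e > 0\<close> unfolding dist_real_def by linarith
    qed
  qed
qed

section \<open>Inradii and measurability\<close>

text \<open>The centres lie in the compact set \<open>K\<close> but possibly outside
  \<open>S\<close>, and a centre need not belong to its own piece. A proper subset \<open>S\<close>
  occurs later as the complement of \<open>W\<close> in a large ball.\<close>

lemma small_partition:
  fixes K S :: "'a::euclidean_space set"
  assumes K: "compact K" and S: "S \<subseteq> K" "S \<in> sets borel" and \<delta>: "\<delta> > 0"
  obtains N z Q where "\<And>i. i < (N::nat) \<Longrightarrow> z i \<in> K" "\<And>i. Q i \<in> sets borel" "\<And>i. Q i \<subseteq> ball (z i) \<delta>"
    "disjoint_family Q" "(\<Union>i<N. Q i) = S"
proof -
  obtain k where k: "finite k" "k \<subseteq> K" "K \<subseteq> (\<Union>x\<in>k. ball x \<delta>)"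
  proof (rule compactE_image[OF K, of K "\<lambda>x. ball x \<delta>"])
    show "K \<subseteq> (\<Union>x\<in>K. ball x \<delta>)" using \<delta> by auto
  qed (use that in auto)
  obtain z where z: "bij_betw z {0..<card k} k" using ex_bij_betw_nat_finite[OF k(1)] by blast
  define Q where "Q i = S \<inter> disjointed (\<lambda>i. ball (z i) \<delta>) i" for i
  have "(\<Union>i<card k. Q i) = S \<inter> (\<Union>i\<in>{0..<card k}. ball (z i) \<delta>)"
    unfolding Q_def lessThan_atLeast0 Int_UN_distrib[symmetric] finite_UN_disjointed_eq ..
  also have "(\<Union>i\<in>{0..<card k}. ball (z i) \<delta>) = (\<Union>x\<in>k. ball x \<delta>)"
  proof -
    have "(\<Union>i\<in>{0..<card k}. ball (z i) \<delta>) = (\<Union>x\<in>z ` {0..<card k}. ball x \<delta>)"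
      by (simp only: image_image)
    then show ?thesis by (simp only: bij_betw_imp_surj_on[OF z])
  qed
  finally have "(\<Union>i<card k. Q i) = S" using k S by auto
  moreover have "disjoint_family Q"
    using disjoint_family_disjointed[of "\<lambda>i. ball (z i) \<delta>"] by (auto simp: Q_def disjoint_family_on_def)
  moreover have "Q i \<subseteq> ball (z i) \<delta>" for i
    using disjointed_subset[of "\<lambda>i. ball (z i) \<delta>"] by (auto simp: Q_def)
  moreover have "range (disjointed (\<lambda>i. ball (z i) \<delta>)) \<subseteq> sets borel"
    by (rule sets.range_disjointed_sets) auto
  then have "Q i \<in> sets borel" for i using S by (auto simp: Q_def)
  moreover have "z i \<in> K" if "i < card k" for i
    using bij_betwE[OF z] that k by auto
  ultimately show ?thesis using that by blast
qed

text \<open>Spheres are null sets of the absolutely continuous \<open>\<mu>\<close>, and off the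
  limiting sphere the indicators converge, dominated by that of one fixed ball.\<close>

lemma measure_ball_tendsto:
  fixes z :: "nat \<Rightarrow> 'a::euclidean_space"
  assumes \<mu>: "\<mu> = density lborel (\<lambda>x. ennreal (f x))" and f: "f \<in> borel_measurable borel"
    and fin: "\<And>B. bounded B \<Longrightarrow> emeasure \<mu> B < \<infinity>"
    and z: "z \<longlonglongrightarrow> x" and s: "s \<longlonglongrightarrow> r"
  shows "(\<lambda>n. measure \<mu> (ball (z n) (s n))) \<longlonglongrightarrow> measure \<mu> (ball x r)"
proof -
  have sets: "sets \<mu> = sets borel" using \<mu> by simp
  obtain B1 where B1: "\<And>n. norm (z n) \<le> B1"
    using Bseq_eq_bounded convergent_imp_Bseq[of z] z unfolding convergent_def Bseq_def by blast
  obtain B2 where B2: "\<And>n. norm (s n) \<le> B2"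
    using Bseq_eq_bounded convergent_imp_Bseq[of s] s unfolding convergent_def Bseq_def by blast
  have int: "measure \<mu> (ball y u) = (\<integral>v. indicator (ball y u) v \<partial>\<mu>)" for y u
    using sets by simp
  have sub: "ball (z n) (s n) \<subseteq> cball 0 (B1 + B2)" for n
  proof
    fix v assume "v \<in> ball (z n) (s n)"
    then have "norm v \<le> norm (z n) + s n" using norm_triangle_sub[of v "z n"] by (simp add: dist_norm norm_minus_commute)
    then show "v \<in> cball 0 (B1 + B2)" using B1[of n] B2[of n] by simp
  qed
  have "AE v in lebesgue. v \<notin> sphere x r"
    using negligible_sphere[of x r] by (intro AE_not_in) (simp add: negligible_iff_null_sets)
  then have "AE v in lborel. v \<notin> sphere x r" by (simp add: AE_completion_iff)
  then have "AE v in \<mu>. v \<notin> sphere x r"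
    unfolding \<mu> using f by (subst AE_density) (auto elim: AE_mp)
  moreover have "(\<lambda>n. indicator (ball (z n) (s n)) v :: real) \<longlonglongrightarrow> indicator (ball x r) v" if "v \<notin> sphere x r" for v
  proof -
    have lim: "(\<lambda>n. dist (z n) v - s n) \<longlonglongrightarrow> dist x v - r" by (intro tendsto_intros z s)
    show ?thesis
    proof (cases "dist x v < r")
      case True
      then have "eventually (\<lambda>n. dist (z n) v - s n < 0) sequentially" by (intro order_tendstoD(2)[OF lim]) simp
      then have "eventually (\<lambda>n. indicator (ball (z n) (s n)) v = (1::real)) sequentially"
        by eventually_elim simp
      then show ?thesis using True by (simp add: tendsto_eventually)
    next
      case False
      then have "eventually (\<lambda>n. dist (z n) v - s n > 0) sequentially"
        using that by (intro order_tendstoD(1)[OF lim]) simp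
      then have "eventually (\<lambda>n. indicator (ball (z n) (s n)) v = (0::real)) sequentially"
        by eventually_elim simp
      then show ?thesis using False by (simp add: tendsto_eventually)
    qed
  qed
  ultimately have "AE v in \<mu>. (\<lambda>n. indicator (ball (z n) (s n)) v :: real) \<longlonglongrightarrow> indicator (ball x r) v"
    by (auto elim: AE_mp)
  then show ?thesis unfolding int
  proof (rule integral_dominated_convergence[where w = "indicator (cball 0 (B1 + B2))", rotated 3])
    show "AE v in \<mu>. norm (indicator (ball (z n) (s n)) v :: real) \<le> indicator (cball 0 (B1 + B2)) v" for n
      using sub[of n] by (intro AE_I2) (auto simp: indicator_def)
    show "integrable \<mu> (indicator (cball 0 (B1 + B2)) :: 'a \<Rightarrow> real)"
      using sets fin[of "cball 0 (B1 + B2)"] by (intro integrable_real_indicator) auto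
    show "(indicator (ball x r) :: 'a \<Rightarrow> real) \<in> borel_measurable \<mu>"
      using sets by (intro borel_measurable_indicator) simp
    show "(indicator (ball (z n) (s n)) :: 'a \<Rightarrow> real) \<in> borel_measurable \<mu>" for n
      using sets by (intro borel_measurable_indicator) simp
  qed
qed

lemma infdist_attained:
  fixes S :: "'a::euclidean_space set"
  assumes \<nu>: "locally_finite_cm \<nu>" and S: "S \<subseteq> cm_support \<nu>" "S \<noteq> {}"
  obtains a where "a \<in> S" "infdist x S = dist x a"
proof -
  obtain b where b: "b \<in> S" using S by auto
  let ?T = "S \<inter> cball x (dist x b)"
  have "finite ?T" by (rule finite_subset[OF _ finite_cm_support_Int[OF \<nu> bounded_cball[of x "dist x b"]]]) (use S in auto)
  moreover have "b \<in> ?T" using b by auto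
  ultimately obtain a where a: "a \<in> ?T" "\<And>y. y \<in> ?T \<Longrightarrow> dist x a \<le> dist x y"
    using arg_min_if_finite(1)[of ?T "dist x"] arg_min_least[of ?T _ "dist x"] by (metis empty_iff)
  have "dist x a \<le> dist x y" if "y \<in> S" for y
    using a that by (cases "dist x y \<le> dist x b") auto
  then have "dist x a \<le> infdist x S" using S(2) by (auto simp: infdist_notempty intro!: cINF_greatest)
  then have "infdist x S = dist x a" using a(1) infdist_le[of a S x] by auto
  then show ?thesis using that a by auto
qed

text \<open>The Voronoi cell is an intersection of half-spaces, and the closest bounding hyperplane
  bisects the segment to the nearest other atom. Without other atoms the inradius is infinite and
  its ball is the whole space.\<close>

lemma eball_inradius:
  fixes x :: "'a::euclidean_space"
  assumes \<nu>: "locally_finite_cm \<nu>"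
  defines "S \<equiv> cm_support \<nu> - {x}"
  shows "eball x (inradius x \<nu>) = (if S = {} then UNIV else ball x (infdist x S / 2))"
proof (cases "S = {}")
  case True
  then have "voronoi_cell x \<nu> = UNIV" by (auto simp: voronoi_cell_def S_def)
  then have le: "ereal R \<le> inradius x \<nu>" if "0 \<le> R" for R
    using that unfolding inradius_def by (intro Sup_upper) auto
  have "ereal (dist x y) < inradius x \<nu>" for y
  proof -
    have "ereal (dist x y) < ereal (dist x y + 1)" by simp
    also have "\<dots> \<le> inradius x \<nu>" by (rule le) simp
    finally show ?thesis .
  qed
  then show ?thesis using True by (auto simp: eball_def)
next
  case False
  obtain a where a: "a \<in> S" "infdist x S = dist x a"
    using infdist_attained[OF \<nu> _ False, of x] by (auto simp: S_def)
  let ?d = "dist x a"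
  have d: "?d > 0" using a by (auto simp: S_def)
  have le: "?d \<le> dist x y" if "y \<in> S" for y using a(2) infdist_le[OF that, of x] by simp
  have iff: "ball x R \<subseteq> voronoi_cell x \<nu> \<longleftrightarrow> R \<le> ?d / 2" for R
  proof
    assume R: "R \<le> ?d / 2"
    show "ball x R \<subseteq> voronoi_cell x \<nu>" unfolding voronoi_cell_def
    proof (intro subsetI CollectI ballI impI)
      fix y x' assume y: "y \<in> ball x R" and x': "x' \<in> cm_support \<nu>" "x' \<noteq> x"
      have "?d \<le> dist x x'" using le x' by (auto simp: S_def)
      also have "\<dots> \<le> dist x y + dist y x'" by (rule dist_triangle)
      finally show "norm (x - y) \<le> norm (y - x')" using y R by (auto simp: dist_norm)
    qed
  next
    assume sub: "ball x R \<subseteq> voronoi_cell x \<nu>"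
    show "R \<le> ?d / 2"
    proof (rule ccontr)
      assume "\<not> R \<le> ?d / 2"
      \<comment> \<open>A point at distance \<open>e\<close> from \<open>x\<close> on the segment to
        \<open>a\<close> lies in the ball but is closer to \<open>a\<close> than to
        \<open>x\<close>; \<open>e < ?d\<close> keeps it between the two atoms.\<close>
      then obtain e where e: "?d / 2 < e" "e < R" "e < ?d"
        using dense[of "?d/2" "min R ?d"] d by auto
      define y where "y = x + (e / ?d) *\<^sub>R (a - x)"
      have 1: "dist x y = e" using e d by (simp add: y_def dist_norm norm_minus_commute)
      have "y - a = (1 - e / ?d) *\<^sub>R (x - a)" by (simp add: y_def algebra_simps)
      then have "norm (y - a) = (1 - e / ?d) * ?d" using e d by (simp add: dist_norm[symmetric])
      also have "\<dots> = ?d - e" using d by (simp add: field_simps)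
      finally have 2: "norm (y - a) = ?d - e" .
      have "y \<in> voronoi_cell x \<nu>" using sub 1 e by auto
      then have "norm (x - y) \<le> norm (y - a)" using a by (auto simp: voronoi_cell_def S_def)
      then show False using 1 2 e by (simp add: dist_norm)
    qed
  qed
  have "inradius x \<nu> = ereal (?d / 2)"
    unfolding inradius_def iff
  proof (rule antisym)
    show "ereal (?d / 2) \<le> Sup {ereal R |R. 0 \<le> R \<and> R \<le> ?d / 2}"
      using d by (intro Sup_upper CollectI exI[of _ "?d / 2"]) auto
  qed (auto intro!: Sup_least)
  then show ?thesis using False a(2) by (auto simp: eball_def)
qed

definition inball_measure :: "'a::euclidean_space measure \<Rightarrow> ('a \<Rightarrow> nat) \<Rightarrow> 'a \<Rightarrow> real" where
  "inball_measure \<mu> \<nu> x = measure \<mu> (eball x (inradius x \<nu>))"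

lemma xi_hat_altdef:
  "xi_hat \<mu> W t \<nu> u = (\<Sum>x\<in>{x\<in>W \<inter> cm_support \<nu>. 2 ^ DIM('a) * t * inball_measure \<mu> \<nu> x - ln t = u}. \<nu> x)"
  for \<mu> :: "'a::euclidean_space measure"
  by (simp add: xi_hat_def inball_measure_def)

lemma
  fixes \<nu> :: "'a::euclidean_space \<Rightarrow> nat"
  assumes \<nu>: "locally_finite_cm \<nu>" and W: "bounded W"
  shows locally_finite_xi_hat: "locally_finite_cm (xi_hat \<mu> W t \<nu>)"
    and cm_count_xi_hat: "cm_count (xi_hat \<mu> W t \<nu>) B =
       (\<Sum>x\<in>{x\<in>W \<inter> cm_support \<nu>. 2 ^ DIM('a) * t * inball_measure \<mu> \<nu> x - ln t \<in> B}. \<nu> x)"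
proof -
  let ?v = "\<lambda>x. 2 ^ DIM('a) * t * inball_measure \<mu> \<nu> x - ln t"
  let ?T = "W \<inter> cm_support \<nu>"
  have fin: "finite ?T" by (rule finite_cm_support_Int[OF \<nu> W])
  have supp: "cm_support (xi_hat \<mu> W t \<nu>) = ?v ` ?T"
  proof -
    have "xi_hat \<mu> W t \<nu> u \<noteq> 0 \<longleftrightarrow> u \<in> ?v ` ?T" for u
    proof -
      have "finite {x\<in>?T. ?v x = u}" using fin by (rule rev_finite_subset) auto
      then have "xi_hat \<mu> W t \<nu> u = 0 \<longleftrightarrow> (\<forall>x\<in>{x\<in>?T. ?v x = u}. \<nu> x = 0)"
        unfolding xi_hat_altdef by (rule sum_eq_0_iff)
      then show ?thesis by (auto simp: cm_support_def)
    qed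
    then show ?thesis unfolding cm_support_def[of "xi_hat \<mu> W t \<nu>"] by blast
  qed
  then show "locally_finite_cm (xi_hat \<mu> W t \<nu>)" using fin by (simp add: locally_finite_cm_def)
  let ?TB = "{x\<in>?T. ?v x \<in> B}"
  have "cm_count (xi_hat \<mu> W t \<nu>) B = (\<Sum>u\<in>B \<inter> ?v ` ?T. \<Sum>x\<in>{x\<in>?TB. ?v x = u}. \<nu> x)"
    unfolding cm_count_def supp xi_hat_altdef by (intro sum.cong refl) auto
  also have "\<dots> = sum \<nu> ?TB" using fin by (intro sum.group) (auto intro: finite_subset[OF _ fin])
  finally show "cm_count (xi_hat \<mu> W t \<nu>) B = sum \<nu> ?TB" .
qed

section \<open>Measurability of the counts of values\<close>

text \<open>Only counts of sets are known to be measurable, so an atom is approximated by the centre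
  of the piece containing it, and the other atoms by those outside this piece. As the pieces shrink,
  the sum over pieces converges for each outcome because \<open>g\<close> is continuous.\<close>

lemma inball_measure_sum_measurable:
  fixes \<mu> :: "'a::euclidean_space measure" and \<eta> :: "'m \<Rightarrow> 'a \<Rightarrow> nat"
  assumes \<mu>: "\<mu> = density lborel (\<lambda>x. ennreal (f x))" and f: "f \<in> borel_measurable borel"
    and fin: "\<And>B. bounded B \<Longrightarrow> emeasure \<mu> B < \<infinity>" and W: "compact W"
    and lf: "\<And>\<omega>. \<omega> \<in> space M \<Longrightarrow> locally_finite_cm (\<eta> \<omega>)"
    and meas: "\<And>B. B \<in> sets borel \<Longrightarrow> bounded B \<Longrightarrow> (\<lambda>\<omega>. cm_count (\<eta> \<omega>) B) \<in> measurable M (count_space UNIV)"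
    and g: "continuous_on UNIV (g :: real \<Rightarrow> real)"
  shows "(\<lambda>\<omega>. \<Sum>x\<in>W \<inter> cm_support (\<eta> \<omega>). real (\<eta> \<omega> x) * g (inball_measure \<mu> (\<eta> \<omega>) x)) \<in> borel_measurable M"
proof -
  have sets: "sets \<mu> = sets borel" using \<mu> by simp
  have emp: "{\<omega>\<in>space M. cm_count (\<eta> \<omega>) B = 0} \<in> sets M" if "B \<in> sets borel" "bounded B" for B
    using measurable_sets[OF meas[OF that], of "{0}"] by (simp add: vimage_def Int_def conj_commute)
  \<comment> \<open>The ball measure attributed to an atom in the piece \<open>A\<close> with centre
    \<open>z\<close>; the first case mirrors the infinite inradius of a lone atom.\<close>
  define h where "h A z \<omega> = (if cm_support (\<eta> \<omega>) - A = {} then measure \<mu> UNIV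
     else measure \<mu> (ball z (infdist z (cm_support (\<eta> \<omega>) - A) / 2)))" for A z \<omega>
  have empty_meas: "{\<omega>\<in>space M. cm_support (\<eta> \<omega>) - A = {}} \<in> sets M" if A: "A \<in> sets borel" for A
  proof -
    have "cm_support (\<eta> \<omega>) - A = {} \<longleftrightarrow> (\<forall>k::nat. cm_count (\<eta> \<omega>) (ball 0 (real k) - A) = 0)" if "\<omega> \<in> space M" for \<omega>
    proof -
      have "cm_count (\<eta> \<omega>) (ball 0 (real k) - A) = 0 \<longleftrightarrow> (ball 0 (real k) - A) \<inter> cm_support (\<eta> \<omega>) = {}" for k
        by (rule cm_count_eq_0_iff[OF lf[OF that]]) (rule bounded_subset[OF bounded_ball], auto)
      moreover have "\<exists>k. x \<in> ball 0 (real k)" for x :: 'a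
        using reals_Archimedean2[of "norm x"] by auto
      ultimately show ?thesis by blast
    qed
    then have "{\<omega>\<in>space M. cm_support (\<eta> \<omega>) - A = {}} = {\<omega>\<in>space M. \<forall>k::nat. cm_count (\<eta> \<omega>) (ball 0 (real k) - A) = 0}"
      by blast
    also have "\<dots> \<in> sets M"
      using A by (intro sets.sets_Collect_countable_All emp) (auto intro: bounded_subset[OF bounded_ball])
    finally show ?thesis .
  qed
  have infdist_meas: "(\<lambda>\<omega>. infdist z (cm_support (\<eta> \<omega>) - A)) \<in> borel_measurable M" if A: "A \<in> sets borel" for A z
  proof (rule borel_measurableI_less)
    fix s :: real
    show "{\<omega>\<in>space M. infdist z (cm_support (\<eta> \<omega>) - A) < s} \<in> sets M"
    proof (cases "s > 0")
      case False
      then have "\<not> infdist z S < s" for S using infdist_nonneg[of z S] by linarith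
      then show ?thesis by simp
    next
      case True
      \<comment> \<open>By convention the distance to the empty set is 0, which lies below every
        positive \<open>s\<close>; hence the first disjunct.\<close>
      have "infdist z (cm_support (\<eta> \<omega>) - A) < s \<longleftrightarrow> cm_support (\<eta> \<omega>) - A = {} \<or> \<not> cm_count (\<eta> \<omega>) (ball z s - A) = 0"
        if "\<omega> \<in> space M" for \<omega>
      proof (cases "cm_support (\<eta> \<omega>) - A = {}")
        case False
        have "cm_count (\<eta> \<omega>) (ball z s - A) = 0 \<longleftrightarrow> (ball z s - A) \<inter> cm_support (\<eta> \<omega>) = {}"
          by (rule cm_count_eq_0_iff[OF lf[OF that]]) (rule bounded_subset[OF bounded_ball], auto)
        moreover have "infdist z (cm_support (\<eta> \<omega>) - A) < s \<longleftrightarrow> (\<exists>y\<in>cm_support (\<eta> \<omega>) - A. dist z y < s)"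
          using False by (simp add: infdist_notempty cINF_less_iff bdd_belowI2[of _ 0])
        ultimately show ?thesis using False by auto
      qed (use True in \<open>simp add: infdist_def\<close>)
      then have "{\<omega>\<in>space M. infdist z (cm_support (\<eta> \<omega>) - A) < s}
        = {\<omega>\<in>space M. cm_support (\<eta> \<omega>) - A = {}} \<union> (space M - {\<omega>\<in>space M. cm_count (\<eta> \<omega>) (ball z s - A) = 0})"
        by blast
      also have "\<dots> \<in> sets M"
        using A by (intro sets.Un sets.Diff sets.top empty_meas emp) (auto intro: bounded_subset[OF bounded_ball])
      finally show ?thesis .
    qed
  qed
  have h_meas: "h A z \<in> borel_measurable M" if A: "A \<in> sets borel" for A z
  proof -
    have "mono (\<lambda>s. measure \<mu> (ball z (s / 2)))"
    proof (rule monoI)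
      fix s s' :: real assume "s \<le> s'"
      then show "measure \<mu> (ball z (s / 2)) \<le> measure \<mu> (ball z (s' / 2))"
        using sets fin[of "ball z (s'/2)"] by (intro measure_mono_fmeasurable) (auto simp: fmeasurable_def)
    qed
    then have "(\<lambda>s. measure \<mu> (ball z (s / 2))) \<in> borel_measurable borel" by (rule borel_measurable_mono)
    from measurable_compose[OF infdist_meas[OF A] this]
    have "(\<lambda>\<omega>. measure \<mu> (ball z (infdist z (cm_support (\<eta> \<omega>) - A) / 2))) \<in> borel_measurable M" .
    then show ?thesis unfolding h_def[abs_def]
      using empty_meas[OF A] by (intro measurable_If) auto
  qed
  have "\<exists>N z Q. (\<forall>i<N. z i \<in> W) \<and> (\<forall>i. Q i \<in> sets borel) \<and> (\<forall>i. Q i \<subseteq> ball (z i) (1 / real (Suc n)))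
     \<and> disjoint_family Q \<and> (\<Union>i<N::nat. Q i) = W" for n
    by (rule small_partition[OF W order_refl, of "1 / real (Suc n)"]) (use W in \<open>auto simp: compact_imp_closed\<close>)
  then obtain N z Q where z: "\<And>n i. i < N n \<Longrightarrow> z n i \<in> W" and Q: "\<And>n i. Q n i \<in> sets borel"
      "\<And>n i. Q n i \<subseteq> ball (z n i) (1 / real (Suc n))" "\<And>n. disjoint_family (Q n)" "\<And>n. (\<Union>i<N n::nat. Q n i) = W"
    by metis
  have Q_bounded: "bounded (Q n i)" for n i by (rule bounded_subset[OF bounded_ball Q(2)])
  show ?thesis
  proof (rule borel_measurable_LIMSEQ_real)
    show "(\<lambda>\<omega>. \<Sum>i<N n. real (cm_count (\<eta> \<omega>) (Q n i)) * g (h (Q n i) (z n i) \<omega>)) \<in> borel_measurable M" for n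
    proof (intro borel_measurable_sum borel_measurable_times)
      show "(\<lambda>\<omega>. real (cm_count (\<eta> \<omega>) (Q n i))) \<in> borel_measurable M" for i
        by (rule measurable_compose[OF meas[OF Q(1) Q_bounded]]) simp
      show "(\<lambda>\<omega>. g (h (Q n i) (z n i) \<omega>)) \<in> borel_measurable M" for i
        using h_meas[OF Q(1)] g by (rule measurable_compose[OF _ borel_measurable_continuous_onI])
    qed
  next
    fix \<omega> assume \<omega>: "\<omega> \<in> space M"
    define \<nu> where "\<nu> = \<eta> \<omega>"
    have \<nu>: "locally_finite_cm \<nu>" using lf[OF \<omega>] by (simp add: \<nu>_def)
    let ?T = "W \<inter> cm_support \<nu>"
    have finT: "finite ?T" by (rule finite_cm_support_Int[OF \<nu> compact_imp_bounded[OF W]])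
    define \<iota> where "\<iota> n x = (THE i. x \<in> Q n i)" for n x
    have \<iota>_eq: "\<iota> n x = i" if "x \<in> Q n i" for n x i
      unfolding \<iota>_def using that Q(3)[of n] by (intro the_equality) (auto simp: disjoint_family_on_def)
    have \<iota>: "x \<in> Q n (\<iota> n x)" if "x \<in> W" for n x
      using that Q(4)[of n] \<iota>_eq by blast
    have "(\<lambda>n. \<Sum>x\<in>?T. real (\<nu> x) * g (h (Q n (\<iota> n x)) (z n (\<iota> n x)) \<omega>))
       \<longlonglongrightarrow> (\<Sum>x\<in>?T. real (\<nu> x) * g (inball_measure \<mu> \<nu> x))"
    proof (intro tendsto_sum tendsto_mult_left continuous_on_tendsto_compose[OF g])
      fix x assume x: "x \<in> ?T"
      have zx: "dist (z n (\<iota> n x)) x \<le> 1 / real (Suc n)" for n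
        using \<iota>[of x n] Q(2)[of n "\<iota> n x"] x by auto
      have "(\<lambda>n. dist (z n (\<iota> n x)) x) \<longlonglongrightarrow> 0"
        by (rule tendsto_0_le[OF LIMSEQ_inverse_real_of_nat, of _ 1]) (use zx in \<open>auto simp: inverse_eq_divide\<close>)
      then have zlim: "(\<lambda>n. z n (\<iota> n x)) \<longlonglongrightarrow> x" by (rule iffD2[OF tendsto_dist_iff])
      \<comment> \<open>\<open>W\<close> contains finitely many atoms, so small pieces separate
        \<open>x\<close> from them; atoms outside \<open>W\<close> are in no piece, since the pieces
        are subsets of \<open>W\<close>.\<close>
      have sep: "eventually (\<lambda>n. cm_support \<nu> - Q n (\<iota> n x) = cm_support \<nu> - {x}) sequentially"
      proof -
        have "eventually (\<lambda>n. \<forall>y\<in>?T - {x}. y \<notin> Q n (\<iota> n x)) sequentially"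
        proof (intro eventually_ball_finite ballI)
          fix y assume y: "y \<in> ?T - {x}"
          then have "dist x y / 2 > 0" by auto
          from order_tendstoD(2)[OF LIMSEQ_inverse_real_of_nat this]
          show "eventually (\<lambda>n. y \<notin> Q n (\<iota> n x)) sequentially"
          proof eventually_elim
            case (elim n)
            show ?case
            proof
              assume "y \<in> Q n (\<iota> n x)"
              then have "dist (z n (\<iota> n x)) y \<le> 1 / real (Suc n)" using Q(2)[of n "\<iota> n x"] by auto
              then have "dist x y \<le> 2 * inverse (real (Suc n))"
                using zx[of n] dist_triangle3[of x y "z n (\<iota> n x)"] by (simp add: inverse_eq_divide)
              then show False using elim by simp
            qed
          qed
        qed (use finT in auto)
        then show ?thesis
        proof eventually_elim
          case (elim n)
          have "y \<in> W" if "y \<in> Q n (\<iota> n x)" for y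
          proof -
            obtain i where "i < N n" "x \<in> Q n i" using Q(4)[of n] x by blast
            then have "\<iota> n x < N n" using \<iota>_eq by blast
            then show ?thesis using that Q(4)[of n] by blast
          qed
          moreover have "x \<in> Q n (\<iota> n x)" using \<iota>[of x n] x by blast
          ultimately show ?case using elim by blast
        qed
      qed
      show "(\<lambda>n. h (Q n (\<iota> n x)) (z n (\<iota> n x)) \<omega>) \<longlonglongrightarrow> inball_measure \<mu> \<nu> x"
      proof (cases "cm_support \<nu> - {x} = {}")
        case True
        have "eventually (\<lambda>n. h (Q n (\<iota> n x)) (z n (\<iota> n x)) \<omega> = inball_measure \<mu> \<nu> x) sequentially"
          using sep by eventually_elim (use True in \<open>simp add: h_def inball_measure_def eball_inradius[OF \<nu>] flip: \<nu>_def\<close>)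
        then show ?thesis by (rule tendsto_eventually)
      next
        case False
        have "(\<lambda>n. measure \<mu> (ball (z n (\<iota> n x)) (infdist (z n (\<iota> n x)) (cm_support \<nu> - {x}) / 2)))
          \<longlonglongrightarrow> measure \<mu> (ball x (infdist x (cm_support \<nu> - {x}) / 2))"
          by (intro measure_ball_tendsto[OF \<mu> f fin zlim] tendsto_divide tendsto_infdist zlim tendsto_const) auto
        moreover have "eventually (\<lambda>n. measure \<mu> (ball (z n (\<iota> n x)) (infdist (z n (\<iota> n x)) (cm_support \<nu> - {x}) / 2))
           = h (Q n (\<iota> n x)) (z n (\<iota> n x)) \<omega>) sequentially"
          using sep by eventually_elim (use False in \<open>simp add: h_def flip: \<nu>_def\<close>)
        ultimately have "(\<lambda>n. h (Q n (\<iota> n x)) (z n (\<iota> n x)) \<omega>) \<longlonglongrightarrow> measure \<mu> (ball x (infdist x (cm_support \<nu> - {x}) / 2))"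
          by (rule Lim_transform_eventually)
        then show ?thesis
          using False by (simp only: inball_measure_def eball_inradius[OF \<nu>] if_False)
      qed
    qed auto
    moreover have "(\<Sum>x\<in>?T. real (\<nu> x) * g (h (Q n (\<iota> n x)) (z n (\<iota> n x)) \<omega>))
       = (\<Sum>i<N n. real (cm_count (\<eta> \<omega>) (Q n i)) * g (h (Q n i) (z n i) \<omega>))" for n
    proof -
      have "?T = (\<Union>i<N n. Q n i \<inter> cm_support \<nu>)" using Q(4)[of n] by blast
      then have "(\<Sum>x\<in>?T. real (\<nu> x) * g (h (Q n (\<iota> n x)) (z n (\<iota> n x)) \<omega>))
        = (\<Sum>i<N n. \<Sum>x\<in>Q n i \<inter> cm_support \<nu>. real (\<nu> x) * g (h (Q n (\<iota> n x)) (z n (\<iota> n x)) \<omega>))"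
        using Q(3)[of n] finite_cm_support_Int[OF \<nu> Q_bounded]
        by (simp only:, intro sum.UNION_disjoint) (auto simp: disjoint_family_on_def)
      also have "\<dots> = (\<Sum>i<N n. \<Sum>x\<in>Q n i \<inter> cm_support \<nu>. real (\<nu> x) * g (h (Q n i) (z n i) \<omega>))"
        using \<iota>_eq by (intro sum.cong refl) auto
      finally show ?thesis by (simp only: cm_count_def sum_distrib_right of_nat_sum \<nu>_def)
    qed
    ultimately show "(\<lambda>n. \<Sum>i<N n. real (cm_count (\<eta> \<omega>) (Q n i)) * g (h (Q n i) (z n i) \<omega>))
       \<longlonglongrightarrow> (\<Sum>x\<in>W \<inter> cm_support (\<eta> \<omega>). real (\<eta> \<omega> x) * g (inball_measure \<mu> (\<eta> \<omega>) x))"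
      unfolding \<nu>_def by simp
  qed
qed

lemma cm_count_xi_hat_measurable:
  fixes \<mu> :: "'a::euclidean_space measure" and \<eta> :: "'m \<Rightarrow> 'a \<Rightarrow> nat"
  assumes \<mu>: "\<mu> = density lborel (\<lambda>x. ennreal (f x))" and f: "f \<in> borel_measurable borel"
    and fin: "\<And>B. bounded B \<Longrightarrow> emeasure \<mu> B < \<infinity>" and W: "compact W"
    and lf: "\<And>\<omega>. \<omega> \<in> space M \<Longrightarrow> locally_finite_cm (\<eta> \<omega>)"
    and meas: "\<And>B. B \<in> sets borel \<Longrightarrow> bounded B \<Longrightarrow> (\<lambda>\<omega>. cm_count (\<eta> \<omega>) B) \<in> measurable M (count_space UNIV)"
  shows "(\<lambda>\<omega>. cm_count (xi_hat \<mu> W t (\<eta> \<omega>)) {a..<b}) \<in> measurable M (count_space UNIV)"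
proof -
  let ?v = "\<lambda>\<omega> x. 2 ^ DIM('a) * t * inball_measure \<mu> (\<eta> \<omega>) x - ln t"
  \<comment> \<open>A ramp rising from 0 at \<open>c - 1 / n\<close> to 1 at \<open>c\<close>. It
    equals 1 at \<open>c\<close> itself, so the limit is the indicator of a closed half-line and
    \<open>G n\<close> tends to that of a half-open interval.\<close>
  define k where "k n c v = max 0 (min 1 (real n * (v - c) + 1))" for n and c v :: real
  define G where "G n v = k n a (2 ^ DIM('a) * t * v - ln t) * (1 - k n b (2 ^ DIM('a) * t * v - ln t))" for n v
  have k_lim: "(\<lambda>n. k n c v) \<longlonglongrightarrow> (if c \<le> v then 1 else 0)" for c v
  proof (cases "c \<le> v")
    case True
    then have "k n c v = 1" for n by (simp add: k_def)
    then show ?thesis using True by simp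
  next
    case False
    obtain n0 :: nat where n0: "1 / (c - v) < real n0" using reals_Archimedean2 by blast
    have "eventually (\<lambda>n. k n c v = 0) sequentially"
      using eventually_ge_at_top[of n0]
    proof eventually_elim
      case (elim n)
      then have "1 / (c - v) \<le> real n" using n0 by linarith
      then have "1 \<le> real n * (c - v)" using False by (simp add: field_simps)
      then show ?case by (simp add: k_def algebra_simps)
    qed
    then show ?thesis using False by (simp add: tendsto_eventually)
  qed
  have "(\<lambda>\<omega>. real (cm_count (xi_hat \<mu> W t (\<eta> \<omega>)) {a..<b})) \<in> borel_measurable M"
  proof (rule borel_measurable_LIMSEQ_real)
    show "(\<lambda>\<omega>. \<Sum>x\<in>W \<inter> cm_support (\<eta> \<omega>). real (\<eta> \<omega> x) * G n (inball_measure \<mu> (\<eta> \<omega>) x)) \<in> borel_measurable M" for n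
      by (rule inball_measure_sum_measurable[OF \<mu> f fin W lf meas])
         (auto simp: G_def k_def intro!: continuous_intros)
    fix \<omega> assume \<omega>: "\<omega> \<in> space M"
    let ?T = "W \<inter> cm_support (\<eta> \<omega>)"
    have finT: "finite ?T" by (rule finite_cm_support_Int[OF lf[OF \<omega>] compact_imp_bounded[OF W]])
    have "(\<lambda>n. \<Sum>x\<in>?T. real (\<eta> \<omega> x) * G n (inball_measure \<mu> (\<eta> \<omega>) x))
      \<longlonglongrightarrow> (\<Sum>x\<in>?T. real (\<eta> \<omega> x) * ((if a \<le> ?v \<omega> x then 1 else 0) * (1 - (if b \<le> ?v \<omega> x then 1 else 0))))"
      unfolding G_def by (intro tendsto_sum tendsto_mult tendsto_diff tendsto_const k_lim)
    also have "(\<Sum>x\<in>?T. real (\<eta> \<omega> x) * ((if a \<le> ?v \<omega> x then 1 else 0) * (1 - (if b \<le> ?v \<omega> x then 1 else 0))))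
       = (\<Sum>x\<in>{x\<in>?T. ?v \<omega> x \<in> {a..<b}}. real (\<eta> \<omega> x))"
      using finT by (intro sum.mono_neutral_cong_right) auto
    also have "\<dots> = real (cm_count (xi_hat \<mu> W t (\<eta> \<omega>)) {a..<b})"
      by (simp add: cm_count_xi_hat[OF lf[OF \<omega>] compact_imp_bounded[OF W]])
    finally show "(\<lambda>n. \<Sum>x\<in>?T. real (\<eta> \<omega> x) * G n (inball_measure \<mu> (\<eta> \<omega>) x)) \<longlonglongrightarrow> real (cm_count (xi_hat \<mu> W t (\<eta> \<omega>)) {a..<b})" .
  qed
  then have "{\<omega>\<in>space M. real (cm_count (xi_hat \<mu> W t (\<eta> \<omega>)) {a..<b}) = real j} \<in> sets M" for j
    by (rule borel_measurable_eq[OF _ borel_measurable_const])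
  then show ?thesis
    unfolding measurable_count_space_eq2_countable by (auto simp: vimage_def Int_def conj_commute)
qed

section \<open>Poisson laws and the Chen--Stein recursion\<close>

lemma (in prob_space) prob_diff_le:
  assumes "A \<in> events" "B \<in> events" "G \<in> events" "A - G = B - G"
  shows "\<bar>prob A - prob B\<bar> \<le> prob G"
proof -
  have "prob A \<le> prob (B \<union> G)" "prob B \<le> prob (A \<union> G)"
    using assms by (auto intro!: finite_measure_mono)
  moreover have "prob (B \<union> G) \<le> prob B + prob G" "prob (A \<union> G) \<le> prob A + prob G"
    using assms by (auto intro!: measure_Un_le)
  ultimately show ?thesis by linarith
qed

text \<open>\<open>D i\<close> is the dependency neighbourhood of \<open>i\<close>. If
  \<open>Y i l\<close> occurs and nothing else happens in \<open>D i\<close>, then the rest must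
  show the counts \<open>k\<close> minus one in class \<open>l\<close>, and the rest is independent
  of \<open>Y i l\<close>. The two error sums are the usual pair and product terms of the local
  Chen--Stein method; the events \<open>E i\<close> contain all classes and so bound them at
  once.\<close>

lemma (in prob_space) stein_recursion:
  fixes Y :: "'i \<Rightarrow> nat \<Rightarrow> 'a set" and D :: "'i \<Rightarrow> 'i set" and E :: "'i \<Rightarrow> 'a set" and m :: nat
  defines "X \<equiv> \<lambda>J l \<omega>. card {i\<in>J. \<omega> \<in> Y i l}"
  defines "S \<equiv> \<lambda>J k. {\<omega> \<in> space M. \<forall>l<m. X J l \<omega> = k l}"
  assumes I: "finite I"
    and Y: "\<And>i l. i \<in> I \<Longrightarrow> l < m \<Longrightarrow> Y i l \<in> events"
    and E: "\<And>i. i \<in> I \<Longrightarrow> E i \<in> events" "\<And>i l. i \<in> I \<Longrightarrow> l < m \<Longrightarrow> Y i l \<subseteq> E i"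
    and disj: "\<And>i l l'. i \<in> I \<Longrightarrow> l < m \<Longrightarrow> l' < m \<Longrightarrow> l \<noteq> l' \<Longrightarrow> Y i l \<inter> Y i l' = {}"
    and D: "\<And>i. i \<in> I \<Longrightarrow> D i \<subseteq> I" "\<And>i. i \<in> I \<Longrightarrow> i \<in> D i"
    and indep: "\<And>i l k. i \<in> I \<Longrightarrow> l < m \<Longrightarrow> prob (Y i l \<inter> S (I - D i) k) = prob (Y i l) * prob (S (I - D i) k)"
    and l: "l < m" and k: "k l \<ge> 1"
  shows "\<bar>real (k l) * prob (S I k) - (\<Sum>i\<in>I. prob (Y i l)) * prob (S I (k(l := k l - 1)))\<bar>
     \<le> (\<Sum>i\<in>I. \<Sum>i'\<in>D i - {i}. prob (E i \<inter> E i')) + (\<Sum>i\<in>I. \<Sum>i'\<in>D i. prob (E i) * prob (E i'))"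
proof -
  let ?k = "k(l := k l - 1)"
  have finD: "finite (D i)" if "i \<in> I" for i using D(1)[OF that] I by (rule finite_subset)
  have X_meas: "X J l \<in> measurable M (count_space UNIV)" if "J \<subseteq> I" "l < m" for J l
  proof -
    have "finite J" using that I finite_subset by auto
    have eq: "X J l = (\<lambda>\<omega>. \<Sum>i\<in>J. if \<omega> \<in> Y i l then 1 else 0)"
      by (auto simp: X_def fun_eq_iff indicator_def sum.If_cases \<open>finite J\<close> Int_def)
    show ?thesis unfolding eq

      using Y that by (intro measurable_sum_nat measurable_If_set) auto
  qed
  have S_meas: "S J k \<in> events" if "J \<subseteq> I" for J k
  proof -
    have "(\<lambda>\<omega>. X J l \<omega> = k l) \<in> measurable M (count_space UNIV)" if "l < m" for l
      using measurable_compose[OF X_meas[OF \<open>J \<subseteq> I\<close> that], of "\<lambda>x. x = k l"] by simp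
    then have *: "{\<omega>\<in>space M. X J l \<omega> = k l} \<in> events" if "l < m" for l
      using that by (auto simp: pred_def)
    have "{\<omega>\<in>space M. \<forall>l\<in>{..<m}. X J l \<omega> = k l} \<in> events"
      by (rule sets.sets_Collect_finite_All) (use * in auto)
    moreover have "{\<omega>\<in>space M. \<forall>l\<in>{..<m}. X J l \<omega> = k l} = S J k"
      unfolding S_def by blast
    ultimately show ?thesis by metis
  qed
  have split: "X I l' \<omega> = X (D i) l' \<omega> + X (I - D i) l' \<omega>" if "i \<in> I" for i l' \<omega>
  proof -
    have "{j\<in>I. \<omega> \<in> Y j l'} = {j\<in>D i. \<omega> \<in> Y j l'} \<union> {j\<in>I - D i. \<omega> \<in> Y j l'}"
      using D(1)[OF that] by blast
    then show ?thesis unfolding X_def using I finD[OF that]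
      by (simp add: card_Un_disjoint disjoint_iff)
  qed
  \<comment> \<open>On \<open>S I k\<close> exactly \<open>k l\<close> of the events
    \<open>Y i l\<close> occur, so the indicator times \<open>k l\<close> is a sum of
    indicators.\<close>
  have first: "real (k l) * prob (S I k) = (\<Sum>i\<in>I. prob (Y i l \<inter> S I k))"
  proof -
    have "real (k l) * prob (S I k) = (\<integral>\<omega>. real (k l) * indicator (S I k) \<omega> \<partial>M)"
      using S_meas[of I k] by simp
    also have "\<dots> = (\<integral>\<omega>. (\<Sum>i\<in>I. indicator (Y i l \<inter> S I k) \<omega>) \<partial>M)"
    proof (intro Bochner_Integration.integral_cong refl)
      fix \<omega> assume "\<omega> \<in> space M"
      show "real (k l) * indicator (S I k) \<omega> = (\<Sum>i\<in>I. indicator (Y i l \<inter> S I k) \<omega> :: real)"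
      proof (cases "\<omega> \<in> S I k")
        case True
        then have "k l = X I l \<omega>" using l by (simp add: S_def)
        then show ?thesis using True by (simp add: X_def indicator_def sum.If_cases I Int_def)
      qed simp
    qed
    also have "\<dots> = (\<Sum>i\<in>I. prob (Y i l \<inter> S I k))"
      using Y S_meas[of I k] l by (subst Bochner_Integration.integral_sum) (auto intro!: integrable_real_indicator simp: less_top[symmetric])
    finally show ?thesis .
  qed
  \<comment> \<open>Unless some other \<open>E i'\<close> in the neighbourhood occurs,
    \<open>D i\<close> contributes precisely one hit in class \<open>l\<close>, and no other class
    is hit because the classes are disjoint.\<close>
  have step1: "\<bar>prob (Y i l \<inter> S I k) - prob (Y i l \<inter> S (I - D i) ?k)\<bar> \<le> (\<Sum>i'\<in>D i - {i}. prob (E i \<inter> E i'))"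
    if i: "i \<in> I" for i
  proof -
    let ?G = "\<Union>i'\<in>D i - {i}. E i \<inter> E i'"
    have EE: "E i \<inter> E i' \<in> events" if "i' \<in> D i" for i' using E(1) D(1)[OF i] that i by auto
    have "\<bar>prob (Y i l \<inter> S I k) - prob (Y i l \<inter> S (I - D i) ?k)\<bar> \<le> prob ?G"
    proof (rule prob_diff_le)
      have "\<omega> \<in> S I k \<longleftrightarrow> \<omega> \<in> S (I - D i) ?k" if w: "\<omega> \<in> Y i l" "\<omega> \<notin> ?G" "\<omega> \<in> space M" for \<omega>
      proof -
        have XD: "X (D i) l' \<omega> = (if l' = l then 1 else 0)" if "l' < m" for l'
        proof -
          have "{i'\<in>D i. \<omega> \<in> Y i' l'} = (if l' = l then {i} else {})"
            using w E(2)[OF i l] E(2) D[OF i] disj[OF i l \<open>l' < m\<close>] \<open>l' < m\<close> by (auto; blast)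
          then show ?thesis by (simp add: X_def)
        qed
        have "X I l' \<omega> = k l' \<longleftrightarrow> X (I - D i) l' \<omega> = ?k l'" if "l' < m" for l'
          using XD[OF that] k by (auto simp: split[OF i])
        then show ?thesis using w by (simp add: S_def)
      qed
      moreover have "Y i l \<subseteq> space M" using Y[OF i l] sets.sets_into_space by auto
      ultimately show "Y i l \<inter> S I k - ?G = Y i l \<inter> S (I - D i) ?k - ?G" by blast
      show "?G \<in> events" using EE finD[OF i] by (intro sets.finite_UN) auto
    qed (use Y[OF i l] S_meas in auto)
    also have "\<dots> \<le> (\<Sum>i'\<in>D i - {i}. prob (E i \<inter> E i'))"
      using finD[OF i] EE by (intro finite_measure_subadditive_finite) auto
    finally show ?thesis .
  qed
  \<comment> \<open>The neighbourhood is put back so that the second factor no longer depends on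
    \<open>i\<close> and the sum over \<open>i\<close> factorises.\<close>
  have step2: "\<bar>prob (S (I - D i) ?k) - prob (S I ?k)\<bar> \<le> (\<Sum>i'\<in>D i. prob (E i'))"
    if i: "i \<in> I" for i
  proof -
    let ?G = "\<Union>i'\<in>D i. E i'"
    have EE: "E i' \<in> events" if "i' \<in> D i" for i' using E(1) D(1)[OF i] that i by auto
    have "\<bar>prob (S (I - D i) ?k) - prob (S I ?k)\<bar> \<le> prob ?G"
    proof (rule prob_diff_le)
      have "\<omega> \<in> S I ?k \<longleftrightarrow> \<omega> \<in> S (I - D i) ?k" if w: "\<omega> \<notin> ?G" "\<omega> \<in> space M" for \<omega>
      proof -
        have XD: "X (D i) l' \<omega> = 0" if "l' < m" for l'
        proof -
          have "{i'\<in>D i. \<omega> \<in> Y i' l'} = {}"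
            using w E(2) D[OF i] \<open>l' < m\<close> by blast
          then show ?thesis unfolding X_def by (simp only: card.empty)
        qed
        then show ?thesis using w by (simp add: S_def split[OF i])
      qed
      moreover have "S J k' \<subseteq> space M" for J k' by (auto simp: S_def)
      ultimately show "S (I - D i) ?k - ?G = S I ?k - ?G" by blast
      show "?G \<in> events" using EE finD[OF i] by (intro sets.finite_UN) auto
    qed (use S_meas in auto)
    also have "\<dots> \<le> (\<Sum>i'\<in>D i. prob (E i'))"
      using finD[OF i] EE by (intro finite_measure_subadditive_finite) auto
    finally show ?thesis .
  qed
  have "\<bar>prob (Y i l \<inter> S I k) - prob (Y i l) * prob (S I ?k)\<bar>
     \<le> (\<Sum>i'\<in>D i - {i}. prob (E i \<inter> E i')) + (\<Sum>i'\<in>D i. prob (E i) * prob (E i'))" if i: "i \<in> I" for i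
  proof -
    have "\<bar>prob (Y i l) * prob (S (I - D i) ?k) - prob (Y i l) * prob (S I ?k)\<bar>
      = prob (Y i l) * \<bar>prob (S (I - D i) ?k) - prob (S I ?k)\<bar>"
      by (simp add: abs_mult right_diff_distrib flip: right_diff_distrib)
    also have "\<dots> \<le> prob (E i) * (\<Sum>i'\<in>D i. prob (E i'))"
      using step2[OF i] E i l by (intro mult_mono finite_measure_mono) auto
    finally show ?thesis using step1[OF i] indep[OF i l] by (simp add: sum_distrib_left)
  qed
  then have "(\<Sum>i\<in>I. \<bar>prob (Y i l \<inter> S I k) - prob (Y i l) * prob (S I ?k)\<bar>)
     \<le> (\<Sum>i\<in>I. (\<Sum>i'\<in>D i - {i}. prob (E i \<inter> E i')) + (\<Sum>i'\<in>D i. prob (E i) * prob (E i')))"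
    by (rule sum_mono)
  moreover have "\<bar>real (k l) * prob (S I k) - (\<Sum>i\<in>I. prob (Y i l)) * prob (S I ?k)\<bar>
    \<le> (\<Sum>i\<in>I. \<bar>prob (Y i l \<inter> S I k) - prob (Y i l) * prob (S I ?k)\<bar>)"
    unfolding first sum_distrib_right sum_subtractf[symmetric] by (rule sum_abs)
  ultimately show ?thesis by (simp add: sum.distrib)
qed

text \<open>The recursion \<open>k\<^sub>l p(k) = \<lambda>\<^sub>l p(k - e\<^sub>l)\<close> determines \<open>p\<close> up to the
  factor \<open>p(0)\<close>, which is in turn fixed by normalisation and tightness.\<close>
lemma poisson_recursion_limit:
  fixes p :: "'t \<Rightarrow> (nat \<Rightarrow> nat) \<Rightarrow> real" and \<pi> :: "(nat \<Rightarrow> nat) \<Rightarrow> real"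
  assumes rec: "\<And>l k. l < m \<Longrightarrow> k l \<ge> 1 \<Longrightarrow>
      ((\<lambda>t. real (k l) * p t k - c l * p t (k(l := k l - 1))) \<longlongrightarrow> 0) F"
    and rec': "\<And>l k. l < m \<Longrightarrow> k l \<ge> 1 \<Longrightarrow> real (k l) * \<pi> k = c l * \<pi> (k(l := k l - 1))"
    and cong: "\<And>t k k'. (\<And>l. l < m \<Longrightarrow> k l = k' l) \<Longrightarrow> p t k = p t k'"
    and cong': "\<And>k k'. (\<And>l. l < m \<Longrightarrow> k l = k' l) \<Longrightarrow> \<pi> k = \<pi> k'"
    and bound: "eventually (\<lambda>t. \<forall>k. 0 \<le> p t k \<and> p t k \<le> 1) F"
    and bound': "\<And>k. 0 \<le> \<pi> k \<and> \<pi> k \<le> 1"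
    and tight: "\<And>\<epsilon>. \<epsilon> > 0 \<Longrightarrow> \<exists>K. eventually (\<lambda>t. \<bar>(\<Sum>k\<in>{..<m} \<rightarrow>\<^sub>E {..K}. p t k) - 1\<bar> \<le> \<epsilon>) F \<and>
         \<bar>(\<Sum>k\<in>{..<m} \<rightarrow>\<^sub>E {..K}. \<pi> k) - 1\<bar> \<le> \<epsilon>"
    and pos: "\<pi> (\<lambda>_. 0) > 0"
  shows "((\<lambda>t. p t k) \<longlongrightarrow> \<pi> k) F"
proof -
  let ?z = "\<lambda>_::nat. 0::nat"
  \<comment> \<open>The ratios to the value at 0 are compared in cross-multiplied form, as
    \<open>p t ?z\<close> could still tend to 0 at this stage.\<close>
  have ratio: "((\<lambda>t. p t k * \<pi> ?z - p t ?z * \<pi> k) \<longlongrightarrow> 0) F" for k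
  proof (induction "\<Sum>l<m. k l" arbitrary: k)
    case 0
    then have "p t k = p t ?z" "\<pi> k = \<pi> ?z" for t by (auto intro!: cong cong')
    then show ?case by simp
  next
    case (Suc n)
    then obtain l where l: "l < m" "k l \<ge> 1"
      by (metis (no_types, lifting) One_nat_def Suc_leI bot_nat_0.not_eq_extremum lessThan_iff nat.distinct(1) sum.neutral)
    let ?k = "k(l := k l - 1)"
    have "(\<Sum>l<m. k l) = k l + (\<Sum>l\<in>{..<m} - {l}. k l)" "(\<Sum>l<m. ?k l) = k l - 1 + (\<Sum>l\<in>{..<m} - {l}. k l)"
      using l by (auto simp: sum.remove[of "{..<m}" l])
    then have "n = (\<Sum>l<m. ?k l)" using Suc(2) l by simp
    from Suc(1)[OF this] rec[of l k, OF l]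
    have "((\<lambda>t. inverse (k l) * ((real (k l) * p t k - c l * p t ?k) * \<pi> ?z + c l * (p t ?k * \<pi> ?z - p t ?z * \<pi> ?k)))
       \<longlongrightarrow> inverse (k l) * (0 * \<pi> ?z + c l * 0)) F"
      by (intro tendsto_intros)
    moreover have "inverse (k l) * ((real (k l) * p t k - c l * p t ?k) * \<pi> ?z + c l * (p t ?k * \<pi> ?z - p t ?z * \<pi> ?k))
      = p t k * \<pi> ?z - p t ?z * \<pi> k" for t
    proof -
      have "inverse (k l) * ((real (k l) * p t k - c l * p t ?k) * \<pi> ?z + c l * (p t ?k * \<pi> ?z - p t ?z * \<pi> ?k))
        = inverse (k l) * (real (k l) * p t k * \<pi> ?z - p t ?z * (c l * \<pi> ?k))"
        by (simp add: algebra_simps)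
      also have "\<dots> = p t k * \<pi> ?z - p t ?z * \<pi> k"
        unfolding rec'[of l k, OF l, symmetric] using l by (simp add: field_simps)
      finally show ?thesis .
    qed
    ultimately show ?case by simp
  qed
  \<comment> \<open>Summing the cross-multiplied relation over a box that carries almost all of both
    masses leaves \<open>\<pi> ?z - p t ?z\<close> up to small errors.\<close>
  have p0: "((\<lambda>t. p t ?z) \<longlongrightarrow> \<pi> ?z) F"
  proof (rule tendstoI)
    fix e :: real assume "e > 0"
    then obtain K where K: "eventually (\<lambda>t. \<bar>(\<Sum>k\<in>{..<m} \<rightarrow>\<^sub>E {..K}. p t k) - 1\<bar> \<le> e/4) F"
         "\<bar>(\<Sum>k\<in>{..<m} \<rightarrow>\<^sub>E {..K}. \<pi> k) - 1\<bar> \<le> e/4" using tight[of "e/4"] by auto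
    let ?B = "{..<m} \<rightarrow>\<^sub>E {..K}"
    have "((\<lambda>t. \<Sum>k\<in>?B. p t k * \<pi> ?z - p t ?z * \<pi> k) \<longlongrightarrow> (\<Sum>k\<in>?B. 0)) F"
      by (intro tendsto_sum ratio)
    then have "eventually (\<lambda>t. \<bar>\<Sum>k\<in>?B. p t k * \<pi> ?z - p t ?z * \<pi> k\<bar> < e/4) F"
      using \<open>e > 0\<close> by (auto dest!: tendstoD[of _ _ _ "e/4"] simp: dist_real_def)
    with K(1) bound show "eventually (\<lambda>t. dist (p t ?z) (\<pi> ?z) < e) F"
    proof eventually_elim
      case (elim t)
      let ?a = "\<Sum>k\<in>?B. p t k" and ?b = "\<Sum>k\<in>?B. \<pi> k"
      have 1: "\<bar>?a * \<pi> ?z - p t ?z * ?b\<bar> < e/4"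
        using elim(3) by (simp add: sum_subtractf sum_distrib_left sum_distrib_right)
      have 2: "\<bar>(?a - 1) * \<pi> ?z\<bar> \<le> e/4 * 1" "\<bar>p t ?z * (?b - 1)\<bar> \<le> 1 * (e/4)"
        unfolding abs_mult using elim bound'[of ?z] K(2) \<open>e > 0\<close> by (intro mult_mono; force)+
      have "\<pi> ?z - p t ?z = (?a * \<pi> ?z - p t ?z * ?b) - (?a - 1) * \<pi> ?z + p t ?z * (?b - 1)"
        by (simp add: algebra_simps)
      then have "\<bar>\<pi> ?z - p t ?z\<bar> \<le> e/4 + e/4 + e/4" using 1 2 by linarith
      then show ?case using \<open>e > 0\<close> unfolding dist_real_def by linarith
    qed
  qed
  have "((\<lambda>t. ((p t k * \<pi> ?z - p t ?z * \<pi> k) + p t ?z * \<pi> k) / \<pi> ?z) \<longlongrightarrow> (0 + \<pi> ?z * \<pi> k) / \<pi> ?z) F"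
    using pos by (intro tendsto_intros ratio p0) auto
  then show ?thesis using pos by simp
qed

section \<open>Joint laws of finitely many counts\<close>

lemma (in prob_space) joint_event:
  fixes Z :: "nat \<Rightarrow> 'a \<Rightarrow> nat"
  assumes "\<And>l. Z l \<in> measurable M (count_space UNIV)"
  shows "{\<omega>\<in>space M. \<forall>l<m. R l (Z l \<omega>)} \<in> events"
proof -
  have "{\<omega>\<in>space M. R l (Z l \<omega>)} \<in> events" for l
    using measurable_sets[OF assms[of l], of "{x. R l x}"] by (simp add: vimage_def Int_def conj_commute)
  then have "{\<omega>\<in>space M. \<forall>l\<in>{..<m}. R l (Z l \<omega>)} \<in> events"
    by (intro sets.sets_Collect_finite_All) auto
  moreover have "{\<omega>\<in>space M. \<forall>l\<in>{..<m}. R l (Z l \<omega>)} = {\<omega>\<in>space M. \<forall>l<m. R l (Z l \<omega>)}" by blast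
  ultimately show ?thesis by metis
qed

text \<open>Extensional functions represent each vector of \<open>m\<close> counts exactly once, so
  the events on the left are disjoint.\<close>

lemma (in prob_space) box_law:
  fixes Z :: "nat \<Rightarrow> 'a \<Rightarrow> nat"
  assumes Z: "\<And>l. Z l \<in> measurable M (count_space UNIV)"
  shows "(\<Sum>k\<in>{..<m} \<rightarrow>\<^sub>E {..K}. prob {\<omega>\<in>space M. \<forall>l<m. Z l \<omega> = k l}) = prob {\<omega>\<in>space M. \<forall>l<m. Z l \<omega> \<le> K}"
proof -
  let ?q = "\<lambda>k. {\<omega>\<in>space M. \<forall>l<m. Z l \<omega> = k l}" and ?A = "{\<omega>\<in>space M. \<forall>l<m. Z l \<omega> \<le> K}"
  have "prob (\<Union>k\<in>{..<m} \<rightarrow>\<^sub>E {..K}. ?q k) = (\<Sum>k\<in>{..<m} \<rightarrow>\<^sub>E {..K}. prob (?q k))"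
  proof (rule finite_measure_finite_Union)
    show "finite ({..<m} \<rightarrow>\<^sub>E {..K})" by (intro finite_PiE) auto
    show "?q ` ({..<m} \<rightarrow>\<^sub>E {..K}) \<subseteq> events"
    proof
      fix e assume "e \<in> ?q ` ({..<m} \<rightarrow>\<^sub>E {..K})"
      then obtain k where k: "e = ?q k" by (rule imageE)
      show "e \<in> events" unfolding k by (rule joint_event[OF Z, where R = "\<lambda>l x. x = k l"])
    qed
    show "disjoint_family_on ?q ({..<m} \<rightarrow>\<^sub>E {..K})"
      unfolding disjoint_family_on_def
    proof (intro ballI impI)
      fix k k' assume "k \<in> {..<m} \<rightarrow>\<^sub>E {..K}" "k' \<in> {..<m} \<rightarrow>\<^sub>E {..K}" "k \<noteq> k'"
      then obtain l where "l < m" "k l \<noteq> k' l" by (metis PiE_ext lessThan_iff)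
      then show "?q k \<inter> ?q k' = {}" by auto
    qed
  qed
  moreover have "(\<Union>k\<in>{..<m} \<rightarrow>\<^sub>E {..K}. ?q k) = ?A"
  proof (intro equalityI subsetI)
    fix \<omega> assume "\<omega> \<in> ?A"
    then have "(\<lambda>l\<in>{..<m}. Z l \<omega>) \<in> {..<m} \<rightarrow>\<^sub>E {..K}" "\<omega> \<in> ?q (\<lambda>l\<in>{..<m}. Z l \<omega>)" by auto
    then show "\<omega> \<in> (\<Union>k\<in>{..<m} \<rightarrow>\<^sub>E {..K}. ?q k)" by blast
  qed (auto simp: PiE_def Pi_def)
  ultimately show ?thesis by simp
qed

lemma half_line_measure_interval:
  fixes M :: "real measure"
  assumes "sets M = sets borel" "\<And>u. emeasure M {u..} = ennreal (exp (- u))" "a \<le> b"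
  shows "measure M {a..<b} = exp (- a) - exp (- b)"
proof -
  have "{a..<b} = {a..} - {b..}" using assms(3) by auto
  moreover have "measure M ({a..} - {b..}) = measure M {a..} - measure M {b..}"
    using assms by (intro measure_Diff) auto
  ultimately show ?thesis using assms(2) by (simp add: measure_def)
qed

lemma poisson_joint_law:
  fixes B :: "nat \<Rightarrow> 'b::euclidean_space set"
  assumes poisson: "poisson_process Q \<zeta> M" and B: "\<And>l. l < m \<Longrightarrow> B l \<in> sets borel \<and> bounded (B l)"
    and disj: "disjoint_family_on B {..<m}" and m: "0 < m"
  shows "measure Q {\<omega>\<in>space Q. \<forall>l<m. cm_count (\<zeta> \<omega>) (B l) = k l}
    = (\<Prod>l<m. measure M (B l) ^ k l / fact (k l) * exp (- measure M (B l)))"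
proof -
  interpret Q: prob_space Q using poisson by (simp add: poisson_process_def)
  have "finite {..<m} \<and> (\<forall>l\<in>{..<m}. B l \<in> sets borel \<and> bounded (B l)) \<and> disjoint_family_on B {..<m}"
    using B disj by auto
  then have indep: "Q.indep_vars (\<lambda>_. count_space UNIV) (\<lambda>l \<omega>. cm_count (\<zeta> \<omega>) (B l)) {..<m}"
    using poisson unfolding poisson_process_def by blast
  have "{\<omega>\<in>space Q. \<forall>l<m. cm_count (\<zeta> \<omega>) (B l) = k l} = (\<Inter>l\<in>{..<m}. (\<lambda>\<omega>. cm_count (\<zeta> \<omega>) (B l)) -` {k l} \<inter> space Q)"
    using m by auto
  also have "measure Q \<dots> = (\<Prod>l<m. measure Q ((\<lambda>\<omega>. cm_count (\<zeta> \<omega>) (B l)) -` {k l} \<inter> space Q))"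
    using m by (intro Q.indep_varsD[OF indep]) auto
  also have "\<dots> = (\<Prod>l<m. measure M (B l) ^ k l / fact (k l) * exp (- measure M (B l)))"
  proof (rule prod.cong[OF refl])
    fix l assume "l \<in> {..<m}"
    then have "measure Q {\<omega>\<in>space Q. cm_count (\<zeta> \<omega>) (B l) = k l} = measure M (B l) ^ k l / fact (k l) * exp (- measure M (B l))"
      using poisson B[of l] by (simp only: poisson_process_def lessThan_iff)
    moreover have "(\<lambda>\<omega>. cm_count (\<zeta> \<omega>) (B l)) -` {k l} \<inter> space Q = {\<omega>\<in>space Q. cm_count (\<zeta> \<omega>) (B l) = k l}" by auto
    ultimately show "measure Q ((\<lambda>\<omega>. cm_count (\<zeta> \<omega>) (B l)) -` {k l} \<inter> space Q) = measure M (B l) ^ k l / fact (k l) * exp (- measure M (B l))"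
      by simp
  qed
  finally show ?thesis .
qed

lemma poisson_weight_recursion:
  fixes c :: "nat \<Rightarrow> real" and k :: "nat \<Rightarrow> nat"
  assumes "l < m" "1 \<le> k l"
  shows "real (k l) * (\<Prod>j<m. c j ^ k j / fact (k j) * exp (- c j))
    = c l * (\<Prod>j<m. c j ^ (k(l := k l - 1)) j / fact ((k(l := k l - 1)) j) * exp (- c j))"
proof -
  let ?w = "\<lambda>k j. c j ^ k j / fact (k j) * exp (- c j)" and ?k = "k(l := k l - 1)"
  obtain j where j: "k l = Suc j" using assms(2) by (cases "k l") auto
  have A: "real (k l) * ?w k l = c l * ?w ?k l"
    unfolding j by (simp del: of_nat_Suc)
  have B: "(\<Prod>j\<in>{..<m} - {l}. ?w ?k j) = (\<Prod>j\<in>{..<m} - {l}. ?w k j)" by (intro prod.cong) auto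
  have C: "(\<Prod>j<m. ?w k' j) = ?w k' l * (\<Prod>j\<in>{..<m} - {l}. ?w k' j)" for k'
    using assms(1) by (intro prod.remove) auto
  have "real (k l) * (\<Prod>j<m. ?w k j) = (real (k l) * ?w k l) * (\<Prod>j\<in>{..<m} - {l}. ?w k j)"
    unfolding C[of k] by (rule mult.assoc[symmetric])
  also have "\<dots> = (c l * ?w ?k l) * (\<Prod>j\<in>{..<m} - {l}. ?w ?k j)" unfolding A B ..
  also have "\<dots> = c l * (\<Prod>j<m. ?w ?k j)" unfolding C[of ?k] by (rule mult.assoc)
  finally show ?thesis .
qed

lemma (in prob_space) box_law_tendsto:
  fixes Z :: "nat \<Rightarrow> 'a \<Rightarrow> nat"
  assumes Z: "\<And>l. Z l \<in> measurable M (count_space UNIV)"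
  shows "(\<lambda>K. \<Sum>k\<in>{..<m} \<rightarrow>\<^sub>E {..K}. prob {\<omega>\<in>space M. \<forall>l<m. Z l \<omega> = k l}) \<longlonglongrightarrow> 1"
proof -
  let ?A = "\<lambda>K. {\<omega>\<in>space M. \<forall>l<m. Z l \<omega> \<le> K}"
  have "(\<lambda>K. prob (?A K)) \<longlonglongrightarrow> prob (\<Union>K. ?A K)"
  proof (rule finite_Lim_measure_incseq)
    show "range ?A \<subseteq> events"
    proof
      fix e assume "e \<in> range ?A"
      then obtain K where K: "e = ?A K" by (rule imageE)
      show "e \<in> events" unfolding K by (rule joint_event[OF Z, where R = "\<lambda>l x. x \<le> K"])
    qed
    show "incseq ?A" by (auto simp: incseq_def intro: order_trans)
  qed
  moreover have "(\<Union>K. ?A K) = space M"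
  proof (intro equalityI subsetI)
    fix \<omega> assume "\<omega> \<in> space M"
    moreover have "Z l \<omega> \<le> (\<Sum>l<m. Z l \<omega>)" if "l < m" for l using that by (intro member_le_sum) auto
    ultimately show "\<omega> \<in> (\<Union>K. ?A K)" by blast
  qed auto
  ultimately show ?thesis by (simp add: prob_space box_law[OF Z])
qed

section \<open>The measure of small balls\<close>

text \<open>The open set around \<open>W\<close> has become a tube of uniform radius \<rho>, which
  exists by compactness. Since \<rho> is at most 1, the local geometry stays in unit balls around
  points of \<open>W\<close>.\<close>

locale voronoi_density =
  fixes f :: "'a::euclidean_space \<Rightarrow> real" and \<mu> :: "'a measure" and W :: "'a set"
    and C b a1 a2 \<rho> :: real
  assumes f_meas: "f \<in> borel_measurable borel"
    and mu_def: "\<mu> = density lborel (\<lambda>x. ennreal (f x))"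
    and mu_loc_fin: "\<And>B. bounded B \<Longrightarrow> emeasure \<mu> B < \<infinity>"
    and W_compact: "compact W"
    and mu_W: "measure \<mu> W = 1"
    and C: "0 < C" and b: "0 < b"
    and hoelder: "\<And>x y. \<bar>f x - f y\<bar> \<le> C * norm (x - y) powr b"
    and a1: "0 < a1" and \<rho>: "0 < \<rho>" "\<rho> \<le> 1"
    and near: "\<And>x y. x \<in> W \<Longrightarrow> dist x y \<le> \<rho> \<Longrightarrow> a1 \<le> f y \<and> f y \<le> a2"
begin

definition v :: real where "v = unit_ball_vol (real DIM('a))"

lemma v_pos: "0 < v" by (simp add: v_def)

lemma sets_mu [simp, measurable_cong]: "sets \<mu> = sets borel" and space_mu [simp]: "space \<mu> = UNIV"
  using mu_def by simp_all

lemma f_W: "x \<in> W \<Longrightarrow> a1 \<le> f x" "x \<in> W \<Longrightarrow> f x \<le> a2"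
  using near[of x x] \<rho> by auto

lemma W_nonempty: "W \<noteq> {}" using mu_W by auto

lemma a1_le_a2: "a1 \<le> a2" using W_nonempty f_W by force

lemma a2: "0 < a2" using a1 a1_le_a2 by simp

lemma mu_fmeasurable: "B \<in> sets borel \<Longrightarrow> bounded B \<Longrightarrow> B \<in> fmeasurable \<mu>"
  using mu_loc_fin by (auto simp: fmeasurable_def)

lemma measure_mu_mono: "A \<in> sets borel \<Longrightarrow> B \<in> sets borel \<Longrightarrow> bounded B \<Longrightarrow> A \<subseteq> B \<Longrightarrow> measure \<mu> A \<le> measure \<mu> B"
  by (intro measure_mono_fmeasurable mu_fmeasurable) auto

lemma emeasure_mu: "B \<in> sets borel \<Longrightarrow> bounded B \<Longrightarrow> emeasure \<mu> B = ennreal (measure \<mu> B)"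
  using mu_loc_fin[of B] by (simp add: emeasure_eq_ennreal_measure)

lemma measure_mu_ball_le:
  assumes "\<And>y. y \<in> ball x s \<Longrightarrow> f y \<le> u" "0 \<le> s" "0 \<le> u"
  shows "measure \<mu> (ball x s) \<le> u * v * s ^ DIM('a)"
proof -
  have "emeasure \<mu> (ball x s) = (\<integral>\<^sup>+y. ennreal (f y) * indicator (ball x s) y \<partial>lborel)"
    using f_meas unfolding mu_def by (intro emeasure_density) auto
  also have "\<dots> \<le> (\<integral>\<^sup>+y. ennreal u * indicator (ball x s) y \<partial>lborel)"
    using assms by (intro nn_integral_mono) (auto simp: indicator_def intro: ennreal_leI)
  also have "\<dots> = ennreal u * emeasure lborel (ball x s)"
    by (subst nn_integral_cmult_indicator) auto
  also have "\<dots> = ennreal (u * v * s ^ DIM('a))"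
    using assms by (simp add: emeasure_ball v_def ennreal_mult mult.assoc)
  finally show ?thesis
    using assms v_pos by (simp add: emeasure_mu)
qed

lemma measure_mu_ball_ge:
  assumes "\<And>y. y \<in> ball x s \<Longrightarrow> u \<le> f y" "0 \<le> s" "0 \<le> u"
  shows "u * v * s ^ DIM('a) \<le> measure \<mu> (ball x s)"
proof -
  have "ennreal (u * v * s ^ DIM('a)) = ennreal u * emeasure lborel (ball x s)"
    using assms by (simp add: emeasure_ball v_def ennreal_mult mult.assoc)
  also have "\<dots> = (\<integral>\<^sup>+y. ennreal u * indicator (ball x s) y \<partial>lborel)"
    by (subst nn_integral_cmult_indicator) auto
  also have "\<dots> \<le> (\<integral>\<^sup>+y. ennreal (f y) * indicator (ball x s) y \<partial>lborel)"
    using assms by (intro nn_integral_mono) (auto simp: indicator_def intro: ennreal_leI)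
  also have "\<dots> = emeasure \<mu> (ball x s)"
    using f_meas unfolding mu_def by (intro emeasure_density[symmetric]) auto
  finally show ?thesis
    by (simp add: emeasure_mu)
qed

lemma ball_measure_expansion:
  assumes "0 \<le> s" "f x \<ge> 0"
  shows "\<bar>measure \<mu> (ball x s) - v * f x * s ^ DIM('a)\<bar> \<le> C * s powr b * v * s ^ DIM('a)"
proof -
  have osc: "\<bar>f x - f y\<bar> \<le> C * s powr b" if "y \<in> ball x s" for y
  proof -
    have "norm (x - y) powr b \<le> s powr b" using that b by (intro powr_mono2) (auto simp: dist_norm)
    then show ?thesis using hoelder[of x y] C by (meson mult_left_mono less_imp_le order_trans)
  qed
  have pos: "0 \<le> C * s powr b" using C by simp
  have "measure \<mu> (ball x s) \<le> (f x + C * s powr b) * v * s ^ DIM('a)"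
    using osc assms pos by (intro measure_mu_ball_le) (force simp: abs_le_iff)+
  moreover have "(f x - C * s powr b) * v * s ^ DIM('a) \<le> measure \<mu> (ball x s)"
  proof (cases "f x - C * s powr b \<ge> 0")
    case True
    then show ?thesis using osc assms by (intro measure_mu_ball_ge) (force simp: abs_le_iff)+
  next
    case False
    then have "(f x - C * s powr b) * v * s ^ DIM('a) \<le> 0"
      using v_pos assms by (intro mult_nonpos_nonneg) auto
    then show ?thesis using measure_nonneg order_trans by blast
  qed
  ultimately show ?thesis by (auto simp: abs_le_iff algebra_simps)
qed

text \<open>The lower density bound \<open>a1\<close> gives balls of this radius around
  \<open>W\<close> a \<open>t * \<mu>\<close> of at least \<open>4 * ln t\<close> once they lie in
  the tube. The levels considered satisfy \<open>u + ln t \<le> 2 * ln t\<close>, so only atoms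
  within \<open>rad t\<close> matter; the 4 leaves room.\<close>

definition rad :: "real \<Rightarrow> real" where "rad t = (4 * ln t / (v * a1 * t)) powr (1 / real DIM('a))"

lemma rad_power:
  assumes "t > 1" shows "t * v * a1 * rad t ^ DIM('a) = 4 * ln t" and "0 < rad t"
proof -
  have pos: "0 < 4 * ln t / (v * a1 * t)" using assms v_pos a1 by (auto intro!: divide_pos_pos mult_pos_pos)
  have "(X powr (1 / real DIM('a))) ^ DIM('a) = X" if "X > 0" for X
    using that by (subst powr_power) auto
  from this[OF pos] have "rad t ^ DIM('a) = 4 * ln t / (v * a1 * t)" by (simp only: rad_def)
  then show "t * v * a1 * rad t ^ DIM('a) = 4 * ln t" using assms v_pos a1 by (simp add: field_simps)
  show "0 < rad t" unfolding rad_def powr_gt_zero using pos by (metis less_irrefl)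
qed

lemma rad_tendsto: "(rad \<longlongrightarrow> 0) at_top"
proof -
  define k where "k = 4 / (v * a1)"
  define e where "e = 1 / real DIM('a)"
  have "k > 0" "e > 0" using v_pos a1 by (auto simp: k_def e_def)
  then have "((\<lambda>t. (k * (ln t / t)) powr e) \<longlongrightarrow> 0) at_top" by real_asymp
  moreover have "rad = (\<lambda>t. (k * (ln t / t)) powr e)" by (simp add: rad_def k_def e_def fun_eq_iff)
  ultimately show ?thesis by simp
qed

text \<open>Here \<open>x\<close> stands for an atom or a centre and \<open>x'\<close> for the
  centre of its piece. All errors are multiplied by \<open>t\<close> times a volume, which is of
  order ln t, so powers of \<open>t\<close> are required: they come from Hoelder continuity and from
  the mesh.\<close>

lemma uniform_ball_measure:
  assumes "\<epsilon> > 0"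
  shows "eventually (\<lambda>t. \<forall>x x' s s'. x' \<in> W \<longrightarrow> dist x x' \<le> 1 / t ^ 3 \<longrightarrow> 0 \<le> s \<longrightarrow> s \<le> 2 * rad t \<longrightarrow>
      0 \<le> s' \<longrightarrow> s' \<le> 2 * rad t \<longrightarrow> \<bar>s - s'\<bar> \<le> 2 / t ^ 3 \<longrightarrow>
      \<bar>t * measure \<mu> (ball x s) - t * v * f x' * s' ^ DIM('a)\<bar> \<le> \<epsilon>) at_top"
proof -
  define k where "k = 4 / (v * a1)"
  define e where "e = b / real DIM('a)"
  have ke: "k > 0" "e > 0" using v_pos a1 b by (auto simp: k_def e_def)
  \<comment> \<open>The summands bound the error of freezing \<open>f\<close> on the ball, of moving
    the centre from \<open>x\<close> to \<open>x'\<close>, and of changing the radius from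
    \<open>s\<close> to \<open>s'\<close>.\<close>
  define T where "T t = v * C * (2 powr b * (k * (ln t / t)) powr e) * (2 ^ DIM('a) * k * ln t)
     + v * C * (1 / t ^ 3) powr b * (2 ^ DIM('a) * k * ln t) + a2 * v * (2 * real DIM('a)) / t ^ 2" for t
  have "((\<lambda>t. v * C * (2 powr b * (k * (ln t / t)) powr e) * (2 ^ DIM('a) * k * ln t)) \<longlongrightarrow> 0) at_top"
  proof -
    have "((\<lambda>t. (k * (ln t / t)) powr e * ln t) \<longlongrightarrow> 0) at_top" using ke by real_asymp
    from tendsto_mult_left[OF this, of "v * C * 2 powr b * 2 ^ DIM('a) * k"] show ?thesis by (simp add: mult_ac)
  qed
  moreover have "((\<lambda>t. v * C * (1 / t ^ 3) powr b * (2 ^ DIM('a) * k * ln t)) \<longlongrightarrow> 0) at_top"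
  proof -
    have "((\<lambda>t::real. (1 / t ^ 3) powr b * ln t) \<longlongrightarrow> 0) at_top" using b by real_asymp
    from tendsto_mult_left[OF this, of "v * C * 2 ^ DIM('a) * k"] show ?thesis by (simp add: mult_ac)
  qed
  moreover have "((\<lambda>t::real. a2 * v * (2 * real DIM('a)) / t ^ 2) \<longlongrightarrow> 0) at_top" by real_asymp
  ultimately have "(T \<longlongrightarrow> 0 + 0 + 0) at_top" unfolding T_def by (intro tendsto_add)
  then have "eventually (\<lambda>t. T t < \<epsilon>) at_top" using assms by (intro order_tendstoD) auto
  moreover have "eventually (\<lambda>t. rad t < min (1/2) \<rho>) at_top" using rad_tendsto \<rho> by (intro order_tendstoD) auto
  moreover have "eventually (\<lambda>t::real. 1 / t ^ 3 < \<rho>) at_top" using \<rho> by real_asymp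
  ultimately show ?thesis using eventually_gt_at_top[of "1::real"]
  proof eventually_elim
    case (elim t)
    show ?case
    proof (intro allI impI)
      fix x x' s s'
      assume x: "x' \<in> W" "dist x x' \<le> 1 / t ^ 3" and s: "0 \<le> s" "s \<le> 2 * rad t" "0 \<le> s'" "s' \<le> 2 * rad t"
        and ss: "\<bar>s - s'\<bar> \<le> 2 / t ^ 3"
      let ?r = "2 * rad t"
      have t: "t > 0" "ln t > 0" using elim by auto
      have r: "0 < rad t" "?r \<le> 1" using elim rad_power(2)[of t] by auto
      have rd: "t * ?r ^ DIM('a) = 2 ^ DIM('a) * k * ln t"
        using rad_power(1)[of t] elim v_pos a1 by (simp add: power_mult_distrib k_def field_simps)
      have rb: "?r powr b = 2 powr b * (k * (ln t / t)) powr e"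
        using r elim v_pos a1 by (simp add: powr_mult rad_def powr_powr k_def e_def)
      have fx: "0 \<le> f x" "f x' \<le> a2" "0 \<le> f x'"
        using near[of x' x] x elim f_W[OF x(1)] a1 by (auto simp: dist_commute)
      have s_pow: "s ^ DIM('a) \<le> ?r ^ DIM('a)" "s powr b \<le> ?r powr b"
        using s b by (intro power_mono powr_mono2; simp)+
      have A: "\<bar>t * measure \<mu> (ball x s) - t * v * f x * s ^ DIM('a)\<bar> \<le> v * C * ?r powr b * (t * ?r ^ DIM('a))"
      proof -
        have "\<bar>t * measure \<mu> (ball x s) - t * v * f x * s ^ DIM('a)\<bar> = t * \<bar>measure \<mu> (ball x s) - v * f x * s ^ DIM('a)\<bar>"
          using t by (simp add: abs_mult right_diff_distrib mult.assoc flip: right_diff_distrib)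
        also have "\<dots> \<le> t * (C * s powr b * v * s ^ DIM('a))"
          using ball_measure_expansion[OF s(1) fx(1)] t by (intro mult_left_mono) auto
        also have "\<dots> \<le> t * (C * ?r powr b * v * ?r ^ DIM('a))"
          using s_pow t v_pos C s by (intro mult_left_mono mult_mono) auto
        finally show ?thesis by (simp add: mult_ac)
      qed
      have B: "\<bar>t * v * f x * s ^ DIM('a) - t * v * f x' * s ^ DIM('a)\<bar> \<le> v * C * (1 / t ^ 3) powr b * (t * ?r ^ DIM('a))"
      proof -
        have "norm (x - x') powr b \<le> (1 / t ^ 3) powr b" using x b by (intro powr_mono2) (auto simp: dist_norm)
        then have "\<bar>f x - f x'\<bar> \<le> C * (1 / t ^ 3) powr b"
          using hoelder[of x x'] C by (meson mult_left_mono less_imp_le order_trans)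
        then have "t * v * s ^ DIM('a) * \<bar>f x - f x'\<bar> \<le> t * v * ?r ^ DIM('a) * (C * (1 / t ^ 3) powr b)"
          using s_pow t v_pos s r by (intro mult_mono) auto
        moreover have "\<bar>t * v * f x * s ^ DIM('a) - t * v * f x' * s ^ DIM('a)\<bar> = t * v * s ^ DIM('a) * \<bar>f x - f x'\<bar>"
        proof -
          have "t * v * f x * s ^ DIM('a) - t * v * f x' * s ^ DIM('a) = (t * v * s ^ DIM('a)) * (f x - f x')"
            by (simp add: algebra_simps)
          then show ?thesis using t v_pos s by (simp add: abs_mult)
        qed
        ultimately show ?thesis by (simp add: mult_ac)
      qed
      have D: "\<bar>t * v * f x' * s ^ DIM('a) - t * v * f x' * s' ^ DIM('a)\<bar> \<le> a2 * v * (2 * real DIM('a)) / t ^ 2"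
      proof -
        \<comment> \<open>Both radii are at most 1, so the power function has Lipschitz constant
          \<open>DIM('a)\<close> there.\<close>
        have "\<bar>s ^ DIM('a) - s' ^ DIM('a)\<bar> \<le> real DIM('a) * \<bar>s - s'\<bar>"
          using norm_power_diff[of s s' "DIM('a)"] s r by simp
        also have "\<dots> \<le> real DIM('a) * (2 / t ^ 3)" using ss by (intro mult_left_mono) auto
        finally have "t * v * f x' * \<bar>s ^ DIM('a) - s' ^ DIM('a)\<bar> \<le> t * v * a2 * (real DIM('a) * (2 / t ^ 3))"
          using t v_pos fx by (intro mult_mono) auto
        also have "\<dots> = a2 * v * (2 * real DIM('a)) / t ^ 2" using t by (simp add: field_simps power2_eq_square power3_eq_cube)
        finally show ?thesis using t v_pos fx by (simp add: abs_mult flip: right_diff_distrib)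
      qed
      have "v * C * ?r powr b * (t * ?r ^ DIM('a)) + v * C * (1 / t ^ 3) powr b * (t * ?r ^ DIM('a)) + a2 * v * (2 * real DIM('a)) / t ^ 2 = T t"
        unfolding rd rb T_def by (simp add: mult_ac)
      then show "\<bar>t * measure \<mu> (ball x s) - t * v * f x' * s' ^ DIM('a)\<bar> \<le> \<epsilon>"
        using A B D elim(1) by linarith
    qed
  qed
qed

end

section \<open>Partition into small pieces\<close>

text \<open>All conditions hold for large \<open>t\<close>, which is fixed from now on. The accuracy
  carries 2^-d because values multiply ball measures by 2^d, and \<open>U + 2 \<le> ln t\<close>
  leaves room to shift a level in [-U, U] by \<epsilon>.\<close>

locale voronoi_scale = voronoi_density f \<mu> W C b a1 a2 \<rho>
  for f :: "'a::euclidean_space \<Rightarrow> real" and \<mu> :: "'a measure" and W :: "'a set"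
    and C b a1 a2 \<rho> :: real +
  fixes t \<epsilon> U :: real
  assumes t: "1 < t" and eps: "0 < \<epsilon>" "\<epsilon> \<le> 1 / 4" and U: "0 \<le> U" "U + 2 \<le> ln t"
    and rad_small: "3 * rad t \<le> \<rho>" and mesh_rad: "4 / t ^ 3 \<le> rad t" and mesh_small: "t * v * a2 * (4 / t ^ 3) \<le> 1"
    and unif: "\<And>x x' s s'. x' \<in> W \<Longrightarrow> dist x x' \<le> 1 / t ^ 3 \<Longrightarrow> 0 \<le> s \<Longrightarrow> s \<le> 2 * rad t \<Longrightarrow>
      0 \<le> s' \<Longrightarrow> s' \<le> 2 * rad t \<Longrightarrow> \<bar>s - s'\<bar> \<le> 2 / t ^ 3 \<Longrightarrow>
      \<bar>t * measure \<mu> (ball x s) - t * v * f x' * s' ^ DIM('a)\<bar> \<le> \<epsilon> / 2 ^ DIM('a)"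
begin

lemma t_facts: "0 < t" "0 < ln t" using t by auto

lemma level_bounds:
  assumes "\<bar>u\<bar> \<le> U + 1"
  shows "1 \<le> u + ln t" "u + ln t \<le> 2 * ln t"
  using assms U by auto

definition mesh :: real where "mesh = 1 / t ^ 3"

lemma mesh: "0 < mesh" "4 * mesh \<le> rad t" "4 * mesh \<le> 1" "t * v * a2 * (4 * mesh) \<le> 1" "2 / t ^ 3 = 2 * mesh"
proof -
  show "0 < mesh" using t_facts by (simp add: mesh_def)
  show "4 * mesh \<le> rad t" using mesh_rad by (simp add: mesh_def)
  then show "4 * mesh \<le> 1" using rad_small \<rho> rad_power(2)[OF t] by linarith
qed (use mesh_small in \<open>simp_all add: mesh_def\<close>)

lemma rad: "0 < rad t" "3 * rad t \<le> 1" "3 * rad t \<le> \<rho>" "t * v * a1 * rad t ^ DIM('a) = 4 * ln t"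
  using rad_power[OF t] rad_small \<rho> by auto

lemma unif':
  assumes "x' \<in> W" "dist x x' \<le> mesh" "0 \<le> s" "s \<le> 2 * rad t" "0 \<le> s'" "s' \<le> 2 * rad t" "\<bar>s - s'\<bar> \<le> 2 * mesh"
  shows "\<bar>t * measure \<mu> (ball x s) - t * v * f x' * s' ^ DIM('a)\<bar> \<le> \<epsilon> / 2 ^ DIM('a)"
    and "\<bar>t * measure \<mu> (ball x s) - t * v * f x' * s' ^ DIM('a)\<bar> \<le> \<epsilon>"
proof -
  show *: "\<bar>t * measure \<mu> (ball x s) - t * v * f x' * s' ^ DIM('a)\<bar> \<le> \<epsilon> / 2 ^ DIM('a)"
    using assms by (intro unif) (auto simp: mesh_def)
  have "\<epsilon> / 2 ^ DIM('a) \<le> \<epsilon> / 1" using eps by (intro divide_left_mono) auto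
  with * show "\<bar>t * measure \<mu> (ball x s) - t * v * f x' * s' ^ DIM('a)\<bar> \<le> \<epsilon>" by linarith
qed

text \<open>The distance at which a neighbour of a point at \<open>x\<close> produces the value \<open>u\<close>,
  up to the error incurred by replacing \<open>\<mu>\<close> by \<open>f x\<close> times Lebesgue measure.\<close>
definition radius :: "'a \<Rightarrow> real \<Rightarrow> real" where
  "radius x u = ((u + ln t) / (t * v * f x)) powr (1 / real DIM('a))"

lemma radius:
  assumes x: "x \<in> W" and u: "\<bar>u\<bar> \<le> U + 1"
  shows "t * v * f x * radius x u ^ DIM('a) = u + ln t" "0 < radius x u" "radius x u < rad t" "4 * mesh \<le> radius x u"
    and "0 \<le> s \<Longrightarrow> t * v * f x * s ^ DIM('a) - ln t < u \<longleftrightarrow> s < radius x u"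
proof -
  have fx: "0 < f x" "a1 \<le> f x" "f x \<le> a2" using f_W[OF x] a1 by auto
  have pos: "0 < t * v * f x" using t_facts v_pos fx by simp
  have lv: "0 < u + ln t" "u + ln t < 4 * ln t" using level_bounds[OF u] t_facts by auto
  have root: "(X powr (1 / real DIM('a))) ^ DIM('a) = X" if "X > 0" for X
    using that by (subst powr_power) auto
  have "radius x u ^ DIM('a) = (u + ln t) / (t * v * f x)"
    unfolding radius_def by (rule root) (use pos lv in simp)
  then show eq: "t * v * f x * radius x u ^ DIM('a) = u + ln t" using pos by (metis less_irrefl nonzero_mult_div_cancel_left times_divide_eq_right)
  show r0: "0 < radius x u"
    unfolding radius_def powr_gt_zero using t_facts v_pos fx lv by simp
  have "t * v * a1 * radius x u ^ DIM('a) \<le> t * v * f x * radius x u ^ DIM('a)"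
    using fx t_facts v_pos r0 by (intro mult_right_mono mult_left_mono) auto
  also have "\<dots> < t * v * a1 * rad t ^ DIM('a)" unfolding eq rad(4) using lv by simp
  finally have "radius x u ^ DIM('a) < rad t ^ DIM('a)"
    using t_facts v_pos a1 by simp
  then show "radius x u < rad t" by (rule power_less_imp_less_base) (use rad(1) in simp)
  \<comment> \<open>As \<open>4 * mesh \<le> 1\<close>, its d-th power is at most itself, and the
    corresponding mass is at most 1, hence below the level \<open>u + ln t\<close>.\<close>
  have "(4 * mesh) ^ DIM('a) \<le> (4 * mesh) ^ 1"
    using mesh by (intro power_decreasing) (auto simp: Suc_le_eq)
  then have "t * v * f x * (4 * mesh) ^ DIM('a) \<le> t * v * a2 * (4 * mesh)"
    using fx t_facts v_pos mesh(1) by (intro mult_mono) auto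
  also have "\<dots> \<le> t * v * f x * radius x u ^ DIM('a)" unfolding eq using mesh(4) level_bounds[OF u] by linarith
  finally have "(4 * mesh) ^ DIM('a) \<le> radius x u ^ DIM('a)" using pos by (simp only: mult_le_cancel_left_pos)
  then show "4 * mesh \<le> radius x u" by (rule power_mono_iff[THEN iffD1, rotated 3]) (use mesh(1) r0 in simp_all)
  assume "0 \<le> s"
  then have "s < radius x u \<longleftrightarrow> s ^ DIM('a) < radius x u ^ DIM('a)"
    using power_mono_iff[of "radius x u" s "DIM('a)"] r0 \<open>0 \<le> s\<close>
    by (metis DIM_positive less_imp_le not_le)
  also have "\<dots> \<longleftrightarrow> t * v * f x * s ^ DIM('a) < t * v * f x * radius x u ^ DIM('a)"
    using pos by (simp only: mult_less_cancel_left_pos)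
  finally show "t * v * f x * s ^ DIM('a) - ln t < u \<longleftrightarrow> s < radius x u" unfolding eq by auto
qed

text \<open>The value that \<open>x\<close> would have if \<open>y\<close> were its nearest other
  atom.\<close>

abbreviation mark :: "'a \<Rightarrow> 'a \<Rightarrow> real" where
  "mark x y \<equiv> 2 ^ DIM('a) * t * measure \<mu> (ball x (dist x y / 2)) - ln t"

text \<open>Distant atoms cannot push a value below the levels considered. This makes comparison
  with a level a local event.\<close>

lemma far_mark:
  assumes "x \<in> W" "rad t \<le> dist x y" "\<bar>u\<bar> \<le> U + 1"
  shows "u \<le> mark x y"
proof -
  have "4 * ln t = 2 ^ DIM('a) * t * (a1 * v * (rad t / 2) ^ DIM('a))"
    unfolding rad(4)[symmetric] by (simp add: power_divide)
  also have "\<dots> \<le> 2 ^ DIM('a) * t * measure \<mu> (ball x (rad t / 2))"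
    using near[OF assms(1)] rad a1 t_facts by (intro mult_left_mono measure_mu_ball_ge) auto
  also have "\<dots> \<le> 2 ^ DIM('a) * t * measure \<mu> (ball x (dist x y / 2))"
    using assms t_facts by (intro mult_left_mono measure_mu_mono subset_ball) auto
  finally show ?thesis using level_bounds[OF assms(3)] t_facts by linarith
qed

end

text \<open>Atoms are counted in the first \<open>nW\<close> pieces, which fill \<open>W\<close>
  exactly. The other pieces are present because atoms outside \<open>W\<close> can be nearest
  neighbours of atoms inside; their centres are arbitrary.\<close>

locale voronoi_grid = voronoi_scale f \<mu> W C b a1 a2 \<rho> t \<epsilon> U
  for f :: "'a::euclidean_space \<Rightarrow> real" and \<mu> :: "'a measure" and W :: "'a set"
    and C b a1 a2 \<rho> t \<epsilon> U :: real +
  fixes n nW :: nat and z :: "nat \<Rightarrow> 'a" and Q :: "nat \<Rightarrow> 'a set"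
  assumes Q_borel: "\<And>j. j < n \<Longrightarrow> Q j \<in> sets borel" and Q_ball: "\<And>j. j < n \<Longrightarrow> Q j \<subseteq> ball (z j) (1 / t ^ 3)"
    and Q_disj: "disjoint_family_on Q {..<n}" and nW: "nW \<le> n" and Q_W: "(\<Union>j<nW. Q j) = W"
    and z_W: "\<And>j. j < nW \<Longrightarrow> z j \<in> W" and cover: "\<And>x. x \<in> W \<Longrightarrow> ball x 1 \<subseteq> (\<Union>j<n. Q j)"
begin

lemma Q_mesh: "j < n \<Longrightarrow> Q j \<subseteq> ball (z j) mesh" using Q_ball by (simp add: mesh_def)

lemma Q_bounded: "j < n \<Longrightarrow> bounded (Q j)" by (rule bounded_subset[OF bounded_ball Q_mesh])

definition p :: "nat \<Rightarrow> real" where "p j = t * measure \<mu> (Q j)"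

lemma p_nonneg: "0 \<le> p j" using t_facts by (simp add: p_def)

lemma sum_p: "J \<subseteq> {..<n} \<Longrightarrow> sum p J = t * measure \<mu> (\<Union>j\<in>J. Q j)"
proof -
  assume J: "J \<subseteq> {..<n}"
  have "measure \<mu> (\<Union>j\<in>J. Q j) = (\<Sum>j\<in>J. measure \<mu> (Q j))"
  proof (rule measure_finite_Union)
    show "finite J" using J finite_subset by blast
    show "disjoint_family_on Q J" using Q_disj J by (rule disjoint_family_on_mono[rotated])
    show "emeasure \<mu> (Q j) \<noteq> \<infinity>" if "j \<in> J" for j
      using mu_loc_fin[OF Q_bounded[of j]] that J by (auto simp: subset_iff)
  qed (use J Q_borel in auto)
  then show ?thesis by (simp add: p_def sum_distrib_left)
qed

lemma UN_Q_borel: "J \<subseteq> {..<n} \<Longrightarrow> (\<Union>j\<in>J. Q j) \<in> sets borel"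
  using Q_borel finite_subset[of J] by (intro sets.finite_UN) auto

lemma UN_Q_bounded: "J \<subseteq> {..<n} \<Longrightarrow> bounded (\<Union>j\<in>J. Q j)"
  using Q_bounded finite_subset[of J] by (intro bounded_UN) auto

lemma sum_p_le_ball:
  assumes "J \<subseteq> {..<n}" "(\<Union>j\<in>J. Q j) \<subseteq> ball x s"
  shows "sum p J \<le> t * measure \<mu> (ball x s)"
  unfolding sum_p[OF assms(1)] using assms t_facts UN_Q_borel[OF assms(1)]
  by (intro mult_left_mono measure_mu_mono) auto

lemma ball_le_sum_p:
  assumes "J \<subseteq> {..<n}" "ball x s \<subseteq> (\<Union>j\<in>J. Q j)"
  shows "t * measure \<mu> (ball x s) \<le> sum p J"
  unfolding sum_p[OF assms(1)] using assms t_facts UN_Q_borel[OF assms(1)] UN_Q_bounded[OF assms(1)]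
  by (intro mult_left_mono measure_mu_mono) auto

lemma sum_p_W: "sum p {..<nW} = t"
  using sum_p[of "{..<nW}"] nW by (simp add: Q_W mu_W)

lemma p_small: "i < nW \<Longrightarrow> p i \<le> \<epsilon>"
proof -
  assume i: "i < nW"
  have "p i \<le> t * measure \<mu> (ball (z i) mesh)"
    using sum_p_le_ball[of "{i}" "z i" mesh] Q_mesh[of i] i nW by auto
  moreover have "\<bar>t * measure \<mu> (ball (z i) mesh) - t * v * f (z i) * 0 ^ DIM('a)\<bar> \<le> \<epsilon>"
    using z_W[OF i] mesh rad by (intro unif') auto
  ultimately show ?thesis by (simp add: power_0_left)
qed

section \<open>Exclusion neighbourhoods in terms of pieces\<close>

text \<open>The counterpart of \<open>mark\<close> in which atoms are replaced by centres and
  \<open>\<mu>\<close> by a multiple of Lebesgue measure; halving the radius cancels the factor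
  2^d.\<close>

definition gap :: "nat \<Rightarrow> nat \<Rightarrow> real" where
  "gap i j = t * v * f (z i) * dist (z i) (z j) ^ DIM('a) - ln t"

text \<open>The pieces that must be empty for an atom in piece \<open>i\<close> to have a value of
  at least \<open>u\<close>. Piece \<open>i\<close> is left out, as it holds the atom
  itself.\<close>

definition nb :: "real \<Rightarrow> nat \<Rightarrow> nat set" where
  "nb u i = {j. j < n \<and> j \<noteq> i \<and> gap i j < u}"

lemma finite_nb [simp]: "finite (nb u i)" and nb_subset: "nb u i \<subseteq> {..<n}" and nb_self: "i \<notin> nb u i"
  by (auto simp: nb_def)

lemma nb_mono: "u \<le> u' \<Longrightarrow> nb u i \<subseteq> nb u' i" by (auto simp: nb_def)

lemma gap_iff: "i < nW \<Longrightarrow> \<bar>u\<bar> \<le> U + 1 \<Longrightarrow> gap i j < u \<longleftrightarrow> dist (z i) (z j) < radius (z i) u"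
  unfolding gap_def using radius(5)[OF z_W] by simp

lemma in_Q: "x \<in> Q j \<Longrightarrow> j < n \<Longrightarrow> dist (z j) x < mesh" using Q_mesh[of j] by auto

lemma coverE:
  assumes "i < nW" "dist (z i) y < 1"
  obtains j where "j < n" "y \<in> Q j"
  using cover[OF z_W[OF assms(1)]] assms(2) by auto

text \<open>The union of the pieces lies between balls whose radii differ from
  \<open>radius (z i) u\<close> by \<open>mesh\<close>. One \<epsilon> pays for the ball measures;
  the other for piece \<open>i\<close>, which the inner ball covers as well.\<close>

lemma sum_nb:
  assumes i: "i < nW" and u: "\<bar>u\<bar> \<le> U + 1"
  shows "\<bar>sum p (nb u i) - (u + ln t)\<bar> \<le> 2 * \<epsilon>"
proof -
  let ?s = "radius (z i) u"
  note r = radius[OF z_W[OF i] u]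
  have "(\<Union>j\<in>nb u i. Q j) \<subseteq> ball (z i) (?s + mesh)"
  proof
    fix y assume "y \<in> (\<Union>j\<in>nb u i. Q j)"
    then obtain j where j: "j < n" "gap i j < u" "y \<in> Q j" by (auto simp: nb_def)
    then show "y \<in> ball (z i) (?s + mesh)"
      using gap_iff[OF i u, of j] in_Q[of y j] dist_triangle[of "z i" y "z j"] by auto
  qed
  then have "sum p (nb u i) \<le> t * measure \<mu> (ball (z i) (?s + mesh))"
    by (intro sum_p_le_ball nb_subset)
  moreover have "\<bar>t * measure \<mu> (ball (z i) (?s + mesh)) - t * v * f (z i) * ?s ^ DIM('a)\<bar> \<le> \<epsilon>"
    using z_W[OF i] mesh rad r by (intro unif') auto
  moreover have "ball (z i) (?s - mesh) \<subseteq> (\<Union>j\<in>insert i (nb u i). Q j)"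
  proof
    fix y assume y: "y \<in> ball (z i) (?s - mesh)"
    then obtain j where j: "j < n" "y \<in> Q j" using coverE[OF i, of y] r rad mesh by force
    then have "dist (z i) (z j) < ?s"
      using y in_Q[of y j] dist_triangle[of "z i" "z j" y] by (auto simp: dist_commute)
    then show "y \<in> (\<Union>j\<in>insert i (nb u i). Q j)" using j gap_iff[OF i u, of j] by (auto simp: nb_def)
  qed
  then have "t * measure \<mu> (ball (z i) (?s - mesh)) \<le> p i + sum p (nb u i)"
    using ball_le_sum_p[of "insert i (nb u i)"] nb_subset i nW by (simp add: nb_self)
  moreover have "\<bar>t * measure \<mu> (ball (z i) (?s - mesh)) - t * v * f (z i) * ?s ^ DIM('a)\<bar> \<le> \<epsilon>"
    using z_W[OF i] mesh rad r by (intro unif') auto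
  ultimately show ?thesis using p_small[OF i] r(1) by linarith
qed

lemma dist_representatives:
  assumes "x \<in> Q i" "y \<in> Q j" "i < n" "j < n"
  shows "\<bar>dist x y - dist (z i) (z j)\<bar> < 2 * mesh"
  using in_Q[OF assms(1,3)] in_Q[OF assms(2,4)]
    dist_triangle[of x y "z i"] dist_triangle[of "z i" y "z j"]
    dist_triangle[of "z i" "z j" x] dist_triangle[of x "z j" y] by (simp add: dist_commute)

text \<open>The disjunction lets closeness be known for the atoms or for the centres: the two
  one-sided comparisons that follow start from different sides.\<close>

lemma mark_approx:
  assumes i: "i < nW" "x \<in> Q i" and j: "j < n" "y \<in> Q j" and near: "dist x y < rad t \<or> dist (z i) (z j) < rad t"
  shows "\<bar>mark x y - gap i j\<bar> \<le> \<epsilon>"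
proof -
  have "i < n" using i nW by simp
  note D = dist_representatives[OF i(2) j(2) \<open>i < n\<close> j(1)]
  have "\<bar>t * measure \<mu> (ball x (dist x y / 2)) - t * v * f (z i) * (dist (z i) (z j) / 2) ^ DIM('a)\<bar> \<le> \<epsilon> / 2 ^ DIM('a)"
    using near D z_W[OF i(1)] in_Q[OF i(2) \<open>i < n\<close>] mesh rad by (intro unif') (auto simp: dist_commute)
  then have "2 ^ DIM('a) * \<bar>t * measure \<mu> (ball x (dist x y / 2)) - t * v * f (z i) * (dist (z i) (z j) / 2) ^ DIM('a)\<bar> \<le> \<epsilon>"
    by (simp add: field_simps)
  moreover have "2 ^ DIM('a) * \<bar>X\<bar> = \<bar>2 ^ DIM('a) * X\<bar>" for X :: real by (simp add: abs_mult)
  ultimately show ?thesis by (simp add: gap_def power_divide right_diff_distrib mult_ac)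
qed

lemma mark_less:
  assumes i: "i < nW" "x \<in> Q i" and j: "j < n" "y \<in> Q j" and u: "\<bar>u\<bar> \<le> U + 1" "gap i j < u"
  shows "mark x y < u + \<epsilon>"
  using mark_approx[OF i j] gap_iff[OF i(1) u(1)] radius(3)[OF z_W[OF i(1)] u(1)] u(2) by fastforce

lemma gap_less:
  assumes i: "i < nW" "x \<in> Q i" and j: "j < n" "y \<in> Q j" and u: "\<bar>u\<bar> \<le> U + 1"
    "mark x y < u"
  shows "gap i j < u + \<epsilon>"
proof -
  have "x \<in> W" using i Q_W by blast
  then have "dist x y < rad t" using far_mark[of x y u] u by force
  then show ?thesis using mark_approx[OF i j] u(2) by force
qed

text \<open>The relative gain from a second exclusion ball: a ball of a quarter of the radius has
  the volume fraction 4^-d, and the densities have ratio at least \<open>a1 / a2\<close>.\<close>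

definition \<kappa> :: real where "\<kappa> = a1 / (a2 * 4 ^ DIM('a))"

lemma kappa: "0 < \<kappa>" "\<kappa> \<le> 1"
proof -
  show "0 < \<kappa>" using a1 a2 by (simp add: \<kappa>_def)
  have "a1 * 1 \<le> a2 * 4 ^ DIM('a)" using a1_le_a2 a1 a2 by (intro mult_mono) auto
  then show "\<kappa> \<le> 1" using a2 by (simp add: \<kappa>_def divide_le_eq)
qed

text \<open>If neither of two pieces lies in the exclusion ball of the other, then the ball of half the
  radius touching \<open>z i'\<close> from the side opposite to \<open>z i\<close> is excluded by \<open>i'\<close> only.\<close>
lemma sum_nb_pair:
  assumes i: "i < nW" "i' < nW" and u: "\<bar>u\<bar> \<le> U + 1" and ne: "i \<noteq> i'" "i' \<notin> nb u i" "i \<notin> nb u i'"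
  shows "(1 + \<kappa>) * (u + ln t) - 2 * \<epsilon> \<le> sum p (nb u i \<union> nb u i')"
proof -
  let ?s = "radius (z i) u" and ?s' = "radius (z i') u"
  let ?D = "dist (z i) (z i')"
  note r = radius[OF z_W[OF i(1)] u] and r' = radius[OF z_W[OF i(2)] u]
  have D: "?s \<le> ?D" "?s' \<le> ?D"
    using ne i nW gap_iff[OF i(1) u, of i'] gap_iff[OF i(2) u, of i] by (auto simp: nb_def dist_commute)
  then have D0: "?D > 0" using r by linarith
  define q where "q = z i' + (?s' / (2 * ?D)) *\<^sub>R (z i' - z i)"
  have "norm (z i' - z i) = ?D" by (simp add: dist_norm norm_minus_commute)
  then have q1: "dist q (z i') = ?s' / 2" using D0 r' by (simp add: q_def dist_norm)
  have "q - z i = (1 + ?s' / (2 * ?D)) *\<^sub>R (z i' - z i)" by (simp add: q_def algebra_simps)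
  then have "dist q (z i) = (1 + ?s' / (2 * ?D)) * ?D"
    using D0 r' \<open>norm (z i' - z i) = ?D\<close> by (simp add: dist_norm)
  then have q2: "dist q (z i) = ?D + ?s' / 2" using D0 by (simp add: field_simps)
  define J where "J = {j. j < n \<and> dist q (z j) < ?s' / 2}"
  have J: "J \<subseteq> {..<n}" "J \<subseteq> nb u i'" "J \<inter> nb u i = {}"
  proof -
    have "j \<in> nb u i'" if "j \<in> J" for j
    proof -
      have "dist (z i') (z j) < ?s'" using that q1 dist_triangle[of "z i'" "z j" q] by (auto simp: J_def dist_commute)
      moreover have "j \<noteq> i'" using that q1 by (auto simp: J_def)
      ultimately show ?thesis using that gap_iff[OF i(2) u, of j] by (auto simp: J_def nb_def)
    qed
    then show "J \<subseteq> nb u i'" by blast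
    have "\<not> dist (z i) (z j) < ?s" if "j \<in> J" for j
      using that q2 D dist_triangle[of q "z i" "z j"] by (auto simp: J_def dist_commute)
    then show "J \<inter> nb u i = {}" using gap_iff[OF i(1) u] by (auto simp: nb_def)
  qed (auto simp: J_def)
  \<comment> \<open>Membership in \<open>J\<close> is decided by centres within
    \<open>?s' / 2\<close> of \<open>q\<close>. As \<open>mesh \<le> ?s' / 4\<close>, each piece
    meeting the ball of half that radius qualifies, hence the quarter.\<close>
  have "ball q (?s' / 4) \<subseteq> (\<Union>j\<in>J. Q j)"
  proof
    fix y assume y: "y \<in> ball q (?s' / 4)"
    have "dist (z i') y < 1" using y q1 r' rad dist_triangle[of "z i'" y q] by (auto simp: dist_commute)
    then obtain j where j: "j < n" "y \<in> Q j" using coverE[OF i(2)] by blast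
    have "dist q (z j) < ?s' / 2"
      using y in_Q[OF j(2,1)] r'(4) dist_triangle[of q "z j" y] by (auto simp: dist_commute)
    then show "y \<in> (\<Union>j\<in>J. Q j)" using j by (auto simp: J_def)
  qed
  then have "t * measure \<mu> (ball q (?s' / 4)) \<le> sum p J" using J by (intro ball_le_sum_p)
  moreover have "t * (a1 * v * (?s' / 4) ^ DIM('a)) \<le> t * measure \<mu> (ball q (?s' / 4))"
  proof (intro mult_left_mono measure_mu_ball_ge)
    fix y assume "y \<in> ball q (?s' / 4)"
    then have "dist (z i') y \<le> \<rho>" using q1 r' rad dist_triangle[of "z i'" y q] by (auto simp: dist_commute)
    then show "a1 \<le> f y" using near[OF z_W[OF i(2)]] by blast
  qed (use r' a1 t_facts in auto)
  moreover have "\<kappa> * (u + ln t) \<le> t * (a1 * v * (?s' / 4) ^ DIM('a))"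
  proof -
    have "\<kappa> * (u + ln t) = \<kappa> * (t * v * f (z i') * ?s' ^ DIM('a))" using r'(1) by simp
    also have "\<dots> \<le> \<kappa> * (t * v * a2 * ?s' ^ DIM('a))"
      using kappa t_facts v_pos f_W(2)[OF z_W[OF i(2)]] r' by (intro mult_left_mono mult_right_mono) auto
    also have "\<dots> = t * (a1 * v * (?s' / 4) ^ DIM('a))"
      using a2 by (simp add: \<kappa>_def power_divide field_simps)
    finally show ?thesis .
  qed
  moreover have "sum p (nb u i) + sum p J \<le> sum p (nb u i \<union> nb u i')"
  proof -
    have "sum p (nb u i) + sum p J = sum p (nb u i \<union> J)"
      using J finite_subset[OF J(1)] by (subst sum.union_disjoint) auto
    also have "\<dots> \<le> sum p (nb u i \<union> nb u i')" using J p_nonneg by (intro sum_mono2) auto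
    finally show ?thesis .
  qed
  ultimately show ?thesis using sum_nb[OF i(1) u] by (simp add: algebra_simps)
qed

text \<open>A bound of order ln t for the expected number of atoms within \<open>3 * rad t\<close>
  of a point of \<open>W\<close>.\<close>

definition vol :: real where "vol = 4 * 3 ^ DIM('a) * (a2 / a1) * ln t"

lemma sum_close:
  assumes i: "i < nW"
  shows "sum p {j. j < nW \<and> dist (z i) (z j) < 2 * rad t} \<le> vol"
proof -
  let ?J = "{j. j < nW \<and> dist (z i) (z j) < 2 * rad t}"
  have "(\<Union>j\<in>?J. Q j) \<subseteq> ball (z i) (3 * rad t)"
  proof
    fix y assume "y \<in> (\<Union>j\<in>?J. Q j)"
    then obtain j where j: "j < nW" "dist (z i) (z j) < 2 * rad t" "y \<in> Q j" by auto
    then show "y \<in> ball (z i) (3 * rad t)"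
      using nW in_Q[of y j] mesh dist_triangle[of "z i" y "z j"] by auto
  qed
  then have "sum p ?J \<le> t * measure \<mu> (ball (z i) (3 * rad t))" using nW by (intro sum_p_le_ball) auto
  also have "\<dots> \<le> t * (a2 * v * (3 * rad t) ^ DIM('a))"
    using near[OF z_W[OF i]] rad a2 t_facts by (intro mult_left_mono measure_mu_ball_le) auto
  also have "\<dots> = 3 ^ DIM('a) * (a2 / a1) * (t * v * a1 * rad t ^ DIM('a))"
    using a1 by (simp add: power_mult_distrib)
  also have "\<dots> = vol" unfolding rad(4) vol_def by simp
  finally show ?thesis .
qed

end

context voronoi_density
begin

lemma eventually_voronoi_scale:
  assumes "0 < \<epsilon>" "\<epsilon> \<le> 1 / 4" "0 \<le> U"
  shows "eventually (\<lambda>t. voronoi_scale f \<mu> W C b a1 a2 \<rho> t \<epsilon> U) at_top"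
proof -
  have "eventually (\<lambda>t::real. U + 2 \<le> ln t) at_top" by real_asymp
  moreover have "eventually (\<lambda>t. rad t < \<rho> / 3) at_top" using rad_tendsto \<rho> by (intro order_tendstoD) auto
  moreover have "eventually (\<lambda>t::real. 4 / t ^ 3 \<le> 1) at_top" by real_asymp
  moreover have "eventually (\<lambda>t. t * v * a1 * (4 / t ^ 3) \<le> 4 * ln t) at_top" using v_pos a1 by real_asymp
  moreover have "eventually (\<lambda>t. t * v * a2 * (4 / t ^ 3) \<le> 1) at_top" using v_pos a2 by real_asymp
  moreover have "eventually (\<lambda>t. \<forall>x x' s s'. x' \<in> W \<longrightarrow> dist x x' \<le> 1 / t ^ 3 \<longrightarrow> 0 \<le> s \<longrightarrow> s \<le> 2 * rad t \<longrightarrow>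
      0 \<le> s' \<longrightarrow> s' \<le> 2 * rad t \<longrightarrow> \<bar>s - s'\<bar> \<le> 2 / t ^ 3 \<longrightarrow>
      \<bar>t * measure \<mu> (ball x s) - t * v * f x' * s' ^ DIM('a)\<bar> \<le> \<epsilon> / 2 ^ DIM('a)) at_top"
    using assms by (intro uniform_ball_measure) simp
  ultimately show ?thesis using eventually_gt_at_top[of "1::real"]
  proof eventually_elim
    case (elim t)
    have "4 / t ^ 3 \<le> rad t"
    proof -
      have "(4 / t ^ 3) ^ DIM('a) \<le> (4 / t ^ 3) ^ 1"
        using elim by (intro power_decreasing) (auto simp: Suc_le_eq)
      then have "t * v * a1 * (4 / t ^ 3) ^ DIM('a) \<le> t * v * a1 * (4 / t ^ 3)"
        using elim v_pos a1 by (intro mult_left_mono) auto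
      also have "\<dots> \<le> t * v * a1 * rad t ^ DIM('a)" using elim rad_power(1)[of t] by simp
      finally have "(4 / t ^ 3) ^ DIM('a) \<le> rad t ^ DIM('a)"
        using elim v_pos a1 by (simp only: mult_le_cancel_left_pos mult_pos_pos)
      then show ?thesis
        by (rule power_mono_iff[THEN iffD1, rotated 3]) (use elim rad_power(2)[of t] in simp_all)
    qed
    then show ?case using elim assms by unfold_locales (auto simp: field_simps)
  qed
qed

end

text \<open>\<open>W\<close> and the remainder of a large ball are partitioned separately, so that
  no piece meets both; the intensities of the pieces of \<open>W\<close> then add up to
  \<open>t\<close> exactly.\<close>

lemma (in voronoi_scale) voronoi_grid_exists:
  "\<exists>n nW z Q. voronoi_grid f \<mu> W C b a1 a2 \<rho> t \<epsilon> U n nW z Q"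
proof -
  obtain B where B: "\<And>x. x \<in> W \<Longrightarrow> norm x \<le> B"
    using compact_imp_bounded[OF W_compact] unfolding bounded_iff by blast
  let ?K = "cball 0 (B + 1) :: 'a set"
  have \<delta>: "0 < 1 / t ^ 3" using t_facts by simp
  have W_borel: "W \<in> sets borel" using compact_imp_closed[OF W_compact] by simp
  obtain N1 z1 Q1 where 1: "\<And>i. i < (N1::nat) \<Longrightarrow> z1 i \<in> W" "\<And>i. Q1 i \<in> sets borel"
    "\<And>i. Q1 i \<subseteq> ball (z1 i) (1 / t ^ 3)" "disjoint_family Q1" "(\<Union>i<N1. Q1 i) = W"
    using small_partition[OF W_compact order_refl W_borel \<delta>] by blast
  have "?K - W \<subseteq> ?K" "?K - W \<in> sets borel" using W_borel by auto
  then obtain N2 z2 Q2 where 2: "\<And>i. i < (N2::nat) \<Longrightarrow> z2 i \<in> ?K" "\<And>i. Q2 i \<in> sets borel"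
    "\<And>i. Q2 i \<subseteq> ball (z2 i) (1 / t ^ 3)" "disjoint_family Q2" "(\<Union>i<N2. Q2 i) = ?K - W"
    using small_partition[OF compact_cball, of "?K - W" 0 "B + 1"] \<delta> by blast
  define z where "z i = (if i < N1 then z1 i else z2 (i - N1))" for i
  define Q where "Q i = (if i < N1 then Q1 i else Q2 (i - N1))" for i
  have UQ: "(\<Union>j<N1. Q j) = W" using 1(5) by (simp add: Q_def)
  have "?K \<subseteq> (\<Union>j<N1 + N2. Q j)"
  proof
    fix x assume "x \<in> ?K"
    then consider "x \<in> (\<Union>i<N1. Q1 i)" | "x \<in> (\<Union>i<N2. Q2 i)" using 1(5) 2(5) by blast
    then show "x \<in> (\<Union>j<N1 + N2. Q j)"
    proof cases
      case 1
      then obtain i where "i < N1" "x \<in> Q1 i" by blast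
      then show ?thesis by (intro UN_I[of i]) (auto simp: Q_def)
    next
      case 2
      then obtain i where "i < N2" "x \<in> Q2 i" by blast
      then show ?thesis by (intro UN_I[of "N1 + i"]) (auto simp: Q_def)
    qed
  qed
  moreover have "ball x 1 \<subseteq> ?K" if "x \<in> W" for x
  proof
    fix y assume "y \<in> ball x 1"
    then show "y \<in> ?K" using B[OF that] norm_triangle_sub[of y x] by (simp add: dist_norm norm_minus_commute)
  qed
  moreover have "disjoint_family_on Q {..<N1 + N2}"
    unfolding disjoint_family_on_def
  proof (intro ballI impI)
    fix i j assume ij: "i \<in> {..<N1 + N2}" "j \<in> {..<N1 + N2}" "i \<noteq> j"
    have in_W: "Q1 k \<subseteq> W" if "k < N1" for k using 1(5) that by blast
    have out_W: "Q2 k \<inter> W = {}" if "k < N2" for k using 2(5) that by blast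
    consider "i < N1" "j < N1" | "i < N1" "\<not> j < N1" | "\<not> i < N1" "j < N1" | "\<not> i < N1" "\<not> j < N1" by blast
    then show "Q i \<inter> Q j = {}"
    proof cases
      case 1 then show ?thesis using \<open>disjoint_family Q1\<close> ij by (auto simp: Q_def disjoint_family_on_def)
    next
      case 2
      then have "Q2 (j - N1) \<inter> W = {}" using ij by (intro out_W) auto
      then show ?thesis using in_W[of i] 2 by (auto simp: Q_def)
    next
      case 3
      then have "Q2 (i - N1) \<inter> W = {}" using ij by (intro out_W) auto
      then show ?thesis using in_W[of j] 3 by (auto simp: Q_def)
    next
      case 4
      then have "i - N1 \<noteq> j - N1" using ij by linarith
      then show ?thesis using \<open>disjoint_family Q2\<close> 4 by (simp add: Q_def disjoint_family_on_def)
    qed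
  qed
  ultimately have "voronoi_grid f \<mu> W C b a1 a2 \<rho> t \<epsilon> U (N1 + N2) N1 z Q"
    using 1 2 UQ by unfold_locales (auto simp: Q_def z_def)
  then show ?thesis by blast
qed

section \<open>Estimates at a fixed time\<close>

text \<open>\<open>small_pairs\<close> controls two atoms in one piece; the summands of
  \<open>small_vol\<close> are the product and the pair term of the Chen--Stein bound. The levels
  \<open>lv\<close> are the end points of the value intervals.\<close>

locale voronoi_poisson = voronoi_grid f \<mu> W C b a1 a2 \<rho> t \<epsilon> U n nW z Q
  for f :: "'a::euclidean_space \<Rightarrow> real" and \<mu> :: "'a measure" and W :: "'a set"
    and C b a1 a2 \<rho> t \<epsilon> U :: real and n nW :: nat and z :: "nat \<Rightarrow> 'a" and Q :: "nat \<Rightarrow> 'a set" +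
  fixes P :: "'m measure" and \<eta> :: "'m \<Rightarrow> 'a \<Rightarrow> nat" and m :: nat and lv :: "nat \<Rightarrow> real"
  assumes poisson: "poisson_process P \<eta> (scale_measure (ennreal t) \<mu>)"
    and small_pairs: "v * a2 / t \<le> \<epsilon>"
    and small_vol: "vol / t * exp (2 * (U + 1)) + vol * t powr (- \<kappa>) * exp (2 * (U + 1)) \<le> \<epsilon>"
    and lv: "\<And>l. l \<le> m \<Longrightarrow> \<bar>lv l\<bar> \<le> U" and lv_mono: "\<And>l. l < m \<Longrightarrow> lv l \<le> lv (Suc l)"

sublocale voronoi_poisson \<subseteq> prob_space P
  using poisson by (simp add: poisson_process_def)

context voronoi_poisson
begin

lemma lf: "\<omega> \<in> space P \<Longrightarrow> locally_finite_cm (\<eta> \<omega>)"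
  using poisson by (simp add: poisson_process_def)

lemma cm_count_measurable:
  "B \<in> sets borel \<Longrightarrow> bounded B \<Longrightarrow> (\<lambda>\<omega>. cm_count (\<eta> \<omega>) B) \<in> measurable P (count_space UNIV)"
  using poisson by (simp add: poisson_process_def)

definition c :: "nat \<Rightarrow> 'm \<Rightarrow> nat" where "c j \<omega> = cm_count (\<eta> \<omega>) (Q j)"

lemma c_measurable: "j < n \<Longrightarrow> c j \<in> measurable P (count_space UNIV)"
  unfolding c_def[abs_def] by (intro cm_count_measurable Q_borel Q_bounded)

lemma prob_c: "j < n \<Longrightarrow> prob {\<omega>\<in>space P. c j \<omega> = k} = p j ^ k / fact k * exp (- p j)"
proof -
  assume j: "j < n"
  have "prob {\<omega>\<in>space P. cm_count (\<eta> \<omega>) (Q j) = k} = measure (scale_measure (ennreal t) \<mu>) (Q j) ^ k / fact k * exp (- measure (scale_measure (ennreal t) \<mu>) (Q j))"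
    using poisson Q_borel[OF j] Q_bounded[OF j] by (simp only: poisson_process_def)
  then show ?thesis using t_facts by (simp add: c_def p_def measure_scale_measure)
qed

lemma indep_c: "indep_vars (\<lambda>_. count_space UNIV) c {..<n}"
proof -
  have "finite {..<n} \<and> (\<forall>i\<in>{..<n}. Q i \<in> sets borel \<and> bounded (Q i)) \<and> disjoint_family_on Q {..<n}"
    using Q_borel Q_bounded Q_disj by auto
  then have "indep_vars (\<lambda>_. count_space UNIV) (\<lambda>i \<omega>. cm_count (\<eta> \<omega>) (Q i)) {..<n}"
    using poisson unfolding poisson_process_def by blast
  then show ?thesis by (simp add: c_def[abs_def])
qed

text \<open>A finite product of discrete countable spaces is discrete, so every predicate of
  finitely many counts gives an event. Locality is expressed by factoring \<open>R\<close> through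
  the restricted counts, which is also the form that independence of disjoint blocks
  requires.\<close>

lemma event_c:
  assumes J: "J \<subseteq> {..<n}" and R: "\<And>\<omega>. \<omega> \<in> space P \<Longrightarrow> R \<omega> \<longleftrightarrow> \<Phi> (\<lambda>j\<in>J. c j \<omega>)"
  shows "{\<omega>\<in>space P. R \<omega>} \<in> events"
proof -
  have "(\<lambda>\<omega>. \<lambda>j\<in>J. c j \<omega>) \<in> measurable P (PiM J (\<lambda>_. count_space UNIV))"
    using J by (intro measurable_restrict c_measurable) auto
  moreover have "{x\<in>PiE J (\<lambda>_. UNIV). \<Phi> x} \<in> sets (PiM J (\<lambda>_. count_space UNIV :: nat measure))"
    using count_space_PiM_finite[OF finite_subset[OF J finite_lessThan], of "\<lambda>_. UNIV :: nat set"] by simp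
  ultimately have "(\<lambda>\<omega>. \<lambda>j\<in>J. c j \<omega>) -` {x\<in>PiE J (\<lambda>_. UNIV). \<Phi> x} \<inter> space P \<in> events"
    by (rule measurable_sets)
  also have "(\<lambda>\<omega>. \<lambda>j\<in>J. c j \<omega>) -` {x\<in>PiE J (\<lambda>_. UNIV). \<Phi> x} \<inter> space P = {\<omega>\<in>space P. R \<omega>}"
    using R by auto
  finally show ?thesis .
qed

lemma indep_c_events:
  assumes AB: "A \<inter> B = {}" "A \<subseteq> {..<n}" "B \<subseteq> {..<n}"
    and R: "\<And>\<omega>. \<omega> \<in> space P \<Longrightarrow> R \<omega> \<longleftrightarrow> \<Phi> (\<lambda>j\<in>A. c j \<omega>)"
    and R': "\<And>\<omega>. \<omega> \<in> space P \<Longrightarrow> R' \<omega> \<longleftrightarrow> \<Psi> (\<lambda>j\<in>B. c j \<omega>)"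
  shows "prob ({\<omega>\<in>space P. R \<omega>} \<inter> {\<omega>\<in>space P. R' \<omega>}) = prob {\<omega>\<in>space P. R \<omega>} * prob {\<omega>\<in>space P. R' \<omega>}"
proof -
  have fin: "finite A" "finite B" using AB finite_subset by blast+
  let ?M = "\<lambda>J. PiM J (\<lambda>_. count_space UNIV :: nat measure)"
  let ?a = "{x\<in>PiE A (\<lambda>_. UNIV). \<Phi> x}" and ?b = "{x\<in>PiE B (\<lambda>_. UNIV). \<Psi> x}"
  have "?a \<in> sets (?M A)" "?b \<in> sets (?M B)"
    using count_space_PiM_finite[OF fin(1), of "\<lambda>_. UNIV :: nat set"]
      count_space_PiM_finite[OF fin(2), of "\<lambda>_. UNIV :: nat set"] by simp_all
  from indep_varD[OF indep_var_restrict[OF indep_c AB] this]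
  have "prob ((\<lambda>\<omega>. (\<lambda>j\<in>A. c j \<omega>, \<lambda>j\<in>B. c j \<omega>)) -` (?a \<times> ?b) \<inter> space P)
    = prob ((\<lambda>\<omega>. \<lambda>j\<in>A. c j \<omega>) -` ?a \<inter> space P) * prob ((\<lambda>\<omega>. \<lambda>j\<in>B. c j \<omega>) -` ?b \<inter> space P)" .
  moreover have "(\<lambda>\<omega>. (\<lambda>j\<in>A. c j \<omega>, \<lambda>j\<in>B. c j \<omega>)) -` (?a \<times> ?b) \<inter> space P
     = {\<omega>\<in>space P. R \<omega>} \<inter> {\<omega>\<in>space P. R' \<omega>}" using R R' by auto
  moreover have "(\<lambda>\<omega>. \<lambda>j\<in>A. c j \<omega>) -` ?a \<inter> space P = {\<omega>\<in>space P. R \<omega>}"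
    "(\<lambda>\<omega>. \<lambda>j\<in>B. c j \<omega>) -` ?b \<inter> space P = {\<omega>\<in>space P. R' \<omega>}" using R R' by auto
  ultimately show ?thesis by simp
qed

lemma prob_void:
  assumes J: "J \<subseteq> {..<n}"
  shows "prob {\<omega>\<in>space P. \<forall>j\<in>J. c j \<omega> = 0} = exp (- sum p J)"
proof (cases "J = {}")
  case True
  then show ?thesis by (simp add: prob_space)
next
  case False
  have fin: "finite J" using J finite_subset by blast
  have "{\<omega>\<in>space P. \<forall>j\<in>J. c j \<omega> = 0} = (\<Inter>j\<in>J. c j -` {0} \<inter> space P)" using False by auto
  then have "prob {\<omega>\<in>space P. \<forall>j\<in>J. c j \<omega> = 0} = (\<Prod>j\<in>J. prob (c j -` {0} \<inter> space P))"
    using indep_varsD[OF indep_c False fin J, of "\<lambda>_. {0}"] by simp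
  also have "\<dots> = (\<Prod>j\<in>J. exp (- p j))"
  proof (rule prod.cong)
    fix j assume "j \<in> J"
    then have "prob {\<omega>\<in>space P. c j \<omega> = 0} = exp (- p j)" using prob_c[of j 0] J by auto
    moreover have "c j -` {0} \<inter> space P = {\<omega>\<in>space P. c j \<omega> = 0}" by auto
    ultimately show "prob (c j -` {0} \<inter> space P) = exp (- p j)" by simp
  qed simp
  also have "\<dots> = exp (- sum p J)" using fin by (simp add: exp_sum sum_negf[symmetric])
  finally show ?thesis .
qed

lemma event_hit: "j < n \<Longrightarrow> {\<omega>\<in>space P. 1 \<le> c j \<omega>} \<in> events"
  by (rule event_c[of "{j}" _ "\<lambda>x. 1 \<le> x j"]) auto

lemma prob_hit: "j < n \<Longrightarrow> prob {\<omega>\<in>space P. 1 \<le> c j \<omega>} = 1 - exp (- p j)"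
proof -
  assume j: "j < n"
  have "prob {\<omega>\<in>space P. \<not> 1 \<le> c j \<omega>} = exp (- p j)" using prob_c[OF j, of 0] by (simp add: not_le)
  then show ?thesis using prob_neg[OF event_hit[OF j]] by simp
qed

text \<open>Discrete version of: piece \<open>i\<close> has an atom with value at least
  \<open>u\<close>.\<close>

definition E :: "real \<Rightarrow> nat \<Rightarrow> 'm set" where
  "E u i = {\<omega>\<in>space P. 1 \<le> c i \<omega> \<and> (\<forall>j\<in>nb u i. c j \<omega> = 0)}"

lemma E_event: "i < n \<Longrightarrow> E u i \<in> events"
  unfolding E_def using nb_subset[of u i]
  by (intro event_c[of "insert i (nb u i)" _ "\<lambda>x. 1 \<le> x i \<and> (\<forall>j\<in>nb u i. x j = 0)"]) auto

lemma E_antimono: "u \<le> u' \<Longrightarrow> E u' i \<subseteq> E u i"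
  using nb_mono by (fastforce simp: E_def)

lemma prob_E: "i < n \<Longrightarrow> prob (E u i) = (1 - exp (- p i)) * exp (- sum p (nb u i))"
proof -
  assume i: "i < n"
  have eq: "E u i = {\<omega>\<in>space P. 1 \<le> c i \<omega>} \<inter> {\<omega>\<in>space P. \<forall>j\<in>nb u i. c j \<omega> = 0}" by (auto simp: E_def)
  have "prob (E u i) = prob {\<omega>\<in>space P. 1 \<le> c i \<omega>} * prob {\<omega>\<in>space P. \<forall>j\<in>nb u i. c j \<omega> = 0}"
    unfolding eq by (rule indep_c_events[of "{i}" "nb u i" _ "\<lambda>x. 1 \<le> x i" _ "\<lambda>x. \<forall>j\<in>nb u i. x j = 0"])
       (use i nb_subset nb_self in auto)
  then show ?thesis by (simp only: prob_hit[OF i] prob_void[OF nb_subset])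
qed

text \<open>A piece in the exclusion neighbourhood of the other makes the events incompatible.
  Otherwise the two hits and the void on the union of both neighbourhoods are independent, and the
  mass of this union is what the geometric gain improves.\<close>

lemma prob_E_pair:
  assumes "i < n" "i' < n" "i \<noteq> i'"
  shows "prob (E u i \<inter> E u i') \<le> (if i' \<in> nb u i \<or> i \<in> nb u i' then 0 else p i * p i' * exp (- sum p (nb u i \<union> nb u i')))"
proof (cases "i' \<in> nb u i \<or> i \<in> nb u i'")
  case True
  then have "E u i \<inter> E u i' = {}" by (auto simp: E_def)
  then show ?thesis using True by simp
next
  case False
  let ?N = "nb u i \<union> nb u i'"
  have N: "?N \<subseteq> {..<n}" using nb_subset by auto
  let ?H = "{\<omega>\<in>space P. 1 \<le> c i \<omega> \<and> 1 \<le> c i' \<omega>}"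
  have "?H = {\<omega>\<in>space P. 1 \<le> c i \<omega>} \<inter> {\<omega>\<in>space P. 1 \<le> c i' \<omega>}" by blast
  moreover have "prob ({\<omega>\<in>space P. 1 \<le> c i \<omega>} \<inter> {\<omega>\<in>space P. 1 \<le> c i' \<omega>})
    = prob {\<omega>\<in>space P. 1 \<le> c i \<omega>} * prob {\<omega>\<in>space P. 1 \<le> c i' \<omega>}"
    by (rule indep_c_events[of "{i}" "{i'}" _ "\<lambda>x. 1 \<le> x i" _ "\<lambda>x. 1 \<le> x i'"]) (use assms in auto)
  ultimately have "prob ?H = (1 - exp (- p i)) * (1 - exp (- p i'))"
    unfolding prob_hit[OF assms(1)] prob_hit[OF assms(2)] by metis
  also have "\<dots> \<le> p i * p i'"
    using exp_ge_add_one_self[of "- p i"] exp_ge_add_one_self[of "- p i'"] p_nonneg[of i] p_nonneg[of i']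
    by (intro mult_mono) auto
  finally have H: "prob ?H \<le> p i * p i'" .
  have eq: "E u i \<inter> E u i' = ?H \<inter> {\<omega>\<in>space P. \<forall>j\<in>?N. c j \<omega> = 0}"
    by (auto simp: E_def)
  have "prob (E u i \<inter> E u i') = prob ?H * prob {\<omega>\<in>space P. \<forall>j\<in>?N. c j \<omega> = 0}"
    unfolding eq
    by (rule indep_c_events[of "{i, i'}" ?N _ "\<lambda>x. 1 \<le> x i \<and> 1 \<le> x i'" _ "\<lambda>x. \<forall>j\<in>?N. x j = 0"])
       (use assms False N nb_self in auto)
  also have "\<dots> = prob ?H * exp (- sum p ?N)" by (simp only: prob_void[OF N])
  also have "\<dots> \<le> p i * p i' * exp (- sum p ?N)" using H by (intro mult_right_mono) auto
  finally show ?thesis using False by (simp only: if_False)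
qed

lemma exp_level: "exp (- (u + ln t)) = exp (- u) / t"
  using t_facts by (simp add: exp_diff)

lemma prob_E_bounds:
  assumes i: "i < nW" and u: "\<bar>u\<bar> \<le> U + 1"
  shows "prob (E u i) \<le> p i / t * exp (2 * \<epsilon> - u)" "p i / t * ((1 - \<epsilon>) * exp (- u - 2 * \<epsilon>)) \<le> prob (E u i)"
proof -
  have i': "i < n" using i nW by simp
  note S = sum_nb[OF i u]
  have "exp (- sum p (nb u i)) \<le> exp (2 * \<epsilon> + - (u + ln t))" using S by simp
  also have "\<dots> = exp (2 * \<epsilon> - u) / t" unfolding exp_add exp_level by (simp add: exp_diff exp_minus field_simps)
  finally have 1: "exp (- sum p (nb u i)) \<le> exp (2 * \<epsilon> - u) / t" .
  have "exp (- u - 2 * \<epsilon>) / t = exp (- 2 * \<epsilon> + - (u + ln t))" unfolding exp_add exp_level by (simp add: exp_diff exp_minus field_simps)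
  also have "\<dots> \<le> exp (- sum p (nb u i))" using S by simp
  finally have 2: "exp (- u - 2 * \<epsilon>) / t \<le> exp (- sum p (nb u i))" .
  have up: "1 - exp (- p i) \<le> p i" using exp_ge_add_one_self[of "- p i"] by simp
  \<comment> \<open>Uses \<open>exp (- p) * (1 + p) \<le> 1\<close> and (1 - p + p^2)(1 + p) = 1 +
    p^3.\<close>
  have "exp (- p i) \<le> 1 - p i * (1 - p i)"
  proof -
    have "exp (- p i) * (1 + p i) \<le> exp (- p i) * exp (p i)"
      using exp_ge_add_one_self[of "p i"] by (intro mult_left_mono) auto
    also have "\<dots> = 1" by (simp flip: exp_add)
    also have "1 \<le> (1 - p i * (1 - p i)) * (1 + p i)"
      using p_nonneg[of i] by (simp add: algebra_simps flip: power3_eq_cube)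
    finally show ?thesis using p_nonneg[of i] by (simp add: mult_le_cancel_right)
  qed
  moreover have "p i * (1 - \<epsilon>) \<le> p i * (1 - p i)" using p_small[OF i] p_nonneg by (intro mult_left_mono) auto
  ultimately have lo: "p i * (1 - \<epsilon>) \<le> 1 - exp (- p i)" by linarith
  have "prob (E u i) \<le> p i * (exp (2 * \<epsilon> - u) / t)"
    unfolding prob_E[OF i'] using up 1 p_nonneg t_facts by (intro mult_mono) auto
  then show "prob (E u i) \<le> p i / t * exp (2 * \<epsilon> - u)" by (simp add: field_simps)
  have "p i * (1 - \<epsilon>) * (exp (- u - 2 * \<epsilon>) / t) \<le> prob (E u i)"
    unfolding prob_E[OF i'] using lo 2 p_nonneg[of i] t_facts eps by (intro mult_mono) auto
  then show "p i / t * ((1 - \<epsilon>) * exp (- u - 2 * \<epsilon>)) \<le> prob (E u i)" by (simp add: field_simps)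
qed

text \<open>The limit intensity appears here: each piece contributes about
  \<open>p i / t * exp (- u)\<close>, and the \<open>p i\<close> add up to \<open>t\<close> because
  \<open>\<mu>\<close> gives mass 1 to \<open>W\<close>.\<close>

lemma sum_prob_E:
  assumes u: "\<bar>u\<bar> \<le> U + 1"
  shows "(\<Sum>i<nW. prob (E u i)) \<le> exp (2 * \<epsilon> - u)" "(1 - \<epsilon>) * exp (- u - 2 * \<epsilon>) \<le> (\<Sum>i<nW. prob (E u i))"
proof -
  have *: "(\<Sum>i<nW. p i / t * K) = K" for K
    using t_facts by (simp add: sum_p_W flip: sum_distrib_right sum_divide_distrib)
  have "(\<Sum>i<nW. prob (E u i)) \<le> (\<Sum>i<nW. p i / t * exp (2 * \<epsilon> - u))"
    using prob_E_bounds[OF _ u] by (intro sum_mono) auto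
  then show "(\<Sum>i<nW. prob (E u i)) \<le> exp (2 * \<epsilon> - u)" unfolding * .
  have "(\<Sum>i<nW. p i / t * ((1 - \<epsilon>) * exp (- u - 2 * \<epsilon>))) \<le> (\<Sum>i<nW. prob (E u i))"
    using prob_E_bounds[OF _ u] by (intro sum_mono) auto
  then show "(1 - \<epsilon>) * exp (- u - 2 * \<epsilon>) \<le> (\<Sum>i<nW. prob (E u i))" unfolding * .
qed

lemma exp_le_double: "0 \<le> x \<Longrightarrow> x \<le> 1 \<Longrightarrow> exp x \<le> 1 + 2 * x" for x :: real
proof -
  assume x: "0 \<le> x" "x \<le> 1"
  have "exp x \<le> 1 + x + x\<^sup>2" using x by (rule exp_bound)
  moreover have "x\<^sup>2 \<le> x" using x by (simp add: power2_eq_square mult_left_le)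
  ultimately show ?thesis by linarith
qed

text \<open>The second bound, with 10 = 6 + 4 from its upper and lower estimate, controls the values
  so close to \<open>u\<close> that the discretisation may misjudge them.\<close>

lemma sum_prob_E_approx:
  assumes u: "\<bar>u\<bar> \<le> U"
  shows "\<bar>(\<Sum>i<nW. prob (E u i)) - exp (- u)\<bar> \<le> 4 * \<epsilon> * exp U"
    and "(\<Sum>i<nW. prob (E (u - \<epsilon>) i)) - (\<Sum>i<nW. prob (E (u + \<epsilon>) i)) \<le> 10 * \<epsilon> * exp U"
proof -
  have eU: "exp (- u) \<le> exp U" using u by simp
  have lo: "1 - 4 * \<epsilon> \<le> (1 - \<epsilon>) * exp (- 3 * \<epsilon>)"
  proof -
    have "(1 - \<epsilon>) * (1 + - 3 * \<epsilon>) \<le> (1 - \<epsilon>) * exp (- 3 * \<epsilon>)"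
      using eps exp_ge_add_one_self[of "- 3 * \<epsilon>"] by (intro mult_left_mono) auto
    moreover have "1 - 4 * \<epsilon> \<le> (1 - \<epsilon>) * (1 + - 3 * \<epsilon>)" using eps by (simp add: algebra_simps)
    ultimately show ?thesis by linarith
  qed
  have "(\<Sum>i<nW. prob (E u i)) \<le> exp (2 * \<epsilon>) * exp (- u)"
    using sum_prob_E(1)[of u] u by (simp flip: exp_add)
  also have "\<dots> \<le> (1 + 2 * (2 * \<epsilon>)) * exp (- u)"
    using exp_le_double[of "2 * \<epsilon>"] eps by (intro mult_right_mono) auto
  finally have 1: "(\<Sum>i<nW. prob (E u i)) - exp (- u) \<le> 4 * \<epsilon> * exp (- u)" by (simp add: algebra_simps)
  have "(1 - 4 * \<epsilon>) * exp (- u) \<le> (1 - \<epsilon>) * exp (- 3 * \<epsilon>) * exp (- u)" using lo by (intro mult_right_mono) auto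
  also have "\<dots> \<le> (1 - \<epsilon>) * exp (- u - 2 * \<epsilon>)"
    using eps by (simp add: mult.assoc mult_left_mono flip: exp_add)
  also have "\<dots> \<le> (\<Sum>i<nW. prob (E u i))" using sum_prob_E(2)[of u] u by simp
  finally have 2: "exp (- u) - (\<Sum>i<nW. prob (E u i)) \<le> 4 * \<epsilon> * exp (- u)" by (simp add: algebra_simps)
  have "4 * \<epsilon> * exp (- u) \<le> 4 * \<epsilon> * exp U" using eU eps by (intro mult_left_mono) auto
  then show "\<bar>(\<Sum>i<nW. prob (E u i)) - exp (- u)\<bar> \<le> 4 * \<epsilon> * exp U" using 1 2 by linarith
  have "(\<Sum>i<nW. prob (E (u - \<epsilon>) i)) \<le> exp (3 * \<epsilon>) * exp (- u)"
    using sum_prob_E(1)[of "u - \<epsilon>"] u eps by (simp add: algebra_simps flip: exp_add)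
  also have "\<dots> \<le> (1 + 2 * (3 * \<epsilon>)) * exp (- u)"
    using exp_le_double[of "3 * \<epsilon>"] eps by (intro mult_right_mono) auto
  finally have 3: "(\<Sum>i<nW. prob (E (u - \<epsilon>) i)) \<le> (1 + 6 * \<epsilon>) * exp (- u)" by simp
  have "(1 - 4 * \<epsilon>) * exp (- u) \<le> (1 - \<epsilon>) * exp (- 3 * \<epsilon>) * exp (- u)" using lo by (intro mult_right_mono) auto
  also have "\<dots> = (1 - \<epsilon>) * exp (- (u + \<epsilon>) - 2 * \<epsilon>)" by (simp add: algebra_simps flip: exp_add)
  also have "\<dots> \<le> (\<Sum>i<nW. prob (E (u + \<epsilon>) i))" using sum_prob_E(2)[of "u + \<epsilon>"] u eps by simp
  finally have 4: "(1 - 4 * \<epsilon>) * exp (- u) \<le> (\<Sum>i<nW. prob (E (u + \<epsilon>) i))" .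
  have "10 * \<epsilon> * exp (- u) \<le> 10 * \<epsilon> * exp U" using eU eps by (intro mult_left_mono) auto
  then show "(\<Sum>i<nW. prob (E (u - \<epsilon>) i)) - (\<Sum>i<nW. prob (E (u + \<epsilon>) i)) \<le> 10 * \<epsilon> * exp U"
    using 3 4 by (simp add: algebra_simps)
qed

end

section \<open>Comparing true and discretised counts\<close>

context voronoi_poisson
begin

definition Y :: "nat \<Rightarrow> nat \<Rightarrow> 'm set" where "Y i l = E (lv l) i - E (lv (Suc l)) i"

definition X :: "nat \<Rightarrow> 'm \<Rightarrow> nat" where "X l \<omega> = card {i \<in> {..<nW}. \<omega> \<in> Y i l}"

definition xi_count :: "nat \<Rightarrow> 'm \<Rightarrow> nat" where
  "xi_count l \<omega> = cm_count (xi_hat \<mu> W t (\<eta> \<omega>)) {lv l..<lv (Suc l)}"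

text \<open>Outside this event each piece of \<open>W\<close> holds at most one atom, with
  multiplicity one, and no occupied piece is in doubt at any level by shifts of \<epsilon>.\<close>

definition bad :: "'m set" where
  "bad = (\<Union>i<nW. {\<omega>\<in>space P. 2 \<le> c i \<omega>}) \<union> (\<Union>l\<le>m. \<Union>i<nW. E (lv l - \<epsilon>) i - E (lv l + \<epsilon>) i)"

lemma nW_n: "i < nW \<Longrightarrow> i < n" using nW by simp

lemma lv_le: "l \<le> l' \<Longrightarrow> l' \<le> m \<Longrightarrow> lv l \<le> lv l'"
proof (induction l' rule: dec_induct)
  case (step k)
  then show ?case using lv_mono[of k] by simp
qed simp

lemma lv_shift: "l \<le> m \<Longrightarrow> \<bar>lv l\<bar> \<le> U + 1" "l \<le> m \<Longrightarrow> \<bar>lv l - \<epsilon>\<bar> \<le> U + 1" "l \<le> m \<Longrightarrow> \<bar>lv l + \<epsilon>\<bar> \<le> U + 1"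
  using lv[of l] eps by auto

lemma event_double: "j < n \<Longrightarrow> {\<omega>\<in>space P. 2 \<le> c j \<omega>} \<in> events"
  by (rule event_c[of "{j}" _ "\<lambda>x. 2 \<le> x j"]) auto

lemma bad_event: "bad \<in> events"
  unfolding bad_def using event_double E_event nW_n by (intro sets.Un sets.finite_UN sets.Diff) auto

lemma prob_double: "j < n \<Longrightarrow> prob {\<omega>\<in>space P. 2 \<le> c j \<omega>} \<le> p j * p j"
proof -
  assume j: "j < n"
  have lev: "{\<omega>\<in>space P. c j \<omega> = k} \<in> events" for k
    by (rule event_c[of "{j}" _ "\<lambda>x. x j = k"]) (use j in auto)
  have "{\<omega>\<in>space P. \<not> 2 \<le> c j \<omega>} = {\<omega>\<in>space P. c j \<omega> = 0} \<union> {\<omega>\<in>space P. c j \<omega> = 1}" by auto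
  then have "prob {\<omega>\<in>space P. \<not> 2 \<le> c j \<omega>} = prob {\<omega>\<in>space P. c j \<omega> = 0} + prob {\<omega>\<in>space P. c j \<omega> = 1}"
    using lev[of 0] lev[of 1] by (simp only:, subst finite_measure_Union) auto
  also have "\<dots> = (1 + p j) * exp (- p j)"
    unfolding prob_c[OF j] by (simp add: algebra_simps)
  finally have eq: "prob {\<omega>\<in>space P. 2 \<le> c j \<omega>} = 1 - (1 + p j) * exp (- p j)"
    using prob_neg[OF event_double[OF j]] by simp
  have "(1 + p j) * (1 - p j) \<le> (1 + p j) * exp (- p j)"
    using exp_ge_add_one_self[of "- p j"] p_nonneg[of j] by (intro mult_left_mono) auto
  then show ?thesis unfolding eq by (simp add: algebra_simps)
qed

text \<open>The exponent 3 of the mesh is used here: even in dimension one \<open>p i\<close> is at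
  most a constant over t^2, and the \<open>p i\<close> add up to \<open>t\<close>.\<close>

lemma sum_p_squared: "(\<Sum>i<nW. p i * p i) \<le> \<epsilon>"
proof -
  have "p i * p i \<le> p i * (\<epsilon> / t)" if i: "i < nW" for i
  proof (rule mult_left_mono)
    have "p i \<le> t * measure \<mu> (ball (z i) mesh)"
      using sum_p_le_ball[of "{i}" "z i" mesh] Q_mesh[of i] i nW by auto
    also have "\<dots> \<le> t * (a2 * v * mesh ^ DIM('a))"
      using near[OF z_W[OF i]] mesh rad a2 t_facts by (intro mult_left_mono measure_mu_ball_le) auto
    also have "\<dots> \<le> t * (a2 * v * mesh)"
    proof -
      have "mesh ^ DIM('a) \<le> mesh ^ 1" using mesh by (intro power_decreasing) (auto simp: Suc_le_eq)
      then show ?thesis using t_facts a2 v_pos by (intro mult_left_mono) auto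
    qed
    also have "\<dots> = v * a2 / t / t" using t_facts by (simp add: mesh_def field_simps power3_eq_cube)
    also have "\<dots> \<le> \<epsilon> / t" using small_pairs t_facts by (intro divide_right_mono) auto
    finally show "p i \<le> \<epsilon> / t" .
  qed (rule p_nonneg)
  then have "(\<Sum>i<nW. p i * p i) \<le> (\<Sum>i<nW. p i * (\<epsilon> / t))" by (intro sum_mono) auto
  also have "\<dots> = \<epsilon>" unfolding sum_distrib_right[symmetric] sum_p_W using t_facts by simp
  finally show ?thesis .
qed

lemma prob_bad: "prob bad \<le> \<epsilon> + real (Suc m) * (10 * \<epsilon> * exp U)"
proof -
  have fin: "finite {..<nW}" "finite {..m}" by auto
  let ?A = "\<lambda>i. {\<omega>\<in>space P. 2 \<le> c i \<omega>}" and ?B = "\<lambda>l i. E (lv l - \<epsilon>) i - E (lv l + \<epsilon>) i"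
  have B: "?B l i \<in> events" if "i < nW" for l i using E_event nW_n that by auto
  have A: "?A i \<in> events" if "i < nW" for i using event_double nW_n that by auto
  have UB: "(\<Union>i<nW. ?B l i) \<in> events" for l using B by (intro sets.finite_UN) auto
  have 0: "prob bad \<le> prob (\<Union>i<nW. ?A i) + prob (\<Union>l\<le>m. \<Union>i<nW. ?B l i)"
    unfolding bad_def using sets.finite_UN[OF fin(1) A] sets.finite_UN[OF fin(2) UB] by (intro measure_Un_le) auto
  have "prob (\<Union>i<nW. ?A i) \<le> (\<Sum>i<nW. prob (?A i))"
    using A by (intro finite_measure_subadditive_finite) auto
  moreover have "(\<Sum>i<nW. prob (?A i)) \<le> (\<Sum>i<nW. p i * p i)"
    using prob_double nW_n by (intro sum_mono) auto
  ultimately have 1: "prob (\<Union>i<nW. ?A i) \<le> \<epsilon>" using sum_p_squared by linarith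
  have 2: "prob (\<Union>l\<le>m. \<Union>i<nW. ?B l i) \<le> (\<Sum>l\<le>m. prob (\<Union>i<nW. ?B l i))"
    using UB by (intro finite_measure_subadditive_finite) auto
  have 3: "(\<Sum>l\<le>m. prob (\<Union>i<nW. ?B l i)) \<le> (\<Sum>l\<le>m. 10 * \<epsilon> * exp U)"
  proof (rule sum_mono)
    fix l assume l: "l \<in> {..m}"
    have "prob (\<Union>i<nW. ?B l i) \<le> (\<Sum>i<nW. prob (?B l i))"
      using B by (intro finite_measure_subadditive_finite) auto
    moreover have "(\<Sum>i<nW. prob (?B l i)) = (\<Sum>i<nW. prob (E (lv l - \<epsilon>) i) - prob (E (lv l + \<epsilon>) i))"
    proof (rule sum.cong[OF refl])
      fix i assume "i \<in> {..<nW}"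
      then show "prob (?B l i) = prob (E (lv l - \<epsilon>) i) - prob (E (lv l + \<epsilon>) i)"
        using E_event[OF nW_n] E_antimono[of "lv l - \<epsilon>" "lv l + \<epsilon>" i] eps
        by (intro finite_measure_Diff) auto
    qed
    moreover have "\<dots> \<le> 10 * \<epsilon> * exp U"
      unfolding sum_subtractf by (rule sum_prob_E_approx(2)) (use lv[of l] l in simp)
    ultimately show "prob (\<Union>i<nW. ?B l i) \<le> 10 * \<epsilon> * exp U" by linarith
  qed
  have "(\<Sum>l\<le>m. 10 * \<epsilon> * exp U) = real (Suc m) * (10 * \<epsilon> * exp U)" by simp
  then show ?thesis using 0 1 2 3 by linarith
qed

text \<open>\<open>mark x y\<close> is monotone in the distance, so the value of \<open>x\<close> is
  its minimum over the other atoms, attained at the nearest one.\<close>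

lemma mark_ge_iff:
  assumes \<nu>: "locally_finite_cm \<nu>" and ne: "cm_support \<nu> - {x} \<noteq> {}"
  shows "u \<le> 2 ^ DIM('a) * t * inball_measure \<mu> \<nu> x - ln t \<longleftrightarrow>
    (\<forall>y\<in>cm_support \<nu> - {x}. u \<le> mark x y)"
proof -
  obtain a where a: "a \<in> cm_support \<nu> - {x}" "infdist x (cm_support \<nu> - {x}) = dist x a"
    using infdist_attained[OF \<nu> _ ne, of x] by auto
  have eq: "inball_measure \<mu> \<nu> x = measure \<mu> (ball x (dist x a / 2))"
    unfolding inball_measure_def eball_inradius[OF \<nu>] using ne a(2) by (simp only: if_False)
  have "2 ^ DIM('a) * t * inball_measure \<mu> \<nu> x \<le> 2 ^ DIM('a) * t * measure \<mu> (ball x (dist x y / 2))"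
    if y: "y \<in> cm_support \<nu> - {x}" for y
  proof -
    have "dist x a \<le> dist x y" using infdist_le[OF y, of x] a(2) by simp
    then show ?thesis unfolding eq using t_facts by (intro mult_left_mono measure_mu_mono subset_ball) auto
  qed
  then have le: "2 ^ DIM('a) * t * inball_measure \<mu> \<nu> x - ln t \<le> mark x y"
    if "y \<in> cm_support \<nu> - {x}" for y using that by simp
  show ?thesis (is "?u \<le> ?m \<longleftrightarrow> ?R")
  proof
    assume "u \<le> ?m" then show ?R using le order_trans by blast
  next
    assume ?R then show "u \<le> ?m" using a(1) unfolding eq by blast
  qed
qed

text \<open>\<open>E (lv l + \<epsilon>) i\<close> forces the value to be at least
  \<open>lv l\<close>, and this in turn forces \<open>E (lv l - \<epsilon>) i\<close>. Outside
  \<open>bad\<close> the outer event implies the inner one, which squeezes \<open>E (lv l) i\<close>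
  in between.\<close>

lemma mark_ge_iff_E:
  assumes \<omega>: "\<omega> \<in> space P - bad" and i: "i < nW" and x: "Q i \<inter> cm_support (\<eta> \<omega>) = {x}"
    and ne: "cm_support (\<eta> \<omega>) - {x} \<noteq> {}" and l: "l \<le> m"
  shows "lv l \<le> 2 ^ DIM('a) * t * inball_measure \<mu> (\<eta> \<omega>) x - ln t \<longleftrightarrow> \<omega> \<in> E (lv l) i"
proof -
  have \<omega>P: "\<omega> \<in> space P" and \<nu>: "locally_finite_cm (\<eta> \<omega>)" using \<omega> lf by auto
  have xQ: "x \<in> Q i" and xW: "x \<in> W" using x i Q_W by auto
  have c_pos: "1 \<le> c j \<omega> \<longleftrightarrow> (\<exists>y\<in>cm_support (\<eta> \<omega>). y \<in> Q j)" if "j < n" for j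
    using cm_count_eq_0_iff[OF \<nu> Q_bounded[OF that]] by (auto simp: c_def Suc_le_eq)
  have ci: "1 \<le> c i \<omega>" using x c_pos[OF nW_n[OF i]] by blast
  have disj: "y \<notin> Q i" if "y \<in> Q j" "j < n" "j \<noteq> i" for y j
    using Q_disj that nW_n[OF i] by (auto simp: disjoint_family_on_def)
  have sharp: "\<omega> \<in> E (lv l + \<epsilon>) i" if "\<omega> \<in> E (lv l - \<epsilon>) i"
    using \<omega> l i that by (auto simp: bad_def)
  show ?thesis unfolding mark_ge_iff[OF \<nu> ne]
  proof
    assume ge: "\<forall>y\<in>cm_support (\<eta> \<omega>) - {x}. lv l \<le> mark x y"
    show "\<omega> \<in> E (lv l) i"
    proof (rule ccontr)
      assume nE: "\<omega> \<notin> E (lv l) i"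
      have "\<omega> \<notin> E (lv l - \<epsilon>) i"
        using sharp nE E_antimono[of "lv l" "lv l + \<epsilon>" i] eps by auto
      then obtain j where j: "j \<in> nb (lv l - \<epsilon>) i" "1 \<le> c j \<omega>"
        using ci \<omega>P by (auto simp: E_def Suc_le_eq)
      then obtain y where y: "y \<in> cm_support (\<eta> \<omega>)" "y \<in> Q j" using c_pos[of j] by (auto simp: nb_def)
      have "y \<noteq> x" using disj[of y j] j y xQ by (auto simp: nb_def)
      then show False
        using ge y mark_less[OF i xQ _ y(2), of "lv l - \<epsilon>"] j lv_shift[OF l] by (force simp: nb_def)
    qed
  next
    assume El: "\<omega> \<in> E (lv l) i"
    then have Ee: "\<omega> \<in> E (lv l + \<epsilon>) i"
      using sharp E_antimono[of "lv l - \<epsilon>" "lv l" i] eps by auto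
    show "\<forall>y\<in>cm_support (\<eta> \<omega>) - {x}. lv l \<le> mark x y"
    proof (rule ballI, rule ccontr)
      fix y assume y: "y \<in> cm_support (\<eta> \<omega>) - {x}"
        and less: "\<not> lv l \<le> mark x y"
      have "dist x y < rad t" using far_mark[OF xW _ lv_shift(1)[OF l], of y] less by force
      then have "y \<in> ball x 1" using rad by auto
      then obtain j where j: "j < n" "y \<in> Q j" using cover[OF xW] by blast
      have "gap i j < lv l + \<epsilon>" using gap_less[OF i xQ j lv_shift(1)[OF l]] less by simp
      moreover have "j \<noteq> i" using j y x by auto
      ultimately have "c j \<omega> = 0" using Ee j by (auto simp: E_def nb_def)
      then show False using c_pos[OF j(1)] j y by auto
    qed
  qed
qed

text \<open>A lone atom has infinite inradius; \<open>measure \<mu> UNIV\<close> is then either the junk value \<open>0\<close>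
  (infinite mass) or at least \<open>1\<close>, and its value leaves every bounded window as \<open>t\<close> grows.\<close>
lemma lonely_mark:
  assumes "locally_finite_cm \<nu>" "cm_support \<nu> - {x} = {}"
  shows "\<not> (- U \<le> 2 ^ DIM('a) * t * inball_measure \<mu> \<nu> x - ln t \<and> 2 ^ DIM('a) * t * inball_measure \<mu> \<nu> x - ln t \<le> U)"
proof -
  have eq: "inball_measure \<mu> \<nu> x = measure \<mu> UNIV"
    unfolding inball_measure_def eball_inradius[OF assms(1)] by (simp add: assms(2))
  show ?thesis
  proof (cases "emeasure \<mu> UNIV = \<infinity>")
    case True
    then have "measure \<mu> UNIV = 0" unfolding measure_def by (simp only:) simp
    then show ?thesis unfolding eq using U by simp
  next
    case False
    have "measure \<mu> W \<le> measure \<mu> UNIV"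
    proof (rule measure_mono_fmeasurable)
      show "W \<in> sets \<mu>" using compact_imp_closed[OF W_compact] by simp
      show "UNIV \<in> fmeasurable \<mu>" using False by (simp add: fmeasurable_def top.not_eq_extremum)
    qed simp
    then have "2 * t * 1 \<le> 2 ^ DIM('a) * t * measure \<mu> UNIV"
      using t_facts mu_W by (intro mult_mono) (auto intro: self_le_power simp: Suc_le_eq)
    moreover have "ln t \<le> t - 1" using t_facts by (intro ln_le_minus_one)
    ultimately have "U < 2 ^ DIM('a) * t * measure \<mu> UNIV - ln t" using U(2) by linarith
    then show ?thesis unfolding eq by linarith
  qed
qed

lemma xi_count_eq_X:
  assumes \<omega>: "\<omega> \<in> space P - bad" and l: "l < m"
  shows "xi_count l \<omega> = X l \<omega>"
proof -
  have \<omega>P: "\<omega> \<in> space P" and \<nu>: "locally_finite_cm (\<eta> \<omega>)" using \<omega> lf by auto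
  let ?v = "\<lambda>x. 2 ^ DIM('a) * t * inball_measure \<mu> (\<eta> \<omega>) x - ln t"
  let ?T = "{x\<in>W \<inter> cm_support (\<eta> \<omega>). ?v x \<in> {lv l..<lv (Suc l)}}"
  have finQ: "finite (Q i \<inter> cm_support (\<eta> \<omega>))" if "i < n" for i
    by (rule finite_cm_support_Int[OF \<nu> Q_bounded[OF that]])
  have inner: "(\<Sum>x\<in>Q i \<inter> ?T. \<eta> \<omega> x) = (if \<omega> \<in> Y i l then 1 else 0)" if i: "i < nW" for i
  proof (cases "c i \<omega> = 0")
    case True
    then have "Q i \<inter> cm_support (\<eta> \<omega>) = {}"
      using cm_count_eq_0_iff[OF \<nu> Q_bounded[OF nW_n[OF i]]] by (simp add: c_def)
    then have "Q i \<inter> ?T = {}" by blast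
    moreover have "\<omega> \<notin> Y i l" using True by (auto simp: Y_def E_def)
    ultimately show ?thesis by (simp only: sum.empty if_False)
  next
    case False
    have "\<not> 2 \<le> c i \<omega>" using \<omega> i by (auto simp: bad_def)
    then have c1: "(\<Sum>x\<in>Q i \<inter> cm_support (\<eta> \<omega>). \<eta> \<omega> x) = 1" using False by (simp add: c_def cm_count_def)
    then obtain x where x: "x \<in> Q i \<inter> cm_support (\<eta> \<omega>)" by (metis sum.empty ex_in_conv zero_neq_one)
    have split: "(\<Sum>y\<in>Q i \<inter> cm_support (\<eta> \<omega>). \<eta> \<omega> y) = \<eta> \<omega> x + (\<Sum>y\<in>Q i \<inter> cm_support (\<eta> \<omega>) - {x}. \<eta> \<omega> y)"
      by (rule sum.remove[OF finQ[OF nW_n[OF i]] x])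
    have "\<eta> \<omega> x \<noteq> 0" using x by (simp add: cm_support_def)
    then have x1: "\<eta> \<omega> x = 1" "(\<Sum>y\<in>Q i \<inter> cm_support (\<eta> \<omega>) - {x}. \<eta> \<omega> y) = 0" using split c1 by linarith+
    have "Q i \<inter> cm_support (\<eta> \<omega>) - {x} = {}"
      using x1(2) finQ[OF nW_n[OF i]] by (auto simp: cm_support_def)
    then have single: "Q i \<inter> cm_support (\<eta> \<omega>) = {x}" using x by blast
    have xW: "x \<in> W" using x i Q_W by blast
    have "?v x \<in> {lv l..<lv (Suc l)} \<longleftrightarrow> \<omega> \<in> Y i l"
    proof (cases "cm_support (\<eta> \<omega>) - {x} = {}")
      case True
      \<comment> \<open>A lone atom counts on neither side: its value is outside the window, and
        with all other pieces empty \<open>E\<close> holds at both end points, so their difference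
        \<open>Y i l\<close> fails.\<close>
      have "?v x \<notin> {lv l..<lv (Suc l)}"
        using lonely_mark[OF \<nu> True] lv[of l] lv[of "Suc l"] l by auto
      moreover have "c j \<omega> = 0" if "j < n" "j \<noteq> i" for j
      proof -
        have "Q j \<inter> Q i = {}" using Q_disj that nW_n[OF i] by (auto simp: disjoint_family_on_def)
        then have "Q j \<inter> cm_support (\<eta> \<omega>) = {}" using True x by blast
        then show ?thesis by (simp add: c_def cm_count_def)
      qed
      then have "\<omega> \<in> E (lv (Suc l)) i" using False \<omega>P by (auto simp: E_def nb_def)
      then have "\<omega> \<notin> Y i l" by (simp add: Y_def)
      ultimately show ?thesis by blast
    next
      case ne: False
      have "lv l \<le> ?v x \<longleftrightarrow> \<omega> \<in> E (lv l) i" "lv (Suc l) \<le> ?v x \<longleftrightarrow> \<omega> \<in> E (lv (Suc l)) i"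
        using mark_ge_iff_E[OF \<omega> i single ne] l by auto
      then show ?thesis by (auto simp: Y_def not_le)
    qed
    moreover have "Q i \<inter> ?T = (if ?v x \<in> {lv l..<lv (Suc l)} then {x} else {})"
    proof -
      have "Q i \<inter> ?T = {y\<in>Q i \<inter> cm_support (\<eta> \<omega>). y \<in> W \<and> ?v y \<in> {lv l..<lv (Suc l)}}" by blast
      then show ?thesis unfolding single using xW by auto
    qed
    ultimately show ?thesis using x1(1) by (cases "\<omega> \<in> Y i l") simp_all
  qed
  have "xi_count l \<omega> = (\<Sum>x\<in>?T. \<eta> \<omega> x)"
    unfolding xi_count_def by (rule cm_count_xi_hat[OF \<nu> compact_imp_bounded[OF W_compact]])
  also have "\<dots> = (\<Sum>x\<in>(\<Union>i<nW. Q i \<inter> ?T). \<eta> \<omega> x)"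
    by (rule arg_cong[of _ _ "sum (\<eta> \<omega>)"]) (use Q_W in blast)
  also have "\<dots> = (\<Sum>i<nW. \<Sum>x\<in>Q i \<inter> ?T. \<eta> \<omega> x)"
  proof (rule sum.UNION_disjoint)
    show "\<forall>i\<in>{..<nW}. finite (Q i \<inter> ?T)"
      using finQ nW_n by (auto intro: finite_subset[rotated])
    show "\<forall>i\<in>{..<nW}. \<forall>j\<in>{..<nW}. i \<noteq> j \<longrightarrow> (Q i \<inter> ?T) \<inter> (Q j \<inter> ?T) = {}"
      using Q_disj nW by (fastforce simp: disjoint_family_on_def)
  qed simp
  also have "\<dots> = (\<Sum>i<nW. if \<omega> \<in> Y i l then 1 else 0)" using inner by (intro sum.cong) auto
  also have "\<dots> = X l \<omega>" by (simp add: X_def sum.If_cases Int_def)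
  finally show ?thesis .
qed


section \<open>Dependency neighbourhoods and the two dependence errors\<close>

text \<open>Neighbourhoods grow with the level, so the highest level \<open>lv m\<close> yields a
  set of pieces that determines \<open>Y i l\<close> for every \<open>l\<close>.\<close>

definition N :: "nat \<Rightarrow> nat set" where "N i = insert i (nb (lv m) i)"

definition D :: "nat \<Rightarrow> nat set" where "D i = {i' \<in> {..<nW}. N i \<inter> N i' \<noteq> {}}"

lemma N_subset: "i < nW \<Longrightarrow> N i \<subseteq> {..<n}" using nb_subset nW_n by (auto simp: N_def)

lemma D_close: "i < nW \<Longrightarrow> D i \<subseteq> {i'. i' < nW \<and> dist (z i) (z i') < 2 * rad t}"
proof
  fix i' assume i: "i < nW" and "i' \<in> D i"
  then obtain j where i': "i' < nW" and j: "j \<in> N i" "j \<in> N i'" by (auto simp: D_def)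
  have close: "dist (z k) (z j) < rad t" if "j \<in> N k" "k < nW" for k
    using that gap_iff[OF that(2) lv_shift(1)[OF order_refl], of j] radius(3)[OF z_W[OF that(2)] lv_shift(1)[OF order_refl]] rad(1)
    by (auto simp: N_def nb_def)
  show "i' \<in> {i'. i' < nW \<and> dist (z i) (z i') < 2 * rad t}"
    using close[OF j(1) i] close[OF j(2) i'] dist_triangle2[of "z i" "z i'" "z j"] i' by auto
qed

text \<open>\<open>Y i l\<close> as a predicate of a count vector, the form in which independence of
  disjoint blocks applies.\<close>

definition occurs :: "nat \<Rightarrow> nat \<Rightarrow> (nat \<Rightarrow> nat) \<Rightarrow> bool" where
  "occurs i l x \<longleftrightarrow> (1 \<le> x i \<and> (\<forall>j\<in>nb (lv l) i. x j = 0)) \<and> \<not> (1 \<le> x i \<and> (\<forall>j\<in>nb (lv (Suc l)) i. x j = 0))"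

lemma Y_local:
  assumes "i < nW" "l < m" "N i \<subseteq> J" "\<omega> \<in> space P"
  shows "\<omega> \<in> Y i l \<longleftrightarrow> occurs i l (\<lambda>j\<in>J. c j \<omega>)"
proof -
  have "nb (lv l) i \<subseteq> J" "nb (lv (Suc l)) i \<subseteq> J" "i \<in> J"
    using assms nb_mono[OF lv_le[of l m], of i] nb_mono[OF lv_le[of "Suc l" m], of i] by (auto simp: N_def)
  then show ?thesis using assms(4) by (auto simp: Y_def E_def occurs_def subset_iff)
qed

lemma Y_event: "i < nW \<Longrightarrow> Y i l \<in> events" using E_event nW_n by (auto simp: Y_def)

lemma indep_Y:
  assumes i: "i < nW" and l: "l < m"
  shows "prob (Y i l \<inter> {\<omega>\<in>space P. \<forall>l<m. card {i' \<in> {..<nW} - D i. \<omega> \<in> Y i' l} = k l})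
    = prob (Y i l) * prob {\<omega>\<in>space P. \<forall>l<m. card {i' \<in> {..<nW} - D i. \<omega> \<in> Y i' l} = k l}"
proof -
  let ?B = "\<Union>i'\<in>{..<nW} - D i. N i'"
  have "Y i l = {\<omega>\<in>space P. \<omega> \<in> Y i l}" using Y_event[OF i] sets.sets_into_space by blast
  moreover have "prob ({\<omega>\<in>space P. \<omega> \<in> Y i l} \<inter> {\<omega>\<in>space P. \<forall>l<m. card {i' \<in> {..<nW} - D i. \<omega> \<in> Y i' l} = k l})
    = prob {\<omega>\<in>space P. \<omega> \<in> Y i l} * prob {\<omega>\<in>space P. \<forall>l<m. card {i' \<in> {..<nW} - D i. \<omega> \<in> Y i' l} = k l}"
  proof (rule indep_c_events[of "N i" ?B])
    show "N i \<inter> ?B = {}" using i by (auto simp: D_def)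
    show "N i \<subseteq> {..<n}" by (rule N_subset[OF i])
    show "?B \<subseteq> {..<n}" using N_subset by blast
    fix \<omega> assume \<omega>: "\<omega> \<in> space P"
    show "\<omega> \<in> Y i l \<longleftrightarrow> occurs i l (\<lambda>j\<in>N i. c j \<omega>)" by (rule Y_local[OF i l order_refl \<omega>])
    have "{i' \<in> {..<nW} - D i. \<omega> \<in> Y i' l} = {i' \<in> {..<nW} - D i. occurs i' l (\<lambda>j\<in>?B. c j \<omega>)}" if "l < m" for l
      using Y_local[OF _ that _ \<omega>, of _ ?B] by blast
    then show "(\<forall>l<m. card {i' \<in> {..<nW} - D i. \<omega> \<in> Y i' l} = k l) \<longleftrightarrow>
      (\<forall>l<m. card {i' \<in> {..<nW} - D i. occurs i' l (\<lambda>j\<in>?B. c j \<omega>)} = k l)" by simp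
  qed
  ultimately show ?thesis by simp
qed

lemma sum_D: "i < nW \<Longrightarrow> sum p (D i) \<le> vol"
proof -
  assume i: "i < nW"
  have "sum p (D i) \<le> sum p {i'. i' < nW \<and> dist (z i) (z i') < 2 * rad t}"
    using D_close[OF i] p_nonneg by (intro sum_mono2) auto
  also have "\<dots> \<le> vol" by (rule sum_close[OF i])
  finally show ?thesis .
qed

text \<open>Each event has probability of order \<open>p i / t\<close>. Summing \<open>p\<close>
  over \<open>D i\<close> gives at most \<open>vol\<close>, and over all \<open>i\<close> it gives
  \<open>t\<close>, hence the order \<open>vol / t\<close>.\<close>

lemma dependence_product:
  "(\<Sum>i<nW. \<Sum>i'\<in>D i. prob (E (lv 0) i) * prob (E (lv 0) i')) \<le> vol / t * exp (2 * (U + 1))"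
proof -
  have e: "prob (E (lv 0) i) \<le> p i / t * exp (U + 1)" if "i < nW" for i
  proof -
    have "prob (E (lv 0) i) \<le> p i / t * exp (2 * \<epsilon> - lv 0)"
      using prob_E_bounds(1)[OF that] lv_shift(1)[of 0] by simp
    also have "\<dots> \<le> p i / t * exp (U + 1)"
      using lv[of 0] eps p_nonneg t_facts by (intro mult_left_mono) (auto intro!: divide_nonneg_pos)
    finally show ?thesis .
  qed
  have "(\<Sum>i<nW. \<Sum>i'\<in>D i. prob (E (lv 0) i) * prob (E (lv 0) i'))
    \<le> (\<Sum>i<nW. p i * (vol / t / t * exp (2 * (U + 1))))"
  proof (rule sum_mono)
    fix i assume "i \<in> {..<nW}"
    then have i: "i < nW" by simp
    have "(\<Sum>i'\<in>D i. prob (E (lv 0) i) * prob (E (lv 0) i'))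
      \<le> (\<Sum>i'\<in>D i. (p i / t * exp (U + 1)) * (p i' / t * exp (U + 1)))"
      using e i t_facts p_nonneg by (intro sum_mono mult_mono) (auto simp: D_def)
    also have "\<dots> = (\<Sum>i'\<in>D i. (p i / t / t * exp (2 * (U + 1))) * p i')"
      by (intro sum.cong refl) (simp add: exp_add[symmetric] field_simps)
    also have "\<dots> = (p i / t / t * exp (2 * (U + 1))) * sum p (D i)"
      by (rule sum_distrib_left[symmetric])
    also have "\<dots> \<le> (p i / t / t * exp (2 * (U + 1))) * vol"
      using sum_D[OF i] p_nonneg t_facts by (intro mult_left_mono) auto
    finally show "(\<Sum>i'\<in>D i. prob (E (lv 0) i) * prob (E (lv 0) i')) \<le> p i * (vol / t / t * exp (2 * (U + 1)))"
      by (simp add: mult_ac)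
  qed
  also have "\<dots> = t * (vol / t / t * exp (2 * (U + 1)))" by (simp only: sum_distrib_right[symmetric] sum_p_W)
  finally show ?thesis using t_facts by simp
qed

text \<open>The geometric gain improves the void probability of a pair from 1/t to t^-(1 +
  \<kappa>). Without it the bound would be of order \<open>vol\<close>, which grows like ln
  t.\<close>

lemma dependence_pairs:
  "(\<Sum>i<nW. \<Sum>i'\<in>D i - {i}. prob (E (lv 0) i \<inter> E (lv 0) i')) \<le> vol * t powr (- \<kappa>) * exp (2 * (U + 1))"
proof -
  let ?G = "exp (2 * (U + 1)) * t powr (- \<kappa>) / t"
  have e: "prob (E (lv 0) i \<inter> E (lv 0) i') \<le> p i * p i' * ?G" if i: "i < nW" "i' < nW" "i \<noteq> i'" for i i'
  proof (cases "i' \<in> nb (lv 0) i \<or> i \<in> nb (lv 0) i'")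
    case True
    then have "prob (E (lv 0) i \<inter> E (lv 0) i') \<le> 0" using prob_E_pair[OF nW_n[OF i(1)] nW_n[OF i(2)] i(3), of "lv 0"] by simp
    also have "0 \<le> p i * p i' * ?G" using p_nonneg t_facts by simp
    finally show ?thesis .
  next
    case False
    have "(1 + \<kappa>) * (lv 0 + ln t) - 2 * \<epsilon> \<le> sum p (nb (lv 0) i \<union> nb (lv 0) i')"
      using sum_nb_pair[OF i(1,2) lv_shift(1)[of 0] i(3)] False by simp
    \<comment> \<open>A crude bound: \<open>1 + \<kappa> \<le> 2\<close>,
      \<open>\<bar>lv 0\<bar> \<le> U\<close> and \<open>2 * \<epsilon> \<le> 2\<close>.\<close>
    moreover have "- (1 + \<kappa>) * lv 0 + 2 * \<epsilon> \<le> 2 * (U + 1)"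
    proof -
      have "- (1 + \<kappa>) * lv 0 \<le> \<bar>(1 + \<kappa>) * lv 0\<bar>"
        unfolding mult_minus_left by (rule abs_ge_minus_self)
      also have "\<dots> \<le> 2 * U" unfolding abs_mult using kappa lv[of 0] by (intro mult_mono) auto
      finally show ?thesis using eps by simp
    qed
    ultimately have "- sum p (nb (lv 0) i \<union> nb (lv 0) i') \<le> 2 * (U + 1) + - \<kappa> * ln t + - ln t"
      by (simp add: algebra_simps)
    then have "exp (- sum p (nb (lv 0) i \<union> nb (lv 0) i')) \<le> exp (2 * (U + 1) + - \<kappa> * ln t + - ln t)" by simp
    also have "\<dots> = ?G" unfolding exp_add using t_facts by (simp add: powr_def exp_minus field_simps)
    finally have "p i * p i' * exp (- sum p (nb (lv 0) i \<union> nb (lv 0) i')) \<le> p i * p i' * ?G"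
      using p_nonneg by (intro mult_left_mono) auto
    then show ?thesis using False prob_E_pair[OF nW_n[OF i(1)] nW_n[OF i(2)] i(3), of "lv 0"] by simp
  qed
  have "(\<Sum>i<nW. \<Sum>i'\<in>D i - {i}. prob (E (lv 0) i \<inter> E (lv 0) i')) \<le> (\<Sum>i<nW. p i * (vol * ?G))"
  proof (rule sum_mono)
    fix i assume "i \<in> {..<nW}"
    then have i: "i < nW" by simp
    have "(\<Sum>i'\<in>D i - {i}. prob (E (lv 0) i \<inter> E (lv 0) i')) \<le> (\<Sum>i'\<in>D i - {i}. p i * ?G * p i')"
    proof (rule sum_mono)
      fix i' assume "i' \<in> D i - {i}"
      then show "prob (E (lv 0) i \<inter> E (lv 0) i') \<le> p i * ?G * p i'"
        using e[OF i, of i'] by (auto simp: D_def mult_ac)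
    qed
    also have "\<dots> \<le> (\<Sum>i'\<in>D i. p i * ?G * p i')"
      using p_nonneg t_facts by (intro sum_mono2) (auto simp: D_def)
    also have "\<dots> = p i * ?G * sum p (D i)" by (rule sum_distrib_left[symmetric])
    also have "\<dots> \<le> p i * ?G * vol" using sum_D[OF i] p_nonneg t_facts by (intro mult_left_mono) auto
    finally show "(\<Sum>i'\<in>D i - {i}. prob (E (lv 0) i \<inter> E (lv 0) i')) \<le> p i * (vol * ?G)" by (simp add: mult_ac)
  qed
  also have "\<dots> = t * (vol * ?G)" by (simp only: sum_distrib_right[symmetric] sum_p_W)
  finally show ?thesis using t_facts by (simp add: mult_ac)
qed

section \<open>The joint law of the counts at a fixed time\<close>

definition \<beta> :: real where "\<beta> = \<epsilon> + real (Suc m) * (10 * \<epsilon> * exp U)"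

lemma X_measurable: "X l \<in> measurable P (count_space UNIV)"
proof -
  have eq: "X l = (\<lambda>\<omega>. \<Sum>i<nW. if \<omega> \<in> Y i l then 1 else 0)"
    by (auto simp: X_def fun_eq_iff sum.If_cases Int_def)
  show ?thesis unfolding eq using Y_event by (intro measurable_sum_nat measurable_If_set) auto
qed

lemma xi_count_measurable: "xi_count l \<in> measurable P (count_space UNIV)"
  unfolding xi_count_def[abs_def]
  by (rule cm_count_xi_hat_measurable[OF mu_def f_meas mu_loc_fin W_compact lf cm_count_measurable])

lemma sum_prob_Y:
  assumes l: "l < m"
  shows "\<bar>(\<Sum>i<nW. prob (Y i l)) - (exp (- lv l) - exp (- lv (Suc l)))\<bar> \<le> 8 * \<epsilon> * exp U"
proof -
  have "prob (Y i l) = prob (E (lv l) i) - prob (E (lv (Suc l)) i)" if "i < nW" for i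
    unfolding Y_def using E_event[OF nW_n[OF that]] E_antimono[OF lv_mono[OF l]]
    by (intro finite_measure_Diff) auto
  then have "(\<Sum>i<nW. prob (Y i l)) = (\<Sum>i<nW. prob (E (lv l) i)) - (\<Sum>i<nW. prob (E (lv (Suc l)) i))"
    by (simp add: sum_subtractf)
  then show ?thesis
    using sum_prob_E_approx(1)[of "lv l"] sum_prob_E_approx(1)[of "lv (Suc l)"] lv[of l] lv[of "Suc l"] l by force
qed

lemma level_mass:
  assumes "l < m"
  shows "0 \<le> exp (- lv l) - exp (- lv (Suc l))" "exp (- lv l) - exp (- lv (Suc l)) \<le> exp U"
proof -
  show "0 \<le> exp (- lv l) - exp (- lv (Suc l))" using lv_mono[OF assms] by simp
  have "exp (- lv l) \<le> exp U" using lv[of l] assms by simp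
  then show "exp (- lv l) - exp (- lv (Suc l)) \<le> exp U" using exp_gt_zero[of "- lv (Suc l)"] by linarith
qed

lemma joint_law_approx:
  "\<bar>prob {\<omega>\<in>space P. \<forall>l<m. xi_count l \<omega> = k l} - prob {\<omega>\<in>space P. \<forall>l<m. X l \<omega> = k l}\<bar> \<le> \<beta>"
proof -
  have "\<bar>prob {\<omega>\<in>space P. \<forall>l<m. xi_count l \<omega> = k l} - prob {\<omega>\<in>space P. \<forall>l<m. X l \<omega> = k l}\<bar> \<le> prob bad"
  proof (rule prob_diff_le[OF joint_event[OF xi_count_measurable] joint_event[OF X_measurable] bad_event])
    show "{\<omega>\<in>space P. \<forall>l<m. xi_count l \<omega> = k l} - bad = {\<omega>\<in>space P. \<forall>l<m. X l \<omega> = k l} - bad"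
      using xi_count_eq_X by auto
  qed
  then show ?thesis using prob_bad by (simp add: \<beta>_def)
qed

text \<open>The terms with \<beta> arise from replacing \<open>xi_count\<close> by \<open>X\<close>
  at \<open>k\<close> and at the lowered vector, \<open>8 * \<epsilon> * exp U\<close> from
  replacing the mean by its limit, and the last \<epsilon> from the Chen--Stein bound.\<close>

lemma joint_law_recursion:
  assumes l: "l < m" and k: "1 \<le> k l"
  shows "\<bar>real (k l) * prob {\<omega>\<in>space P. \<forall>l<m. xi_count l \<omega> = k l}
     - (exp (- lv l) - exp (- lv (Suc l))) * prob {\<omega>\<in>space P. \<forall>l'<m. xi_count l' \<omega> = (k(l := k l - 1)) l'}\<bar>
     \<le> (real (k l) + exp U) * \<beta> + 8 * \<epsilon> * exp U + \<epsilon>"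
proof -
  let ?S = "\<lambda>k. prob {\<omega>\<in>space P. \<forall>l<m. X l \<omega> = k l}" and ?q = "\<lambda>k. prob {\<omega>\<in>space P. \<forall>l<m. xi_count l \<omega> = k l}"
  let ?k = "k(l := k l - 1)" and ?\<Lambda> = "exp (- lv l) - exp (- lv (Suc l))"
  \<comment> \<open>The dominating event belongs to the lowest level: \<open>E (lv 0) i\<close>
    contains \<open>Y i l\<close> for every class.\<close>
  have "\<bar>real (k l) * ?S k - (\<Sum>i\<in>{..<nW}. prob (Y i l)) * ?S ?k\<bar>
    \<le> (\<Sum>i\<in>{..<nW}. \<Sum>i'\<in>D i - {i}. prob (E (lv 0) i \<inter> E (lv 0) i')) + (\<Sum>i\<in>{..<nW}. \<Sum>i'\<in>D i. prob (E (lv 0) i) * prob (E (lv 0) i'))"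
    unfolding X_def
  proof (rule stein_recursion)
    fix i l assume i: "i \<in> {..<nW}" and l: "l < m"
    show "Y i l \<subseteq> E (lv 0) i" using E_antimono[OF lv_le[of 0 l]] l by (auto simp: Y_def)
    fix l' assume l': "l' < m" "l \<noteq> l'"
    have "lv (Suc l) \<le> lv l' \<or> lv (Suc l') \<le> lv l" using l l' lv_le[of "Suc l" l'] lv_le[of "Suc l'" l] by linarith
    then show "Y i l \<inter> Y i l' = {}" using E_antimono by (fastforce simp: Y_def)
  next
    fix i l k assume "i \<in> {..<nW}" "l < m"
    then show "prob (Y i l \<inter> {\<omega> \<in> space P. \<forall>l<m. card {i' \<in> {..<nW} - D i. \<omega> \<in> Y i' l} = k l}) =
       prob (Y i l) * prob {\<omega> \<in> space P. \<forall>l<m. card {i' \<in> {..<nW} - D i. \<omega> \<in> Y i' l} = k l}"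
      using indep_Y[of i l k] by simp
  qed (use Y_event E_event nW_n l k in \<open>auto simp: D_def N_def\<close>)
  then have 1: "\<bar>real (k l) * ?S k - (\<Sum>i<nW. prob (Y i l)) * ?S ?k\<bar> \<le> \<epsilon>"
    using dependence_product dependence_pairs small_vol by linarith
  have 2: "\<bar>real (k l) * ?q k - real (k l) * ?S k\<bar> \<le> real (k l) * \<beta>"
    using joint_law_approx[of k] by (simp add: abs_mult mult_left_mono flip: right_diff_distrib)
  have 3: "\<bar>((\<Sum>i<nW. prob (Y i l)) - ?\<Lambda>) * ?S ?k\<bar> \<le> (8 * \<epsilon> * exp U) * 1"
    unfolding abs_mult using sum_prob_Y[OF l] eps by (intro mult_mono) auto
  have 4: "\<bar>?\<Lambda> * (?S ?k - ?q ?k)\<bar> \<le> exp U * \<beta>"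
    unfolding abs_mult using level_mass[OF l] joint_law_approx[of ?k] by (intro mult_mono) auto
  have "real (k l) * ?q k - ?\<Lambda> * ?q ?k = (real (k l) * ?q k - real (k l) * ?S k)
    + (real (k l) * ?S k - (\<Sum>i<nW. prob (Y i l)) * ?S ?k) + ((\<Sum>i<nW. prob (Y i l)) - ?\<Lambda>) * ?S ?k + ?\<Lambda> * (?S ?k - ?q ?k)"
    by (simp only: left_diff_distrib right_diff_distrib)
  then have "\<bar>real (k l) * ?q k - ?\<Lambda> * ?q ?k\<bar> \<le> real (k l) * \<beta> + \<epsilon> + 8 * \<epsilon> * exp U + exp U * \<beta>"
    using 1 2 3 4 by linarith
  then show ?thesis by (simp only: distrib_right)
qed

text \<open>Markov's inequality is applied to \<open>X l\<close>, whose mean is under control, and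
  \<open>bad\<close> is paid for separately; the mean of \<open>xi_count l\<close> on
  \<open>bad\<close> is not estimated.\<close>

lemma joint_law_tight:
  "\<bar>(\<Sum>k\<in>{..<m} \<rightarrow>\<^sub>E {..K}. prob {\<omega>\<in>space P. \<forall>l<m. xi_count l \<omega> = k l}) - 1\<bar>
    \<le> \<beta> + real m * (exp U + 8 * \<epsilon> * exp U) / real (Suc K)"
proof -
  let ?M = "exp U + 8 * \<epsilon> * exp U"
  have "prob {\<omega>\<in>space P. \<not> (\<forall>l<m. xi_count l \<omega> \<le> K)} \<le> \<beta> + real m * ?M / real (Suc K)"
  proof -
    have ev: "{\<omega>\<in>space P. K < X l \<omega>} \<in> events" for l
      using measurable_sets[OF X_measurable[of l], of "{K<..}"] by (simp add: vimage_def Int_def conj_commute)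
    \<comment> \<open>Exceeding \<open>K\<close> means being at least \<open>Suc K\<close>, which
      also keeps the denominator positive.\<close>
    have single: "prob {\<omega>\<in>space P. K < X l \<omega>} \<le> ?M / real (Suc K)" if l: "l < m" for l
    proof -
      have "real (Suc K) * prob {\<omega>\<in>space P. K < X l \<omega>} = (\<integral>\<omega>. real (Suc K) * indicator {\<omega>\<in>space P. K < X l \<omega>} \<omega> \<partial>P)"
        using ev by simp
      also have "\<dots> \<le> (\<integral>\<omega>. (\<Sum>i<nW. indicator (Y i l) \<omega>) \<partial>P)"
      proof (rule integral_mono)
        show "integrable P (\<lambda>\<omega>. real (Suc K) * indicator {\<omega>\<in>space P. K < X l \<omega>} \<omega>)"
          using ev by (intro integrable_mult_right integrable_real_indicator) (auto simp: less_top[symmetric])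
        show "integrable P (\<lambda>\<omega>. \<Sum>i<nW. indicator (Y i l) \<omega> :: real)"
          using Y_event by (intro Bochner_Integration.integrable_sum integrable_real_indicator) (auto simp: less_top[symmetric])
        fix \<omega>
        have "(\<Sum>i<nW. indicator (Y i l) \<omega> :: real) = real (X l \<omega>)"
          by (simp add: X_def indicator_def sum.If_cases Int_def)
        then show "real (Suc K) * indicator {\<omega>\<in>space P. K < X l \<omega>} \<omega> \<le> (\<Sum>i<nW. indicator (Y i l) \<omega>)"
          by (simp add: indicator_def)
      qed
      also have "\<dots> = (\<Sum>i<nW. prob (Y i l))"
        using Y_event by (subst Bochner_Integration.integral_sum) (auto intro!: integrable_real_indicator simp: less_top[symmetric])
      also have "\<dots> \<le> ?M" using sum_prob_Y[OF l] level_mass(2)[OF l] by linarith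
      finally show ?thesis by (simp add: field_simps)
    qed
    have UX: "(\<Union>l<m. {\<omega>\<in>space P. K < X l \<omega>}) \<in> events" using ev by (intro sets.finite_UN) auto
    have "{\<omega>\<in>space P. \<not> (\<forall>l<m. xi_count l \<omega> \<le> K)} \<subseteq> bad \<union> (\<Union>l<m. {\<omega>\<in>space P. K < X l \<omega>})"
      using xi_count_eq_X by (fastforce simp: not_le)
    then have "prob {\<omega>\<in>space P. \<not> (\<forall>l<m. xi_count l \<omega> \<le> K)} \<le> prob (bad \<union> (\<Union>l<m. {\<omega>\<in>space P. K < X l \<omega>}))"
      using bad_event UX by (intro finite_measure_mono) auto
    moreover have "prob (bad \<union> (\<Union>l<m. {\<omega>\<in>space P. K < X l \<omega>})) \<le> prob bad + prob (\<Union>l<m. {\<omega>\<in>space P. K < X l \<omega>})"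
      using bad_event UX by (rule measure_Un_le)
    moreover have "prob (\<Union>l<m. {\<omega>\<in>space P. K < X l \<omega>}) \<le> (\<Sum>l<m. prob {\<omega>\<in>space P. K < X l \<omega>})"
      using ev by (intro finite_measure_subadditive_finite) auto
    moreover have "(\<Sum>l<m. prob {\<omega>\<in>space P. K < X l \<omega>}) \<le> (\<Sum>l<m. ?M / real (Suc K))"
      using single by (intro sum_mono) auto
    moreover have "(\<Sum>l<m. ?M / real (Suc K)) = real m * ?M / real (Suc K)" by simp
    moreover have "prob bad \<le> \<beta>" using prob_bad by (simp add: \<beta>_def)
    ultimately show ?thesis by linarith
  qed
  moreover have "prob {\<omega>\<in>space P. \<not> (\<forall>l<m. xi_count l \<omega> \<le> K)} = 1 - prob {\<omega>\<in>space P. \<forall>l<m. xi_count l \<omega> \<le> K}"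
    by (rule prob_neg) (rule joint_event[OF xi_count_measurable])
  moreover have "prob {\<omega>\<in>space P. \<forall>l<m. xi_count l \<omega> \<le> K} \<le> 1" by simp
  ultimately show ?thesis unfolding box_law[OF xi_count_measurable] by linarith
qed

end

section \<open>Convergence as the intensity tends to infinity\<close>

context voronoi_density
begin

definition grid_level :: "nat \<Rightarrow> nat \<Rightarrow> real" where "grid_level n l = - real n + real l / real n"

lemma grid_cell_level: "grid_cell n l = {grid_level n l..<grid_level n (Suc l)}"
  by (simp add: grid_cell_def grid_level_def)

lemma grid_level_bound: "n > 0 \<Longrightarrow> l \<le> 2 * n * n \<Longrightarrow> \<bar>grid_level n l\<bar> \<le> real n"
proof -
  assume n: "n > 0" and l: "l \<le> 2 * n * n"
  have "real l \<le> real (2 * n * n)" using l by (rule of_nat_mono)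
  then have "real l / real n \<le> 2 * real n" using n by (simp add: field_simps)
  then show ?thesis by (simp add: grid_level_def abs_le_iff)
qed

lemma grid_level_mono: "grid_level n l \<le> grid_level n (Suc l)"
  by (simp add: grid_level_def divide_right_mono)

text \<open>The bounds are free of \<open>t\<close>: only the threshold beyond which they hold
  depends on \<epsilon>. This permits the limit in \<open>t\<close> first and \<epsilon> to 0
  afterwards.\<close>

lemma eventually_grid_law:
  fixes P :: "real \<Rightarrow> 'm measure" and \<eta> :: "real \<Rightarrow> 'm \<Rightarrow> 'a \<Rightarrow> nat"
  assumes \<epsilon>: "0 < \<epsilon>" "\<epsilon> \<le> 1 / 4" and n: "0 < n"
    and eta: "\<And>t. 0 < t \<Longrightarrow> poisson_process (P t) (\<eta> t) (scale_measure (ennreal t) \<mu>)"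
  defines "m \<equiv> 2 * n * n" and "U \<equiv> real n"
  defines "\<beta> \<equiv> \<epsilon> + real (Suc m) * (10 * \<epsilon> * exp U)"
    and "c \<equiv> \<lambda>l. exp (- grid_level n l) - exp (- grid_level n (Suc l))"
    and "p \<equiv> \<lambda>t k. measure (P t) {\<omega>\<in>space (P t). \<forall>l<m. cm_count (xi_hat \<mu> W t (\<eta> t \<omega>)) (grid_cell n l) = k l}"
  shows "eventually (\<lambda>t.
     (\<forall>l k. l < m \<longrightarrow> 1 \<le> k l \<longrightarrow> \<bar>real (k l) * p t k - c l * p t (k(l := k l - 1))\<bar>
        \<le> (real (k l) + exp U) * \<beta> + 8 * \<epsilon> * exp U + \<epsilon>) \<and>
     (\<forall>K. \<bar>(\<Sum>k\<in>{..<m} \<rightarrow>\<^sub>E {..K}. p t k) - 1\<bar> \<le> \<beta> + real m * (exp U + 8 * \<epsilon> * exp U) / real (Suc K))) at_top"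
proof -
  define \<kappa> where "\<kappa> = a1 / (a2 * 4 ^ DIM('a))"
  have "\<kappa> > 0" using a1 a2 by (simp add: \<kappa>_def)
  define k0 where "k0 = 4 * 3 ^ DIM('a) * (a2 / a1)"
  define k1 where "k1 = exp (2 * (U + 1))"
  have "U \<ge> 0" by (simp add: U_def)
  have "((\<lambda>t. k0 * ln t / t * k1 + k0 * ln t * t powr (- \<kappa>) * k1) \<longlongrightarrow> 0) at_top"
  proof -
    have "((\<lambda>t::real. ln t / t) \<longlongrightarrow> 0) at_top" by real_asymp
    moreover have "((\<lambda>t. ln t * t powr (- \<kappa>)) \<longlongrightarrow> 0) at_top" using \<open>\<kappa> > 0\<close> by real_asymp
    ultimately have "((\<lambda>t. (k0 * k1) * (ln t / t) + (k0 * k1) * (ln t * t powr (- \<kappa>))) \<longlongrightarrow> (k0 * k1) * 0 + (k0 * k1) * 0) at_top"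
      by (intro tendsto_intros)
    then show ?thesis by (simp add: mult_ac)
  qed
  then have "eventually (\<lambda>t. k0 * ln t / t * k1 + k0 * ln t * t powr (- \<kappa>) * k1 < \<epsilon>) at_top"
    using \<epsilon> by (intro order_tendstoD) auto
  moreover have "((\<lambda>t. v * a2 / t) \<longlongrightarrow> 0) at_top" by real_asymp
  then have "eventually (\<lambda>t. v * a2 / t < \<epsilon>) at_top" using \<epsilon> by (intro order_tendstoD) auto
  ultimately show ?thesis
    using eventually_voronoi_scale[OF \<epsilon> \<open>U \<ge> 0\<close>] eventually_gt_at_top[of "0::real"]
  proof eventually_elim
    case (elim t)
    interpret voronoi_scale f \<mu> W C b a1 a2 \<rho> t \<epsilon> U by (rule elim)
    obtain n' nW z Q where "voronoi_grid f \<mu> W C b a1 a2 \<rho> t \<epsilon> U n' nW z Q"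
      using voronoi_grid_exists by blast
    then interpret G: voronoi_grid f \<mu> W C b a1 a2 \<rho> t \<epsilon> U n' nW z Q .
    interpret G: voronoi_poisson f \<mu> W C b a1 a2 \<rho> t \<epsilon> U n' nW z Q "P t" "\<eta> t" m "grid_level n"
    proof
      show "poisson_process (P t) (\<eta> t) (scale_measure (ennreal t) \<mu>)" by (rule eta) fact
      show "v * a2 / t \<le> \<epsilon>" using elim by simp
      show "G.vol / t * exp (2 * (U + 1)) + G.vol * t powr (- G.\<kappa>) * exp (2 * (U + 1)) \<le> \<epsilon>"
        using elim(1) unfolding G.vol_def G.\<kappa>_def k0_def k1_def \<kappa>_def by simp
      show "\<bar>grid_level n l\<bar> \<le> U" if "l \<le> m" for l
        using grid_level_bound[OF n] that by (simp add: m_def U_def)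
      show "grid_level n l \<le> grid_level n (Suc l)" for l by (rule grid_level_mono)
    qed
    have p: "p t k = G.prob {\<omega>\<in>space (P t). \<forall>l<m. G.xi_count l \<omega> = k l}" for k
      by (simp only: p_def G.xi_count_def grid_cell_level)
    have \<beta>: "\<beta> = G.\<beta>" by (simp only: \<beta>_def G.\<beta>_def)
    show ?case
      unfolding p \<beta> c_def using G.joint_law_recursion G.joint_law_tight by blast
  qed
qed

lemma grid_law_tendsto:
  fixes P :: "real \<Rightarrow> 'm measure" and \<eta> :: "real \<Rightarrow> 'm \<Rightarrow> 'a \<Rightarrow> nat"
    and M :: "real measure" and Q :: "'n measure" and \<zeta> :: "'n \<Rightarrow> real \<Rightarrow> nat"
  assumes n: "0 < n"
    and eta: "\<And>t. 0 < t \<Longrightarrow> poisson_process (P t) (\<eta> t) (scale_measure (ennreal t) \<mu>)"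
    and M: "sets M = sets borel" "\<And>u. emeasure M {u..} = ennreal (exp (- u))"
    and \<zeta>: "poisson_process Q \<zeta> M"
  shows "((\<lambda>t. measure (P t) {\<omega>\<in>space (P t). \<forall>l<2*n*n. cm_count (xi_hat \<mu> W t (\<eta> t \<omega>)) (grid_cell n l) = k l})
     \<longlongrightarrow> measure Q {\<omega>\<in>space Q. \<forall>l<2*n*n. cm_count (\<zeta> \<omega>) (grid_cell n l) = k l}) at_top"
proof -
  interpret Q: prob_space Q using \<zeta> by (simp add: poisson_process_def)
  define m where "m = 2 * n * n"
  define U where "U = real n"
  define c where "c l = exp (- grid_level n l) - exp (- grid_level n (Suc l))" for l
  define p where "p t k = measure (P t) {\<omega>\<in>space (P t). \<forall>l<m. cm_count (xi_hat \<mu> W t (\<eta> t \<omega>)) (grid_cell n l) = k l}" for t k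
  define \<pi> where "\<pi> k = measure Q {\<omega>\<in>space Q. \<forall>l<m. cm_count (\<zeta> \<omega>) (grid_cell n l) = k l}" for k
  have m: "m > 0" using n by (simp add: m_def)
  have cell: "measure M (grid_cell n l) = c l" for l
    unfolding grid_cell_level c_def by (rule half_line_measure_interval[OF M grid_level_mono])
  have grid_borel: "grid_cell n l \<in> sets borel" for l by (simp add: grid_cell_def)
  have \<pi>: "\<pi> k = (\<Prod>l<m. c l ^ k l / fact (k l) * exp (- c l))" for k
    unfolding \<pi>_def
    by (subst poisson_joint_law[OF \<zeta> _ disjoint_grid_cell m])
       (simp_all add: bounded_grid_cell grid_borel cell)
  define g where "g \<epsilon> = \<epsilon> + real (Suc m) * (10 * \<epsilon> * exp U)" for \<epsilon>
  have law: "eventually (\<lambda>t.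
     (\<forall>l k. l < m \<longrightarrow> 1 \<le> k l \<longrightarrow> \<bar>real (k l) * p t k - c l * p t (k(l := k l - 1))\<bar>
        \<le> (real (k l) + exp U) * g \<epsilon> + 8 * \<epsilon> * exp U + \<epsilon>) \<and>
     (\<forall>K. \<bar>(\<Sum>k\<in>{..<m} \<rightarrow>\<^sub>E {..K}. p t k) - 1\<bar> \<le> g \<epsilon> + real m * (exp U + 8 * \<epsilon> * exp U) / real (Suc K))) at_top"
    if "0 < \<epsilon>" "\<epsilon> \<le> 1 / 4" for \<epsilon>
    unfolding p_def c_def g_def m_def U_def by (rule eventually_grid_law[OF that n eta])
  have \<epsilon>_ex: "\<exists>\<epsilon>>0. \<epsilon> \<le> 1 / 4 \<and> h * \<epsilon> < e" if "0 < h" "0 < e" for h e :: real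
    using that by (intro exI[of _ "min (1/4) (e / (2 * h))"]) (auto simp: min_def field_simps)
  have "((\<lambda>t. p t k) \<longlongrightarrow> \<pi> k) at_top"
  proof (rule poisson_recursion_limit[where m = m and c = c and p = p and \<pi> = \<pi>])
    fix l and k :: "nat \<Rightarrow> nat" assume l: "l < m" "1 \<le> k l"
    show "((\<lambda>t. real (k l) * p t k - c l * p t (k(l := k l - 1))) \<longlongrightarrow> 0) at_top"
    proof (rule tendstoI)
      fix e :: real assume e: "e > 0"
      \<comment> \<open>The error is linear in \<epsilon>, and \<open>h\<close> is its
        coefficient.\<close>
      define h where "h = (real (k l) + exp U) * (1 + real (Suc m) * (10 * exp U)) + 8 * exp U + 1"
      have "h > 0" by (simp add: h_def add_nonneg_pos add_pos_nonneg)
      then obtain \<epsilon> where \<epsilon>: "0 < \<epsilon>" "\<epsilon> \<le> 1 / 4" "h * \<epsilon> < e" using \<epsilon>_ex[OF _ e] by blast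
      have "(real (k l) + exp U) * g \<epsilon> + 8 * \<epsilon> * exp U + \<epsilon> = h * \<epsilon>"
        by (simp add: h_def g_def algebra_simps)
      with \<epsilon>(3) have less: "(real (k l) + exp U) * g \<epsilon> + 8 * \<epsilon> * exp U + \<epsilon> < e" by simp
      show "eventually (\<lambda>t. dist (real (k l) * p t k - c l * p t (k(l := k l - 1))) 0 < e) at_top"
        using law[OF \<epsilon>(1,2)]
      proof eventually_elim
        case (elim t)
        then have "\<bar>real (k l) * p t k - c l * p t (k(l := k l - 1))\<bar> \<le> (real (k l) + exp U) * g \<epsilon> + 8 * \<epsilon> * exp U + \<epsilon>"
          using l by blast
        then show ?case using less unfolding dist_real_def diff_0_right by (rule order.strict_trans1)
      qed
    qed
    show "real (k l) * \<pi> k = c l * \<pi> (k(l := k l - 1))"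
      unfolding \<pi> by (rule poisson_weight_recursion[of l m k c, OF l])
  next
    fix t :: real and k k' :: "nat \<Rightarrow> nat" assume "\<And>l. l < m \<Longrightarrow> k l = k' l"
    then show "p t k = p t k'" "\<pi> k = \<pi> k'" by (simp_all add: p_def \<pi>_def cong: conj_cong)
  next
    show "eventually (\<lambda>t. \<forall>k. 0 \<le> p t k \<and> p t k \<le> 1) at_top"
      using eventually_gt_at_top[of 0]
    proof eventually_elim
      case (elim t)
      interpret prob_space "P t" using eta[OF elim] by (simp add: poisson_process_def)
      show ?case by (simp add: p_def)
    qed
    show "0 \<le> \<pi> k \<and> \<pi> k \<le> 1" for k by (simp add: \<pi>_def)
    show "\<pi> (\<lambda>_. 0) > 0" unfolding \<pi> by (intro prod_pos) simp
  next
    fix e :: real assume e: "e > 0"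
    \<comment> \<open>Order of choice: \<epsilon> makes the part independent of \<open>K\<close>
      small; then one \<open>K\<close> settles both the Markov term and the tail of the limit
      law.\<close>
    define h where "h = 1 + real (Suc m) * (10 * exp U)"
    have "h > 0" by (simp add: h_def add_pos_nonneg)
    then obtain \<epsilon> where \<epsilon>: "0 < \<epsilon>" "\<epsilon> \<le> 1 / 4" "h * \<epsilon> < e / 2" using \<epsilon>_ex[of h "e / 2"] e by auto
    have "g \<epsilon> = h * \<epsilon>" by (simp add: h_def g_def algebra_simps)
    with \<epsilon>(3) have g: "g \<epsilon> < e / 2" by simp
    have "(\<lambda>K. real m * (exp U + 8 * \<epsilon> * exp U) * inverse (real (Suc K))) \<longlonglongrightarrow> real m * (exp U + 8 * \<epsilon> * exp U) * 0"
      by (intro tendsto_mult_left LIMSEQ_inverse_real_of_nat)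
    then have "eventually (\<lambda>K. real m * (exp U + 8 * \<epsilon> * exp U) * inverse (real (Suc K)) < e / 2) sequentially"
      using e by (intro order_tendstoD) auto
    moreover have "(\<lambda>K. \<Sum>k\<in>{..<m} \<rightarrow>\<^sub>E {..K}. \<pi> k) \<longlonglongrightarrow> 1"
      unfolding \<pi>_def
    proof (rule Q.box_law_tendsto)
      show "(\<lambda>\<omega>. cm_count (\<zeta> \<omega>) (grid_cell n l)) \<in> measurable Q (count_space UNIV)" for l
        using \<zeta> bounded_grid_cell[of n l] by (simp add: poisson_process_def grid_cell_def)
    qed
    then have "eventually (\<lambda>K. dist (\<Sum>k\<in>{..<m} \<rightarrow>\<^sub>E {..K}. \<pi> k) 1 < e) sequentially"
      using e by (rule tendstoD)
    ultimately have "eventually (\<lambda>K. real m * (exp U + 8 * \<epsilon> * exp U) * inverse (real (Suc K)) < e / 2 \<and>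
        dist (\<Sum>k\<in>{..<m} \<rightarrow>\<^sub>E {..K}. \<pi> k) 1 < e) sequentially"
      by (rule eventually_conj)
    then obtain K where K: "real m * (exp U + 8 * \<epsilon> * exp U) / real (Suc K) < e / 2"
        "\<bar>(\<Sum>k\<in>{..<m} \<rightarrow>\<^sub>E {..K}. \<pi> k) - 1\<bar> < e"
      unfolding eventually_sequentially dist_real_def divide_inverse by blast
    have "eventually (\<lambda>t. \<bar>(\<Sum>k\<in>{..<m} \<rightarrow>\<^sub>E {..K}. p t k) - 1\<bar> \<le> e) at_top"
      using law[OF \<epsilon>(1,2)]
    proof eventually_elim
      case (elim t)
      then have "\<bar>(\<Sum>k\<in>{..<m} \<rightarrow>\<^sub>E {..K}. p t k) - 1\<bar> \<le> g \<epsilon> + real m * (exp U + 8 * \<epsilon> * exp U) / real (Suc K)" by blast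
      then show ?case using K(1) g by linarith
    qed
    then show "\<exists>K. eventually (\<lambda>t. \<bar>(\<Sum>k\<in>{..<m} \<rightarrow>\<^sub>E {..K}. p t k) - 1\<bar> \<le> e) at_top \<and>
        \<bar>(\<Sum>k\<in>{..<m} \<rightarrow>\<^sub>E {..K}. \<pi> k) - 1\<bar> \<le> e"
      using K(2) by (intro exI[of _ K]) auto
  qed
  then show ?thesis by (simp only: p_def \<pi>_def m_def)
qed

end

theorem theorem3p6:
  fixes f :: "'a::euclidean_space \<Rightarrow> real"
    and \<mu> :: "'a measure"
    and W :: "'a set"
    and P :: "real \<Rightarrow> 'm measure"
    and \<eta> :: "real \<Rightarrow> 'm \<Rightarrow> 'a \<Rightarrow> nat"
  assumes f_meas: "f \<in> borel_measurable borel"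
    and f_nonneg: "\<And>x. 0 \<le> f x"
    and mu_def: "\<mu> = density lborel (\<lambda>x. ennreal (f x))"
    and mu_loc_fin: "\<And>B. bounded B \<Longrightarrow> emeasure \<mu> B < \<infinity>"
    and W_compact: "compact W"
    and mu_W: "emeasure \<mu> W = 1"
    and A: "\<exists>A. open A \<and> bounded A \<and> W \<subseteq> A \<and>
               (\<exists>a1 a2. 0 < a1 \<and> (\<forall>x\<in>A. a1 \<le> f x \<and> f x \<le> a2))"
    and hoelder: "\<exists>C b. 0 < C \<and> 0 < b \<and> (\<forall>x y. \<bar>f x - f y\<bar> \<le> C * norm (x - y) powr b)"
    and eta: "\<And>t. 0 < t \<Longrightarrow> poisson_process (P t) (\<eta> t) (scale_measure (ennreal t) \<mu>)"
  shows "\<forall>(M::real measure) (Q::'n measure) \<zeta>.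
           sets M = sets borel \<and> (\<forall>u. emeasure M {u..} = ennreal (exp (- u))) \<and>
           poisson_process Q \<zeta> M \<longrightarrow>
           conv_distr_cm P (\<lambda>t \<omega>. xi_hat \<mu> W t (\<eta> t \<omega>)) Q \<zeta>"
proof (intro allI impI, elim conjE)
  fix M :: "real measure" and Q :: "'n measure" and \<zeta>
  assume M: "sets M = sets borel" "\<forall>u. emeasure M {u..} = ennreal (exp (- u))"
    and \<zeta>: "poisson_process Q \<zeta> M"
  obtain A' a1 a2 where A': "open A'" "W \<subseteq> A'" and a1: "0 < a1" and bounds: "\<And>x. x \<in> A' \<Longrightarrow> a1 \<le> f x \<and> f x \<le> a2"
    using A by blast
  obtain C b where Cb: "0 < C" "0 < b" "\<And>x y. \<bar>f x - f y\<bar> \<le> C * norm (x - y) powr b"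
    using hoelder by blast
  \<comment> \<open>Compactness of \<open>W\<close> gives one radius for all its points; it is then
    capped at 1.\<close>
  obtain \<rho> where \<rho>: "\<rho> > 0" "(\<Union>x\<in>W. cball x \<rho>) \<subseteq> A'"
    using compact_subset_open_imp_cball_epsilon_subset[OF W_compact A'] by blast
  interpret voronoi_density f \<mu> W C b a1 a2 "min \<rho> 1"
  proof
    show "measure \<mu> W = 1" using mu_W by (simp add: measure_def)
    show "a1 \<le> f y \<and> f y \<le> a2" if "x \<in> W" "dist x y \<le> min \<rho> 1" for x y
      using that \<rho>(2) by (intro bounds) force
  qed (use assms \<rho> Cb a1 in auto)
  have W_bounded: "bounded W" using W_compact by (rule compact_imp_bounded)
  show "conv_distr_cm P (\<lambda>t \<omega>. xi_hat \<mu> W t (\<eta> t \<omega>)) Q \<zeta>"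
  proof (rule conv_distr_cmI)
    show "prob_space Q" using \<zeta> by (simp add: poisson_process_def)
    \<comment> \<open>Nothing is assumed about \<open>P t\<close> for \<open>t \<le> 0\<close>, so
      these properties hold eventually only.\<close>
    show "eventually (\<lambda>t. prob_space (P t)) at_top"
      using eventually_gt_at_top[of 0] by eventually_elim (use eta in \<open>simp add: poisson_process_def\<close>)
    show "eventually (\<lambda>t. \<forall>\<omega>\<in>space (P t). locally_finite_cm (xi_hat \<mu> W t (\<eta> t \<omega>))) at_top"
      using eventually_gt_at_top[of 0]
      by eventually_elim (use eta in \<open>auto simp: poisson_process_def intro: locally_finite_xi_hat[OF _ W_bounded]\<close>)
    show "eventually (\<lambda>t. \<forall>n l. (\<lambda>\<omega>. cm_count (xi_hat \<mu> W t (\<eta> t \<omega>)) (grid_cell n l)) \<in> measurable (P t) (count_space UNIV)) at_top"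
      using eventually_gt_at_top[of 0]
    proof eventually_elim
      case (elim t)
      show ?case unfolding grid_cell_def
        using eta[OF elim] by (intro allI cm_count_xi_hat_measurable[OF mu_def f_meas mu_loc_fin W_compact]) (auto simp: poisson_process_def)
    qed
    show "locally_finite_cm (\<zeta> \<omega>)" if "\<omega> \<in> space Q" for \<omega> using \<zeta> that by (simp add: poisson_process_def)
    show "(\<lambda>\<omega>. cm_count (\<zeta> \<omega>) (grid_cell n l)) \<in> measurable Q (count_space UNIV)" for n l
      using \<zeta> bounded_grid_cell[of n l] by (simp add: poisson_process_def grid_cell_def)
    show "((\<lambda>t. measure (P t) {\<omega>\<in>space (P t). \<forall>l<2*n*n. cm_count (xi_hat \<mu> W t (\<eta> t \<omega>)) (grid_cell n l) = k l})
      \<longlongrightarrow> measure Q {\<omega>\<in>space Q. \<forall>l<2*n*n. cm_count (\<zeta> \<omega>) (grid_cell n l) = k l}) at_top" if "n > 0" for n k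
      using M by (intro grid_law_tendsto[OF that eta _ _ \<zeta>]) auto
  qed
qed

end
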